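(* Let $X$ be a Banach space over $\mathbb{K}\in\{\mathbb{R},\mathbb{C}\}$ and $N\in\mathbb{N}$. (1) The set $\mathrm{NA}_{\mathrm{nu}}({}^N X)$ of nuclear $N$-homogeneous polynomials on $X$ that attain their nuclear norm is $w^*$-dense in $\mathcal{P}_{\mathcal I}({}^N X)$. (2) If $\widehat\otimes_{\varepsilon,s,N}X$ does not contain any isomorphic copy of $\ell_1$, then $\mathrm{NA}_{\mathrm{nu}}({}^N X)$ is norm-dense in $\mathcal{P}_{\mathcal I}({}^N X)$.
   Context: For $x\in X$ write $x^N=x\otimes\cdots\otimes x$ ($N$ times); $\otimes_{s,N}X$ is the linear span of $\{x^N:x\in X\}$ in the $N$-fold algebraic tensor product of $X$. $\widehat\otimes_{\varepsilon,s,N}X$ is the completion of $\otimes_{s,N}X$ under the symmetric injective norm $\|z\|=\sup_{x^*\in B_{X^*}}|\sum_j\lambda_j x^*(x_j)^N|$ for $z=\sum_j\lambda_jx_j^N$; thus it embeds isometrically in $C(B_{X^*},w^* )$. An $N$-homogeneous polynomial $P$ on $X$ is integral if there is a Radon measure ($\mathbb{K}$-valued finite regular Borel measure) $\mu$ on $(B_{X^*},w^* )$ with $P(x)=\int_{B_{X^*}}x^*(x)^N\,d\mu(x^* )$ for all $x\in X$; $\|P\|_{\mathcal I}$ is the infimum of the total variations of such $\mu$. $\mathcal{P}_{\mathcal I}({}^N X)$ is the space of integral $N$-homogeneous polynomials with norm $\|\cdot\|_{\mathcal I}$; it is canonically isometric to $(\widehat\otimes_{\varepsilon,s,N}X)^*$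 via $\langle P,x^N\rangle=P(x)$, and its $w^*$-topology is the one from this duality. Norm-density is with respect to $\|\cdot\|_{\mathcal I}$. An $N$-homogeneous polynomial $P$ is nuclear if there are sequences $(\varphi_i)$ in $S_{X^*}$ and $(\lambda_i)$ in $\mathbb K$ with $\sum_i|\lambda_i|<\infty$ and $P(x)=\sum_{i=1}^\infty\lambda_i\varphi_i(x)^N$ for all $x\in X$; its nuclear norm is the infimum of $\sum_i|\lambda_i|$ over all such representations. $P$ attains its nuclear norm if this infimum is realized by some representation; $\mathrm{NA}_{\mathrm{nu}}({}^N X)$ is the set of such $P$. Every nuclear polynomial is integral with $\|P\|_{\mathcal I}\le\|P\|_{\mathrm{nu}}$. *)

theory Defs
  imports "HOL-Analysis.Analysis"
begin

section \<open>Scalars and Banach spaces over them\<close>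

text \<open>The scalar field is the real or the complex numbers: the class axiom asks for an isometric
  field embedding into the complex numbers whose range is one of these two fields.\<close>

class real_or_complex = real_normed_field + euclidean_space +
  assumes isometric_to_real_or_complex:
    "\<exists>\<iota> :: 'a \<Rightarrow> complex.
       (\<forall>a b. \<iota> (a + b) = \<iota> a + \<iota> b) \<and> (\<forall>a b. \<iota> (a * b) = \<iota> a * \<iota> b) \<and>
       (\<forall>a. norm (\<iota> a) = norm a) \<and> (range \<iota> = \<real> \<or> range \<iota> = UNIV)"

instance real :: real_or_complex
  by standard (rule exI[of _ complex_of_real], auto simp: Reals_def)

instance complex :: real_or_complex
  by standard (rule exI[of _ "\<lambda>z. z"], auto)

text \<open>The library has no class of complex normed spaces. The norm, the metric and completeness come
  from the class \<^class>\<open>banach\<close>; the scalar multiplication over the field is a parameter that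
  extends the real one.\<close>

locale banach_space_over = vector_space smul
  for smul :: "'k::real_or_complex \<Rightarrow> 'a::banach \<Rightarrow> 'a" +
  assumes norm_smul: "norm (smul c x) = norm c * norm x"
    and smul_of_real: "smul (of_real r) x = r *\<^sub>R x"

definition dual_space :: "('k::real_or_complex \<Rightarrow> 'a::banach \<Rightarrow> 'a) \<Rightarrow> ('a \<Rightarrow> 'k) set" where
  "dual_space smul = {\<phi>. Vector_Spaces.linear smul (*) \<phi> \<and> bounded_linear \<phi>}"

definition dual_ball :: "('k::real_or_complex \<Rightarrow> 'a::banach \<Rightarrow> 'a) \<Rightarrow> ('a \<Rightarrow> 'k) set" where
  "dual_ball smul = {\<phi> \<in> dual_space smul. onorm \<phi> \<le> 1}"

definition dual_sphere :: "('k::real_or_complex \<Rightarrow> 'a::banach \<Rightarrow> 'a) \<Rightarrow> ('a \<Rightarrow> 'k) set" where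
  "dual_sphere smul = {\<phi> \<in> dual_space smul. onorm \<phi> = 1}"

section \<open>Homogeneous polynomials\<close>

text \<open>An \<open>N\<close>-linear form takes lists of length \<open>N\<close>; its values on other lists are irrelevant.\<close>

definition multilinear_forms ::
    "('k::real_or_complex \<Rightarrow> 'a::banach \<Rightarrow> 'a) \<Rightarrow> nat \<Rightarrow> ('a list \<Rightarrow> 'k) set" where
  "multilinear_forms smul N =
     {A. \<forall>xs i. length xs = N \<longrightarrow> i < N \<longrightarrow> Vector_Spaces.linear smul (*) (\<lambda>v. A (xs[i := v]))}"

definition homogeneous_polynomial ::
    "('k::real_or_complex \<Rightarrow> 'a::banach \<Rightarrow> 'a) \<Rightarrow> nat \<Rightarrow> ('a \<Rightarrow> 'k) \<Rightarrow> bool" where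
  "homogeneous_polynomial smul N P \<longleftrightarrow>
     (\<exists>A \<in> multilinear_forms smul N.
        (\<exists>C. \<forall>xs. length xs = N \<longrightarrow> norm (A xs) \<le> C * prod_list (map norm xs)) \<and>
        (\<forall>x. P x = A (replicate N x)))"

section \<open>The symmetric injective tensor product\<close>

text \<open>The algebraic tensor product is modelled inside the algebraic dual of the space of all
  \<open>N\<close>-linear forms: the tensor of \<open>x\<^sub>1, \<dots>, x\<^sub>N\<close> is evaluation at \<open>[x\<^sub>1, \<dots>, x\<^sub>N]\<close>. The value 0 away
  from the multilinear forms makes this a function on the whole type.\<close>

definition tensor_power ::
    "('k::real_or_complex \<Rightarrow> 'a::banach \<Rightarrow> 'a) \<Rightarrow> nat \<Rightarrow> 'a \<Rightarrow> (('a list \<Rightarrow> 'k) \<Rightarrow> 'k)" where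
  "tensor_power smul N x = (\<lambda>A. if A \<in> multilinear_forms smul N then A (replicate N x) else 0)"

definition sym_tensors ::
    "('k::real_or_complex \<Rightarrow> 'a::banach \<Rightarrow> 'a) \<Rightarrow> nat \<Rightarrow> (('a list \<Rightarrow> 'k) \<Rightarrow> 'k) set" where
  "sym_tensors smul N =
     {z. \<exists>(m::nat) c x. z = (\<lambda>A. \<Sum>j<m. c j * tensor_power smul N (x j) A)}"

text \<open>The form \<open>\<lambda>xs. prod_list (map \<phi> xs)\<close> is the \<open>N\<close>-th power of \<open>\<phi>\<close>, so a tensor
  \<open>z = (\<Sum>j. c\<^sub>j x\<^sub>j\<^sup>N)\<close> is sent to the function \<open>\<phi> \<mapsto> (\<Sum>j. c\<^sub>j \<phi>(x\<^sub>j)\<^sup>N)\<close> on the dual ball. The symmetric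
  injective norm of \<open>z\<close> is the supremum norm of this function. Functions on the dual ball are
  represented by functions that vanish off it, so that vector operations are pointwise.\<close>

definition ball_function ::
    "('k::real_or_complex \<Rightarrow> 'a::banach \<Rightarrow> 'a) \<Rightarrow> (('a list \<Rightarrow> 'k) \<Rightarrow> 'k) \<Rightarrow> ('a \<Rightarrow> 'k) \<Rightarrow> 'k" where
  "ball_function smul z =
     (\<lambda>\<phi>. if \<phi> \<in> dual_ball smul then z (\<lambda>xs. prod_list (map \<phi> xs)) else 0)"

definition ball_norm ::
    "('k::real_or_complex \<Rightarrow> 'a::banach \<Rightarrow> 'a) \<Rightarrow> (('a \<Rightarrow> 'k) \<Rightarrow> 'k) \<Rightarrow> real" where
  "ball_norm smul f = (SUP \<phi>\<in>dual_ball smul. norm (f \<phi>))"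

text \<open>The completion is realised as the closure, for the supremum norm, of the isometric copy of the
  symmetric tensors in the continuous functions on the dual ball.\<close>

definition sym_inj_tensor_product ::
    "('k::real_or_complex \<Rightarrow> 'a::banach \<Rightarrow> 'a) \<Rightarrow> nat \<Rightarrow> (('a \<Rightarrow> 'k) \<Rightarrow> 'k) set" where
  "sym_inj_tensor_product smul N =
     {f. (\<exists>z. (\<forall>n. z n \<in> sym_tensors smul N) \<and>
              uniform_limit (dual_ball smul) (\<lambda>n. ball_function smul (z n)) f sequentially) \<and>
         (\<forall>\<phi>. \<phi> \<notin> dual_ball smul \<longrightarrow> f \<phi> = 0)}"

definition ell1 :: "(nat \<Rightarrow> 'k::real_or_complex) set" where
  "ell1 = {a. summable (\<lambda>n. norm (a n))}"

definition contains_ell1 ::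
    "(('b \<Rightarrow> 'k::real_or_complex) set) \<Rightarrow> (('b \<Rightarrow> 'k) \<Rightarrow> real) \<Rightarrow> bool" where
  "contains_ell1 Y nrm \<longleftrightarrow>
     (\<exists>T :: (nat \<Rightarrow> 'k) \<Rightarrow> ('b \<Rightarrow> 'k).
        (\<forall>a \<in> ell1. T a \<in> Y) \<and>
        (\<forall>a \<in> ell1. \<forall>b \<in> ell1. \<forall>c. T (\<lambda>n. c * a n + b n) = (\<lambda>t. c * T a t + T b t)) \<and>
        (\<exists>c > 0. \<exists>C. \<forall>a \<in> ell1.
           c * (\<Sum>n. norm (a n)) \<le> nrm (T a) \<and> nrm (T a) \<le> C * (\<Sum>n. norm (a n))))"

section \<open>Radon measures with values in the scalar field\<close>

text \<open>The topology on \<open>'a \<Rightarrow> 'k\<close> is the product topology, that is, pointwise convergence; on the dual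
  ball it is the weak-star topology. Only the space and the measurable sets of
  \<open>restrict_space borel (dual_ball smul)\<close> matter below: they are the dual ball and its Borel sets.\<close>

definition dual_ball_borel :: "('k::real_or_complex \<Rightarrow> 'a::banach \<Rightarrow> 'a) \<Rightarrow> ('a \<Rightarrow> 'k) measure" where
  "dual_ball_borel smul = restrict_space borel (dual_ball smul)"

definition scalar_measure :: "'b measure \<Rightarrow> ('b set \<Rightarrow> 'k::real_or_complex) \<Rightarrow> bool" where
  "scalar_measure M \<mu> \<longleftrightarrow>
     (\<forall>A :: nat \<Rightarrow> 'b set. range A \<subseteq> sets M \<longrightarrow> disjoint_family A \<longrightarrow>
        (\<lambda>i. \<mu> (A i)) sums \<mu> (\<Union>i. A i))"

definition variation :: "'b measure \<Rightarrow> ('b set \<Rightarrow> 'k::real_or_complex) \<Rightarrow> 'b set \<Rightarrow> ennreal" where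
  "variation M \<mu> E =
     (SUP \<A> \<in> {\<A>. finite \<A> \<and> \<A> \<subseteq> sets M \<and> disjoint \<A> \<and> \<Union>\<A> = E}. \<Sum>A\<in>\<A>. ennreal (norm (\<mu> A)))"

definition radon_measure ::
    "('k::real_or_complex \<Rightarrow> 'a::banach \<Rightarrow> 'a) \<Rightarrow> (('a \<Rightarrow> 'k) set \<Rightarrow> 'k) \<Rightarrow> bool" where
  "radon_measure smul \<mu> \<longleftrightarrow>
     scalar_measure (dual_ball_borel smul) \<mu> \<and>
     (\<forall>E \<in> sets (dual_ball_borel smul). \<forall>\<epsilon>>0. \<exists>K U.
        compactin (top_of_set (dual_ball smul)) K \<and> openin (top_of_set (dual_ball smul)) U \<and>
        K \<subseteq> E \<and> E \<subseteq> U \<and> variation (dual_ball_borel smul) \<mu> (U - K) < \<epsilon>)"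

text \<open>Integral of a bounded measurable function: the limit of the elementary integrals of simple
  functions converging uniformly to it. By finiteness of the total variation this limit does not
  depend on the approximating sequence.\<close>

definition has_scalar_integral ::
    "'b measure \<Rightarrow> ('b set \<Rightarrow> 'k::real_or_complex) \<Rightarrow> ('b \<Rightarrow> 'k) \<Rightarrow> 'k \<Rightarrow> bool" where
  "has_scalar_integral M \<mu> f I \<longleftrightarrow>
     (\<exists>s. (\<forall>n::nat. simple_function M (s n)) \<and> uniform_limit (space M) s f sequentially \<and>
        (\<lambda>n. \<Sum>y\<in>s n ` space M. y * \<mu> (s n -` {y} \<inter> space M)) \<longlonglongrightarrow> I)"

section \<open>Integral polynomials\<close>

definition representing_measures ::
    "('k::real_or_complex \<Rightarrow> 'a::banach \<Rightarrow> 'a) \<Rightarrow> nat \<Rightarrow> ('a \<Rightarrow> 'k) \<Rightarrow> (('a \<Rightarrow> 'k) set \<Rightarrow> 'k) set" where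
  "representing_measures smul N P =
     {\<mu>. radon_measure smul \<mu> \<and>
         (\<forall>x. has_scalar_integral (dual_ball_borel smul) \<mu> (\<lambda>\<phi>. \<phi> x ^ N) (P x))}"

definition integral_polynomials ::
    "('k::real_or_complex \<Rightarrow> 'a::banach \<Rightarrow> 'a) \<Rightarrow> nat \<Rightarrow> ('a \<Rightarrow> 'k) set" where
  "integral_polynomials smul N =
     {P. homogeneous_polynomial smul N P \<and> representing_measures smul N P \<noteq> {}}"

text \<open>The integral norm takes the value \<open>\<infinity>\<close> on polynomials that are not integral.\<close>

definition integral_norm ::
    "('k::real_or_complex \<Rightarrow> 'a::banach \<Rightarrow> 'a) \<Rightarrow> nat \<Rightarrow> ('a \<Rightarrow> 'k) \<Rightarrow> ennreal" where
  "integral_norm smul N P =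
     (INF \<mu> \<in> representing_measures smul N P. variation (dual_ball_borel smul) \<mu> (dual_ball smul))"

text \<open>The duality between an integral polynomial \<open>P\<close> and the completed tensor product: the bounded
  linear functional \<open>L\<close> on the latter that sends every \<open>x\<^sup>N\<close> to \<open>P x\<close>. It is unique on the completed
  tensor product because the \<open>x\<^sup>N\<close> span a dense subspace.\<close>

definition sym_inj_functionals ::
    "('k::real_or_complex \<Rightarrow> 'a::banach \<Rightarrow> 'a) \<Rightarrow> nat \<Rightarrow> ((('a \<Rightarrow> 'k) \<Rightarrow> 'k) \<Rightarrow> 'k) set" where
  "sym_inj_functionals smul N =
     {L. (\<forall>f \<in> sym_inj_tensor_product smul N. \<forall>g \<in> sym_inj_tensor_product smul N. \<forall>c.
            L (\<lambda>\<phi>. c * f \<phi> + g \<phi>) = c * L f + L g) \<and>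
         (\<exists>C. \<forall>f \<in> sym_inj_tensor_product smul N. norm (L f) \<le> C * ball_norm smul f)}"

definition pairing ::
    "('k::real_or_complex \<Rightarrow> 'a::banach \<Rightarrow> 'a) \<Rightarrow> nat \<Rightarrow> ('a \<Rightarrow> 'k) \<Rightarrow> (('a \<Rightarrow> 'k) \<Rightarrow> 'k) \<Rightarrow> 'k" where
  "pairing smul N P f =
     (THE v. \<exists>L \<in> sym_inj_functionals smul N.
        (\<forall>x. L (ball_function smul (tensor_power smul N x)) = P x) \<and> L f = v)"

definition weak_star_topology ::
    "('k::real_or_complex \<Rightarrow> 'a::banach \<Rightarrow> 'a) \<Rightarrow> nat \<Rightarrow> ('a \<Rightarrow> 'k) topology" where
  "weak_star_topology smul N =
     pullback_topology (integral_polynomials smul N)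
       (\<lambda>P. restrict (pairing smul N P) (sym_inj_tensor_product smul N))
       (product_topology (\<lambda>_. euclidean) (sym_inj_tensor_product smul N))"

section \<open>Nuclear polynomials\<close>

definition nuclear_representation ::
    "('k::real_or_complex \<Rightarrow> 'a::banach \<Rightarrow> 'a) \<Rightarrow> nat \<Rightarrow> ('a \<Rightarrow> 'k) \<Rightarrow>
     (nat \<Rightarrow> 'a \<Rightarrow> 'k) \<Rightarrow> (nat \<Rightarrow> 'k) \<Rightarrow> bool" where
  "nuclear_representation smul N P \<phi> c \<longleftrightarrow>
     (\<forall>i. \<phi> i \<in> dual_sphere smul) \<and> summable (\<lambda>i. norm (c i)) \<and>
     (\<forall>x. (\<lambda>i. c i * \<phi> i x ^ N) sums P x)"

definition nuclear_polynomials ::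
    "('k::real_or_complex \<Rightarrow> 'a::banach \<Rightarrow> 'a) \<Rightarrow> nat \<Rightarrow> ('a \<Rightarrow> 'k) set" where
  "nuclear_polynomials smul N =
     {P. homogeneous_polynomial smul N P \<and> (\<exists>\<phi> c. nuclear_representation smul N P \<phi> c)}"

definition nuclear_norm ::
    "('k::real_or_complex \<Rightarrow> 'a::banach \<Rightarrow> 'a) \<Rightarrow> nat \<Rightarrow> ('a \<Rightarrow> 'k) \<Rightarrow> real" where
  "nuclear_norm smul N P = Inf {\<Sum>i. norm (c i) | \<phi> c. nuclear_representation smul N P \<phi> c}"

definition NA_nu ::
    "('k::real_or_complex \<Rightarrow> 'a::banach \<Rightarrow> 'a) \<Rightarrow> nat \<Rightarrow> ('a \<Rightarrow> 'k) set" where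
  "NA_nu smul N =
     {P \<in> nuclear_polynomials smul N.
        \<exists>\<phi> c. nuclear_representation smul N P \<phi> c \<and> (\<Sum>i. norm (c i)) = nuclear_norm smul N P}"

end

theory Submission
  imports Defs "HOL-Library.Function_Algebras"
begin

text \<open>
  Let \<open>Y\<close> be the completed symmetric tensor product, a closed space of continuous functions on the
  weak-star compact dual ball, and let \<open>L\<close> be a functional on \<open>Y\<close>. Ekeland's variational principle on the
  unit ball of \<open>Y\<close> provides a point \<open>f\<close> such that, up to an arbitrarily small error in norm, \<open>Re L g\<close> is at
  least \<open>r\<close> times the minimum of \<open>Re (g / f)\<close> over the set where \<open>\<bar>f\<bar> = 1\<close>, for all \<open>g\<close>. By a minimax
  argument \<open>L\<close> is then \<open>r\<close> times a finitely additive mean of \<open>g / f\<close> over this set. Replacing the mean by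
  finite convex combinations gives sums \<open>\<Sum> c\<^sub>j \<phi>\<^sub>j\<^sup>N\<close> with \<open>c\<^sub>j f(\<phi>\<^sub>j) = \<bar>c\<^sub>j\<bar>\<close>; testing any other nuclear
  representation against \<open>f\<close> shows that these attain their nuclear norm. Weak-star approximation of a mean is
  always possible. If norm approximation fails, then an ultrafilter version of Haydon's argument yields
  an independent sequence in \<open>Y\<close>, hence a copy of \<open>\<ell>\<^sub>1\<close>. Finally, without a copy of \<open>\<ell>\<^sub>1\<close> the same norm
  approximation, iterated, represents a functional of small norm by a discrete measure of small variation,
  so that no Riesz representation theorem is needed to compare the integral norm with the norm of \<open>Y\<^sup>*\<close>.
\<close>

text \<open>The obstacle is that all atoms of an approximating sum must share one certificate: a
  single \<open>f\<close> in the unit ball of \<open>Y\<close>, not merely a continuous function on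
  \<open>K\<close>, that has modulus 1 at every atom and the right phase there. Discretising an
  arbitrary representing measure gives no such \<open>f\<close>. The functional therefore has to be
  moved first, by a small amount in norm, to one carried by the peak set of an element of
  \<open>Y\<close>; Ekeland's principle does this and supplies \<open>f\<close> at the same time. A
  finitely additive mean suffices because only finite convex combinations are ever extracted from
  it. For finitely many tests such combinations always exist: the mean is in the weak-star closed
  convex hull of the atoms. Uniformity over the unit ball of \<open>Y\<close> is a different matter,
  and independent sequences are exactly what obstructs it. Both scalar fields are treated at once:
  \<open>z \<bullet> 1\<close> is the real part of \<open>z\<close>, and sums over a real basis of
  the scalars replace a case distinction.\<close>

instantiation "fun" :: (type, real_vector) real_vector
begin

definition scaleR_fun_def: "r *\<^sub>R f = (\<lambda>x. r *\<^sub>R f x)"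

instance
  by standard (auto simp: scaleR_fun_def plus_fun_def algebra_simps)

end

lemma scaleR_fun_apply [simp]: "(r *\<^sub>R f) x = r *\<^sub>R f x"
  by (simp add: scaleR_fun_def)

section \<open>Hahn-Banach, means and ultrafilters\<close>

text \<open>A pair \<open>(v, c)\<close> stands for the constraint \<open>f v \<le> c\<close> on a
  linear functional \<open>f\<close> still to be found, and the closure rules combine constraints.
  In this form each application can list its own constraints without writing down a sublinear
  functional.\<close>

definition real_cone :: "('v::real_vector \<times> real) set \<Rightarrow> bool" where
  "real_cone G \<longleftrightarrow> (0, 0) \<in> G \<and> (\<forall>v c w d. (v, c) \<in> G \<longrightarrow> (w, d) \<in> G \<longrightarrow> (v + w, c + d) \<in> G) \<and>
     (\<forall>v c t. (v, c) \<in> G \<longrightarrow> t > 0 \<longrightarrow> (t *\<^sub>R v, t * c) \<in> G)"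

text \<open>A maximal cone in \<open>V \<times> \<real>\<close> that meets the fibre over 0 only in nonnegative numbers is the
  epigraph of a linear functional.\<close>

lemma hahn_banach_cone:
  fixes G0 :: "('v::real_vector \<times> real) set"
  assumes V: "subspace V" and G0: "real_cone G0" and pos: "\<And>c. (0, c) \<in> G0 \<Longrightarrow> c \<ge> 0"
    and dom: "\<And>v. v \<in> V \<Longrightarrow> \<exists>c. (v, c) \<in> G0"
  obtains f where "\<And>u v. u \<in> V \<Longrightarrow> v \<in> V \<Longrightarrow> f (u + v) = f u + f v"
    and "\<And>a v. v \<in> V \<Longrightarrow> f (a *\<^sub>R v) = a * f v"
    and "\<And>v c. v \<in> V \<Longrightarrow> (v, c) \<in> G0 \<Longrightarrow> f v \<le> c"
proof -
  define \<G> where "\<G> = {G. real_cone G \<and> G0 \<subseteq> G \<and> (\<forall>c. (0, c) \<in> G \<longrightarrow> c \<ge> 0)}"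
  have "G0 \<in> \<G>" using G0 pos by (auto simp: \<G>_def)
  have "\<exists>M\<in>\<G>. \<forall>X\<in>\<G>. M \<subseteq> X \<longrightarrow> X = M"
  proof (rule subset_Zorn_nonempty)
    show "\<G> \<noteq> {}" using \<open>G0 \<in> \<G>\<close> by blast
    fix C assume C: "C \<noteq> {}" "subset.chain \<G> C"
    then have sub: "C \<subseteq> \<G>" and ch: "\<And>X Y. X \<in> C \<Longrightarrow> Y \<in> C \<Longrightarrow> X \<subseteq> Y \<or> Y \<subseteq> X"
      by (auto simp: subset_chain_def)
    have "(v + w, c + d) \<in> \<Union>C" if vw: "(v, c) \<in> \<Union>C" "(w, d) \<in> \<Union>C" for v w c d
    proof -
      obtain X Y where XY: "(v, c) \<in> X" "(w, d) \<in> Y" "X \<in> C" "Y \<in> C" using vw by blast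
      then obtain Z where Z: "Z \<in> C" "(v, c) \<in> Z" "(w, d) \<in> Z" using ch by blast
      then have "real_cone Z" using sub by (auto simp: \<G>_def)
      then have "(v + w, c + d) \<in> Z" using Z unfolding real_cone_def by blast
      then show ?thesis using Z by blast
    qed
    moreover have "(0, 0) \<in> \<Union>C" using C sub by (auto simp: \<G>_def real_cone_def)
    moreover have "(t *\<^sub>R v, t * c) \<in> \<Union>C" if vw: "(v, c) \<in> \<Union>C" "t > 0" for v c t
      using vw sub by (fastforce simp: \<G>_def real_cone_def)
    ultimately have "real_cone (\<Union>C)" unfolding real_cone_def by blast
    moreover have "G0 \<subseteq> \<Union>C" using C sub by (auto simp: \<G>_def)
    moreover have "\<forall>c. (0, c) \<in> \<Union>C \<longrightarrow> c \<ge> 0" using sub by (auto simp: \<G>_def)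
    ultimately show "\<Union>C \<in> \<G>" by (simp add: \<G>_def)
  qed
  then obtain G where G: "G \<in> \<G>" and max: "\<And>X. X \<in> \<G> \<Longrightarrow> G \<subseteq> X \<Longrightarrow> X = G" by blast
  have cone: "real_cone G" and sub: "G0 \<subseteq> G" and posG: "\<And>c. (0, c) \<in> G \<Longrightarrow> c \<ge> 0"
    using G by (auto simp: \<G>_def)
  have add: "(v + w, c + d) \<in> G" if "(v, c) \<in> G" "(w, d) \<in> G" for v w c d
    using cone that by (auto simp: real_cone_def)
  have scl: "(t *\<^sub>R v, t * c) \<in> G" if "(v, c) \<in> G" "t > 0" for v c t
    using cone that by (auto simp: real_cone_def)
  have zero: "(0, 0) \<in> G" using cone by (auto simp: real_cone_def)
  \<comment> \<open>The tightest constraint imposed at \<open>v\<close>. The fibre is bounded below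
    because a constraint at \<open>- v\<close> adds up with it to one over 0. The cone rules make
    \<open>f\<close> sublinear; maximality enters only in \<open>f_neg\<close>.\<close>
  define f where "f v = Inf {c. (v, c) \<in> G}" for v
  have neg: "- v \<in> V" if "v \<in> V" for v using subspace_neg[OF V that] .
  have bdd: "bdd_below {c. (v, c) \<in> G}" if v: "v \<in> V" for v
  proof -
    obtain c' where c': "(- v, c') \<in> G" using dom[OF neg[OF v]] sub by blast
    have "- c' \<le> c" if "(v, c) \<in> G" for c
      using posG[of "c + c'"] add[OF that c'] by simp
    then show ?thesis by (auto simp: bdd_below_def)
  qed
  have ne: "{c. (v, c) \<in> G} \<noteq> {}" if v: "v \<in> V" for v using dom[OF v] sub by blast
  have f_le: "f v \<le> c" if "v \<in> V" "(v, c) \<in> G" for v c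
    unfolding f_def using bdd[OF that(1)] that(2) by (auto intro: cInf_lower)
  have f_ge: "b \<le> f v" if "v \<in> V" "\<And>c. (v, c) \<in> G \<Longrightarrow> b \<le> c" for v b
    unfolding f_def using ne[OF that(1)] that(2) by (auto intro: cInf_greatest)
  have f_scale: "f (t *\<^sub>R v) = t * f v" if v: "v \<in> V" and t: "t > 0" for v t
  proof (rule antisym)
    have tv: "t *\<^sub>R v \<in> V" using V v by (auto simp: subspace_def)
    have "f (t *\<^sub>R v) / t \<le> f v"
    proof (rule f_ge[OF v])
      fix c assume "(v, c) \<in> G"
      then show "f (t *\<^sub>R v) / t \<le> c"
        using f_le[OF tv scl[OF _ t]] t by (simp add: field_simps)
    qed
    then show "f (t *\<^sub>R v) \<le> t * f v" using t by (simp add: field_simps)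
    show "t * f v \<le> f (t *\<^sub>R v)"
    proof (rule f_ge[OF tv])
      fix c assume "(t *\<^sub>R v, c) \<in> G"
      then have "f v \<le> inverse t * c"
        using f_le[OF v] scl[of "t *\<^sub>R v" c "inverse t"] t by simp
      then show "t * f v \<le> c" using t by (simp add: field_simps)
    qed
  qed
  have f_sub: "f (u + v) \<le> f u + f v" if u: "u \<in> V" and v: "v \<in> V" for u v
  proof -
    have uv: "u + v \<in> V" using V u v by (auto simp: subspace_def)
    have "f (u + v) - f u \<le> f v"
    proof (rule f_ge[OF v])
      fix c assume c: "(v, c) \<in> G"
      have "f (u + v) - c \<le> f u"
      proof (rule f_ge[OF u])
        fix d assume "(u, d) \<in> G"
        then show "f (u + v) - c \<le> d" using f_le[OF uv add[OF _ c]] by fastforce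
      qed
      then show "f (u + v) - f u \<le> c" by simp
    qed
    then show ?thesis by simp
  qed
  have V0: "0 \<in> V" using V by (auto simp: subspace_def)
  have f0: "f 0 = 0" using f_le[OF V0 zero] f_ge[OF V0, of 0] posG by force
  have f_neg: "f (- w) = - f w" if w: "w \<in> V" for w
  proof (rule antisym)
    have nw: "- w \<in> V" using neg[OF w] .
    show "- f w \<le> f (- w)" using f_sub[OF w nw] f0 by simp
    \<comment> \<open>Adds the constraint \<open>f (- w) \<le> - f w\<close> with its nonnegative
      multiples. Over 0 nothing negative appears, since \<open>v1 = t1 *\<^sub>R w\<close> forces
      \<open>c1 \<ge> t1 * f w\<close>. By maximality the constraint was already in
      \<open>G\<close>, which turns subadditivity into additivity.\<close>
    define G' where "G' = {(v - t *\<^sub>R w, c - t * f w) | v c t. (v, c) \<in> G \<and> t \<ge> 0}"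
    have G'I: "(v - t *\<^sub>R w, c - t * f w) \<in> G'" if "(v, c) \<in> G" "t \<ge> 0" for v c t
      using that by (auto simp: G'_def)
    have "G \<subseteq> G'" using G'I[of _ _ 0] by auto
    have "real_cone G'"
      unfolding real_cone_def
    proof (intro conjI allI impI)
      show "(0, 0) \<in> G'" using G'I[OF zero, of 0] by simp
      fix v c assume vc: "(v, c) \<in> G'"
      then obtain v1 c1 t1 where 1: "v = v1 - t1 *\<^sub>R w" "c = c1 - t1 * f w" "(v1, c1) \<in> G" "t1 \<ge> 0"
        unfolding G'_def by blast
      show "(v + v', c + c') \<in> G'" if v': "(v', c') \<in> G'" for v' c'
      proof -
        obtain v2 c2 t2 where 2: "v' = v2 - t2 *\<^sub>R w" "c' = c2 - t2 * f w" "(v2, c2) \<in> G" "t2 \<ge> 0"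
          using v' unfolding G'_def by blast
        show ?thesis using G'I[OF add[OF 1(3) 2(3)], of "t1 + t2"] 1(4) 2(4)
          unfolding 1(1,2) 2(1,2) by (simp add: algebra_simps)
      qed
      show "(t *\<^sub>R v, t * c) \<in> G'" if "t > 0" for t
        using G'I[OF scl[OF 1(3) that], of "t * t1"] 1(4) that
        unfolding 1(1,2) by (simp add: algebra_simps)
    qed
    moreover have "c \<ge> 0" if c: "(0, c) \<in> G'" for c
    proof -
      obtain v1 c1 t1 where 1: "0 = v1 - t1 *\<^sub>R w" "c = c1 - t1 * f w" "(v1, c1) \<in> G" "t1 \<ge> 0"
        using c unfolding G'_def by blast
      then have v1: "v1 = t1 *\<^sub>R w" by simp
      then have "v1 \<in> V" using V w by (auto simp: subspace_def)
      then have "f v1 \<le> c1" using f_le 1 by blast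
      moreover have "f v1 = t1 * f w" using f_scale[OF w, of t1] v1 1(4) f0 by (cases "t1 = 0") auto
      ultimately show ?thesis using 1 by simp
    qed
    ultimately have "G' \<in> \<G>" using sub \<open>G \<subseteq> G'\<close> by (auto simp: \<G>_def)
    then have "G' = G" using max \<open>G \<subseteq> G'\<close> by blast
    moreover have "(- w, - f w) \<in> G'" using G'I[OF zero, of 1] by simp
    ultimately show "f (- w) \<le> - f w" using f_le[OF nw] by blast
  qed
  show thesis
  proof (rule that[of f])
    fix u v assume u: "u \<in> V" and v: "v \<in> V"
    have "f (- (u + v)) \<le> f (- u) + f (- v)"
      using f_sub[OF neg[OF u] neg[OF v]] by simp
    moreover have "u + v \<in> V" using V u v by (auto simp: subspace_def)
    ultimately show "f (u + v) = f u + f v" using f_sub[OF u v] f_neg u v by fastforce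
  next
    fix a :: real and v assume v: "v \<in> V"
    consider "a > 0" | "a = 0" | "a < 0" by linarith
    then show "f (a *\<^sub>R v) = a * f v"
    proof cases
      case 3
      then have "f ((- a) *\<^sub>R v) = - a * f v" using f_scale[OF v, of "- a"] by simp
      moreover have "a *\<^sub>R v \<in> V" using V v by (auto simp: subspace_def)
      ultimately show ?thesis using f_neg[of "a *\<^sub>R v"] by simp
    qed (use f_scale v f0 in auto)
  qed (use f_le sub in auto)
qed

section \<open>Means: finitely additive integration of bounded functions\<close>

definition bounded_on :: "'d set \<Rightarrow> ('d \<Rightarrow> real) set" where
  "bounded_on D = {u. \<exists>B. \<forall>x\<in>D. \<bar>u x\<bar> \<le> B}"

lemma bounded_onI: "(\<And>x. x \<in> D \<Longrightarrow> \<bar>u x\<bar> \<le> B) \<Longrightarrow> u \<in> bounded_on D"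
  by (auto simp: bounded_on_def)

lemma bounded_onE:
  assumes "u \<in> bounded_on D"
  obtains B where "B \<ge> 0" "\<And>x. x \<in> D \<Longrightarrow> \<bar>u x\<bar> \<le> B"
proof -
  obtain B where "\<forall>x\<in>D. \<bar>u x\<bar> \<le> B" using assms by (auto simp: bounded_on_def)
  then show thesis using that[of "max 0 B"] by fastforce
qed

lemma bounded_on_const [simp, intro]: "(\<lambda>_. c) \<in> bounded_on D"
  by (rule bounded_onI[of _ _ "\<bar>c\<bar>"]) auto

lemma bounded_on_add [intro]:
  assumes "u \<in> bounded_on D" "v \<in> bounded_on D"
  shows "(\<lambda>x. u x + v x) \<in> bounded_on D"
proof -
  obtain B where B: "\<And>x. x \<in> D \<Longrightarrow> \<bar>u x\<bar> \<le> B" using bounded_onE[OF assms(1)] by blast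
  obtain C where C: "\<And>x. x \<in> D \<Longrightarrow> \<bar>v x\<bar> \<le> C" using bounded_onE[OF assms(2)] by blast
  show ?thesis by (rule bounded_onI[of _ _ "B + C"]) (use B C in fastforce)
qed

lemma bounded_on_mult [intro]:
  assumes "u \<in> bounded_on D" "v \<in> bounded_on D"
  shows "(\<lambda>x. u x * v x) \<in> bounded_on D"
proof -
  obtain B where B: "B \<ge> 0" "\<And>x. x \<in> D \<Longrightarrow> \<bar>u x\<bar> \<le> B" using bounded_onE[OF assms(1)] by blast
  obtain C where C: "C \<ge> 0" "\<And>x. x \<in> D \<Longrightarrow> \<bar>v x\<bar> \<le> C" using bounded_onE[OF assms(2)] by blast
  show ?thesis
    by (rule bounded_onI[of _ _ "B * C"]) (use B C in \<open>auto simp: abs_mult intro!: mult_mono\<close>)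
qed

lemma bounded_on_minus [intro]: "u \<in> bounded_on D \<Longrightarrow> (\<lambda>x. - u x) \<in> bounded_on D"
  by (auto simp: bounded_on_def)

lemma bounded_on_indicator [simp, intro]: "indicator A \<in> bounded_on D"
  by (rule bounded_onI[of _ _ 1]) (auto simp: indicator_def)

lemma bounded_on_sum [intro]:
  "(\<And>i. i \<in> I \<Longrightarrow> u i \<in> bounded_on D) \<Longrightarrow> (\<lambda>x. \<Sum>i\<in>I. u i x) \<in> bounded_on D"
  by (induction I rule: infinite_finite_induct) auto

text \<open>A finitely additive probability on all subsets of \<open>D\<close>, given by its
  integral. The last clause carries both positivity and normalisation: on constants and their
  negatives it yields \<open>mean_const\<close>.\<close>

definition mean :: "'d set \<Rightarrow> (('d \<Rightarrow> real) \<Rightarrow> real) \<Rightarrow> bool" where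
  "mean D m \<longleftrightarrow> (\<forall>u\<in>bounded_on D. \<forall>v\<in>bounded_on D. m (\<lambda>x. u x + v x) = m u + m v) \<and>
     (\<forall>u\<in>bounded_on D. \<forall>a. m (\<lambda>x. a * u x) = a * m u) \<and>
     (\<forall>u\<in>bounded_on D. \<forall>c. (\<forall>x\<in>D. u x \<le> c) \<longrightarrow> m u \<le> c)"

lemma mean_add: "mean D m \<Longrightarrow> u \<in> bounded_on D \<Longrightarrow> v \<in> bounded_on D \<Longrightarrow> m (\<lambda>x. u x + v x) = m u + m v"
  by (auto simp: mean_def)

lemma mean_scale: "mean D m \<Longrightarrow> u \<in> bounded_on D \<Longrightarrow> m (\<lambda>x. a * u x) = a * m u"
  by (auto simp: mean_def)

lemma mean_upper: "mean D m \<Longrightarrow> u \<in> bounded_on D \<Longrightarrow> (\<And>x. x \<in> D \<Longrightarrow> u x \<le> c) \<Longrightarrow> m u \<le> c"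
  by (auto simp: mean_def)

lemma mean_mono:
  assumes "mean D m" "u \<in> bounded_on D" "v \<in> bounded_on D" "\<And>x. x \<in> D \<Longrightarrow> u x \<le> v x"
  shows "m u \<le> m v"
proof -
  have nv: "(\<lambda>x. (- 1) * v x) \<in> bounded_on D" using assms(3) by auto
  have "m (\<lambda>x. u x + (- 1) * v x) \<le> 0"
    by (rule mean_upper[OF assms(1) bounded_on_add[OF assms(2) nv]]) (use assms in auto)
  then show ?thesis using mean_add[OF assms(1,2) nv] mean_scale[OF assms(1,3), of "- 1"] by simp
qed

lemma mean_cong:
  assumes "mean D m" "u \<in> bounded_on D" "\<And>x. x \<in> D \<Longrightarrow> u x = v x"
  shows "m u = m v"
proof -
  have "v \<in> bounded_on D" using assms(2,3) by (auto simp: bounded_on_def)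
  then show ?thesis using mean_mono[OF assms(1)] assms by (metis antisym order_refl)
qed

lemma mean_const: 
  assumes "mean D m" shows "m (\<lambda>_. c) = c"
proof -
  have "m (\<lambda>_. c) \<le> c" by (rule mean_upper[OF assms]) auto
  moreover have "m (\<lambda>_. - c) \<le> - c" by (rule mean_upper[OF assms]) auto
  moreover have "m (\<lambda>_. (- 1) * c) = (- 1) * m (\<lambda>_. c)" by (rule mean_scale[OF assms]) auto
  ultimately show ?thesis by simp
qed

lemma mean_abs_le:
  assumes "mean D m" "\<And>x. x \<in> D \<Longrightarrow> \<bar>u x\<bar> \<le> B"
  shows "\<bar>m u\<bar> \<le> B"
proof -
  have u: "u \<in> bounded_on D" using assms(2) by (rule bounded_onI)
  have "m u \<le> B" by (rule mean_upper[OF assms(1) u]) (use assms(2) in fastforce)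
  moreover have "m (\<lambda>x. (- 1) * u x) \<le> B"
    by (rule mean_upper[OF assms(1)]) (use u assms(2) in fastforce)+
  ultimately show ?thesis using mean_scale[OF assms(1) u, of "- 1"] by simp
qed

lemma mean_sum:
  assumes "mean D m" "\<And>i. i \<in> I \<Longrightarrow> u i \<in> bounded_on D"
  shows "m (\<lambda>x. \<Sum>i\<in>I. u i x) = (\<Sum>i\<in>I. m (u i))"
  using assms(2)
proof (induction I rule: infinite_finite_induct)
  case (insert i I)
  then show ?case using mean_add[OF assms(1), of "u i" "\<lambda>x. \<Sum>i\<in>I. u i x"] by auto
qed (use mean_const[OF assms(1)] in auto)

lemma mean_diff:
  assumes "mean D m" "u \<in> bounded_on D" "v \<in> bounded_on D"
  shows "m (\<lambda>x. u x - v x) = m u - m v"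
proof -
  have "m (\<lambda>x. u x + (- 1) * v x) = m u + m (\<lambda>x. (- 1) * v x)"
    by (rule mean_add[OF assms(1,2)]) (use assms(3) in auto)
  then show ?thesis using mean_scale[OF assms(1,3), of "- 1"] by simp
qed

text \<open>A minimax theorem in the style of Koenig: the cone in the Hahn-Banach argument consists of the
  pairs \<open>(u, s)\<close> with \<open>u \<le> w + s - c\<close> for some \<open>(w, c)\<close> in \<open>W\<close>.\<close>

lemma exists_mean:
  fixes W :: "(('d \<Rightarrow> real) \<times> real) set"
  assumes W: "real_cone W" and bdd: "\<And>w c. (w, c) \<in> W \<Longrightarrow> w \<in> bounded_on D"
    and inf: "\<And>w c \<delta>. (w, c) \<in> W \<Longrightarrow> \<delta> > 0 \<Longrightarrow> \<exists>x\<in>D. w x < c + \<delta>"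
  obtains m where "mean D m" "\<And>w c. (w, c) \<in> W \<Longrightarrow> m w \<le> c"
proof -
  have W_add: "(v + w, c + d) \<in> W" if "(v, c) \<in> W" "(w, d) \<in> W" for v w c d
    using W that by (auto simp: real_cone_def)
  have W_scl: "(t *\<^sub>R v, t * c) \<in> W" if "(v, c) \<in> W" "t > 0" for v c t
    using W that by (auto simp: real_cone_def)
  have W0: "(0, 0) \<in> W" using W by (auto simp: real_cone_def)
  define G where "G = {(u, s) | u s. \<exists>w c. (w, c) \<in> W \<and> (\<forall>x\<in>D. u x + c \<le> w x + s)}"
  have V: "subspace (bounded_on D)"
    unfolding subspace_def plus_fun_def scaleR_fun_def zero_fun_def by auto
  obtain f where f: "\<And>u v. u \<in> bounded_on D \<Longrightarrow> v \<in> bounded_on D \<Longrightarrow> f (u + v) = f u + f v"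
    "\<And>a v. v \<in> bounded_on D \<Longrightarrow> f (a *\<^sub>R v) = a * f v"
    "\<And>v c. v \<in> bounded_on D \<Longrightarrow> (v, c) \<in> G \<Longrightarrow> f v \<le> c"
  proof (rule hahn_banach_cone[OF V, of G])
    show "real_cone G"
      unfolding real_cone_def
    proof (intro conjI allI impI)
      show "(0, 0) \<in> G" using W0 unfolding G_def by force
      fix v c assume "(v, c) \<in> G"
      then obtain w a where 1: "(w, a) \<in> W" "\<And>x. x \<in> D \<Longrightarrow> v x + a \<le> w x + c"
        unfolding G_def by blast
      show "(v + v', c + c') \<in> G" if v': "(v', c') \<in> G" for v' c'
      proof -
        obtain w' a' where 2: "(w', a') \<in> W" "\<And>x. x \<in> D \<Longrightarrow> v' x + a' \<le> w' x + c'"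
          using v' unfolding G_def by blast
        have "(v + v') x + (a + a') \<le> (w + w') x + (c + c')" if "x \<in> D" for x
          using 1(2)[OF that] 2(2)[OF that] by simp
        then show ?thesis using W_add[OF 1(1) 2(1)] unfolding G_def by blast
      qed
      show "(t *\<^sub>R v, t * c) \<in> G" if "t > 0" for t
      proof -
        have "(t *\<^sub>R v) x + t * a \<le> (t *\<^sub>R w) x + t * c" if "x \<in> D" for x
          using mult_left_mono[OF 1(2)[OF that], of t] \<open>t > 0\<close> by (simp add: algebra_simps)
        then show ?thesis using W_scl[OF 1(1) that] unfolding G_def by blast
      qed
    qed
    show "c \<ge> 0" if c: "(0, c) \<in> G" for c
    proof (rule ccontr)
      assume "\<not> c \<ge> 0"
      then have "- c > 0" by simp
      \<comment> \<open>A pair over 0 with \<open>c < 0\<close> would come from some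
        \<open>(w, a)\<close> in \<open>W\<close> with \<open>w \<ge> a - c\<close> on all of
        \<open>D\<close>, contradicting \<open>inf\<close> with margin \<open>- c\<close>.\<close>
      obtain w a where 1: "(w, a) \<in> W" "\<And>x. x \<in> D \<Longrightarrow> a \<le> w x + c"
        using c unfolding G_def by auto
      then show False using inf[OF 1(1) \<open>- c > 0\<close>] by force
    qed
    show "\<exists>c. (v, c) \<in> G" if v: "v \<in> bounded_on D" for v
    proof -
      obtain B where "\<And>x. x \<in> D \<Longrightarrow> \<bar>v x\<bar> \<le> B" using bounded_onE[OF v] by blast
      then have "\<forall>x\<in>D. v x + 0 \<le> 0 x + B" by fastforce
      then show ?thesis using W0 unfolding G_def by blast
    qed
  qed blast
  show thesis
  proof (rule that[of f])
    show "mean D f"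
      unfolding mean_def
    proof (intro conjI ballI allI impI)
      fix u c assume u: "u \<in> bounded_on D" and "\<forall>x\<in>D. u x \<le> c"
      then have "(u, c) \<in> G" unfolding G_def using W0 by fastforce
      then show "f u \<le> c" using f(3)[OF u] by blast
    qed (use f(1,2) in \<open>auto simp: plus_fun_def scaleR_fun_def\<close>)
    show "f w \<le> c" if "(w, c) \<in> W" for w c
    proof (rule f(3)[OF bdd[OF that]])
      show "(w, c) \<in> G" unfolding G_def using that by (auto simp: add.commute)
    qed
  qed
qed

definition weights :: "'d set \<Rightarrow> 'd set \<Rightarrow> ('d \<Rightarrow> real) \<Rightarrow> bool" where
  "weights D S a \<longleftrightarrow> finite S \<and> S \<subseteq> D \<and> (\<forall>x\<in>S. a x \<ge> 0) \<and> sum a S = 1"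

lemma mean_finite:
  assumes m: "mean S m" and S: "finite S"
  obtains a where "weights S S a" "\<And>u. m u = (\<Sum>x\<in>S. a x * u x)"
proof
  let ?a = "\<lambda>x. m (indicator {x})"
  have eq: "m u = (\<Sum>x\<in>S. ?a x * u x)" for u
  proof -
    have u: "u \<in> bounded_on S"
      by (rule bounded_onI[of _ _ "\<Sum>x\<in>S. \<bar>u x\<bar>"]) (use S in \<open>auto intro: member_le_sum\<close>)
    have "m u = m (\<lambda>y. \<Sum>x\<in>S. u x * indicator {x} y)"
    proof (rule mean_cong[OF m u])
      fix y assume y: "y \<in> S"
      have "(\<Sum>x\<in>S. u x * indicator {x} y) = (\<Sum>x\<in>S. if x = y then u x else 0)"
        by (intro sum.cong) (auto simp: indicator_def)
      then show "u y = (\<Sum>x\<in>S. u x * indicator {x} y)" using S y by simp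
    qed
    also have "\<dots> = (\<Sum>x\<in>S. m (\<lambda>y. u x * indicator {x} y))"
      by (rule mean_sum[OF m]) auto
    also have "\<dots> = (\<Sum>x\<in>S. ?a x * u x)"
      by (rule sum.cong) (auto simp: mean_scale[OF m] mult.commute)
    finally show ?thesis .
  qed
  then show "m u = (\<Sum>x\<in>S. ?a x * u x)" for u .
  have "0 \<le> ?a x" for x
    using mean_mono[OF m, of "\<lambda>_. 0" "indicator {x}"] mean_const[OF m, of 0] by simp
  moreover have "sum ?a S = 1" using eq[of "\<lambda>_. 1"] mean_const[OF m, of 1] by simp
  ultimately show "weights S S ?a" using S by (simp add: weights_def)
qed

text \<open>The cells of the partition behind this approximation are the fibres of the integer parts of
  \<open>u / \<delta>\<close> for \<open>u\<close> in \<open>F\<close>.\<close>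

lemma mean_approx_weights:
  assumes m: "mean D m" and D: "D \<noteq> {}" and F: "finite F" "F \<subseteq> bounded_on D" and "\<delta> > 0"
  obtains S a where "weights D S a" "\<And>u. u \<in> F \<Longrightarrow> \<bar>m u - (\<Sum>x\<in>S. a x * u x)\<bar> \<le> \<delta>"
proof -
  define T where "T x = (\<lambda>u\<in>F. \<lfloor>u x / \<delta>\<rfloor>)" for x
  have "\<exists>B. \<forall>x\<in>D. \<bar>u x\<bar> \<le> B" if "u \<in> F" for u using F that by (auto simp: bounded_on_def)
  then obtain B where B: "\<And>u x. u \<in> F \<Longrightarrow> x \<in> D \<Longrightarrow> \<bar>u x\<bar> \<le> B u" by metis
  have "T ` D \<subseteq> PiE F (\<lambda>u. {\<lfloor>- B u / \<delta>\<rfloor>..\<lfloor>B u / \<delta>\<rfloor>})"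
  proof
    fix t assume "t \<in> T ` D"
    then obtain x where x: "x \<in> D" "t = T x" by blast
    have "\<lfloor>- B u / \<delta>\<rfloor> \<le> \<lfloor>u x / \<delta>\<rfloor> \<and> \<lfloor>u x / \<delta>\<rfloor> \<le> \<lfloor>B u / \<delta>\<rfloor>" if "u \<in> F" for u
      using B[OF that x(1)] \<open>\<delta> > 0\<close> by (intro conjI floor_mono divide_right_mono) auto
    then show "t \<in> PiE F (\<lambda>u. {\<lfloor>- B u / \<delta>\<rfloor>..\<lfloor>B u / \<delta>\<rfloor>})" using x by (auto simp: T_def)
  qed
  then have fin: "finite (T ` D)"
    by (rule finite_subset) (intro finite_PiE F(1), auto)
  \<comment> \<open>One sample point in each nonempty cell; its weight is the mass that the mean
    gives to the cell. The weighted sum is then the mean of \<open>u\<close> sampled cellwise, and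
    sampling changes \<open>u\<close> by at most \<open>\<delta>\<close>.\<close>
  define p where "p t = (SOME x. x \<in> D \<and> T x = t)" for t
  have p: "p (T x) \<in> D \<and> T (p (T x)) = T x" if "x \<in> D" for x
    unfolding p_def by (rule someI[of _ x]) (use that in auto)
  define A :: "_ \<Rightarrow> 'a \<Rightarrow> real" where "A t = indicator {x. T x = t}" for t
  define S where "S = p ` T ` D"
  define a where "a y = m (A (T y))" for y
  have inj: "inj_on p (T ` D)"
    by (rule inj_on_inverseI[of _ T]) (use p in auto)
  have A_sum: "(\<Sum>t\<in>T ` D. c t * A t x) = c (T x)" if "x \<in> D" for x and c :: "_ \<Rightarrow> real"
  proof -
    have "(\<Sum>t\<in>T ` D. c t * A t x) = (\<Sum>t\<in>T ` D. if t = T x then c t else 0)"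
      by (intro sum.cong) (auto simp: A_def indicator_def)
    then show ?thesis using fin that by simp
  qed
  have A_bdd: "A t \<in> bounded_on D" for t unfolding A_def by blast
  have eq: "(\<Sum>y\<in>S. a y * u y) = m (\<lambda>x. u (p (T x)))" for u
  proof -
    have "m (\<lambda>x. u (p (T x))) = m (\<lambda>x. \<Sum>t\<in>T ` D. u (p t) * A t x)"
    proof (rule mean_cong[OF m, symmetric])
      show "(\<lambda>x. \<Sum>t\<in>T ` D. u (p t) * A t x) \<in> bounded_on D"
        by (intro bounded_on_sum bounded_on_mult bounded_on_const A_bdd)
    qed (rule A_sum)
    also have "\<dots> = (\<Sum>t\<in>T ` D. m (\<lambda>x. u (p t) * A t x))"
      by (rule mean_sum[OF m]) (use A_bdd in auto)
    also have "\<dots> = (\<Sum>t\<in>T ` D. a (p t) * u (p t))"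
      by (rule sum.cong) (use p mean_scale[OF m A_bdd] in \<open>auto simp: a_def\<close>)
    also have "\<dots> = (\<Sum>y\<in>S. a y * u y)"
      unfolding S_def by (rule sum.reindex_cong[OF inj, symmetric]) auto
    finally show ?thesis by simp
  qed
  show thesis
  proof (rule that[of S a])
    have "0 \<le> a y" for y
      using mean_mono[OF m, of "\<lambda>_. 0" "A (T y)"] mean_const[OF m, of 0] A_bdd
      by (auto simp: a_def A_def)
    moreover have "sum a S = 1" using eq[of "\<lambda>_. 1"] mean_const[OF m, of 1] by simp
    ultimately show "weights D S a" using fin p by (auto simp: weights_def S_def)
  next
    fix u assume u: "u \<in> F"
    have b1: "u \<in> bounded_on D" using u F by blast
    have b2: "(\<lambda>x. u (p (T x))) \<in> bounded_on D"
      by (rule bounded_onI[of _ _ "B u"]) (use B u p in auto)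
    have "\<bar>m (\<lambda>x. u x - u (p (T x)))\<bar> \<le> \<delta>"
    proof (rule mean_abs_le[OF m])
      fix x assume x: "x \<in> D"
      have "T (p (T x)) u = T x u" using p[OF x] by simp
      then have "\<lfloor>u (p (T x)) / \<delta>\<rfloor> = \<lfloor>u x / \<delta>\<rfloor>" using u by (simp add: T_def)
      then have "\<bar>u x / \<delta> - u (p (T x)) / \<delta>\<bar> < 1" by linarith
      then have "\<bar>u x - u (p (T x))\<bar> / \<delta> < 1" using \<open>\<delta> > 0\<close> by (simp add: diff_divide_distrib[symmetric])
      then show "\<bar>u x - u (p (T x))\<bar> \<le> \<delta>" using \<open>\<delta> > 0\<close> by (simp add: field_simps)
    qed
    then show "\<bar>m u - (\<Sum>x\<in>S. a x * u x)\<bar> \<le> \<delta>" using mean_diff[OF m b1 b2] eq by simp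
  qed
qed

section \<open>Ultrafilters and limits along them\<close>

lemma exists_ultrafilter:
  fixes F :: "'a filter"
  assumes "F \<noteq> bot"
  obtains U where "U \<le> F" "U \<noteq> bot" "\<And>P. eventually P U \<or> eventually (\<lambda>x. \<not> P x) U"
proof -
  let ?A = "{G. G \<le> F \<and> G \<noteq> bot}"
  have "\<exists>U\<in>?A. \<forall>G\<in>?A. G \<le> U \<longrightarrow> G = U"
  proof (rule predicate_Zorn)
    show "partial_order_on ?A (relation_of (\<lambda>x y. y \<le> x) ?A)"
      by (rule partial_order_on_relation_ofI) (auto dest: order.trans antisym)
    fix C assume C: "C \<in> Chains (relation_of (\<lambda>x y. y \<le> x) ?A)"
    then have sub: "C \<subseteq> ?A" using Chains_relation_of by blast
    show "\<exists>u\<in>?A. \<forall>a\<in>C. u \<le> a"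
    proof (cases "C = {}")
      case True
      then show ?thesis using assms by auto
    next
      case False
      \<comment> \<open>A chain of filters is a filter base, so what holds eventually for its
        infimum already holds eventually for a member; properness passes to the infimum.\<close>
      have "Inf C \<noteq> bot"
        unfolding trivial_limit_def
        proof (subst eventually_Inf_base[OF False])
        show "\<exists>H\<in>C. H \<le> inf F G" if "F \<in> C" "G \<in> C" for F G
        proof -
          have "F \<le> G \<or> G \<le> F" using that C unfolding Chains_def relation_of_def by blast
          then show ?thesis using that by (metis inf.absorb1 inf.absorb2 order_refl)
        qed
        show "\<not> (\<exists>G\<in>C. \<forall>\<^sub>F x in G. False)" using sub by (auto simp: trivial_limit_def)
      qed
      moreover have "Inf C \<le> F" using False sub by (auto intro: Inf_lower2)
      ultimately show ?thesis by (auto intro: Inf_lower)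
    qed
  qed
  then obtain U where U: "U \<le> F" "U \<noteq> bot" and min: "\<And>G. G \<le> F \<Longrightarrow> G \<noteq> bot \<Longrightarrow> G \<le> U \<Longrightarrow> G = U"
    by blast
  have "eventually P U \<or> eventually (\<lambda>x. \<not> P x) U" for P
  proof (rule disjCI)
    assume "\<not> eventually (\<lambda>x. \<not> P x) U"
    \<comment> \<open>Restricting \<open>U\<close> to the event \<open>P\<close> keeps it proper
      unless \<open>P\<close> eventually fails; minimality says that the restriction is
      \<open>U\<close> itself.\<close>
    then have "inf U (principal {x. P x}) \<noteq> bot"
      by (auto simp: trivial_limit_def eventually_inf_principal)
    then have "inf U (principal {x. P x}) = U" using min U(1) by (simp add: le_infI1)
    moreover have "eventually P (inf U (principal {x. P x}))" by (simp add: eventually_inf_principal)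
    ultimately show "eventually P U" by simp
  qed
  then show thesis using that U by blast
qed

text \<open>Compactness of a closed ball gives a cluster point, and along an ultrafilter a cluster
  point is a limit: a neighbourhood that is not eventually visited is eventually avoided.\<close>

lemma ultrafilter_limit:
  fixes U :: "'a filter" and u :: "'a \<Rightarrow> 'b::{heine_borel, real_normed_vector}"
  assumes U: "U \<noteq> bot" "\<And>P. eventually P U \<or> eventually (\<lambda>x. \<not> P x) U"
    and bdd: "eventually (\<lambda>x. norm (u x) \<le> B) U"
  obtains l where "(u \<longlongrightarrow> l) U"
proof -
  let ?F = "filtermap u U"
  have "?F \<le> principal (cball 0 B)" using bdd by (simp add: le_principal eventually_filtermap)
  moreover have "?F \<noteq> bot" using U(1) by (simp add: filtermap_bot_iff)
  ultimately obtain l where l: "inf (nhds l) ?F \<noteq> bot"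
    using compact_cball[of "0::'b" B] unfolding compact_filter le_principal by blast
  have "(u \<longlongrightarrow> l) U"
  proof (rule topological_tendstoI)
    fix S assume S: "open S" "l \<in> S"
    show "eventually (\<lambda>x. u x \<in> S) U"
    proof (rule ccontr)
      assume "\<not> ?thesis"
      then have "eventually (\<lambda>x. u x \<notin> S) U" using U(2)[of "\<lambda>x. u x \<in> S"] by blast
      then have "eventually (\<lambda>y. y \<notin> S) ?F" by (simp add: eventually_filtermap)
      moreover have "eventually (\<lambda>y. y \<in> S) (nhds l)" using S by (rule eventually_nhds_in_open)
      ultimately have "eventually (\<lambda>y. False) (inf (nhds l) ?F)" unfolding eventually_inf by blast
      then show False using l by (simp add: trivial_limit_def)
    qed
  qed
  then show thesis by (rule that)
qed

section \<open>Spaces of continuous functions on a compact set\<close>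

text \<open>The class does not relate its inner product to multiplication; polarisation recovers the
  inner product from the norm, which is multiplicative. As a consequence
  \<open>u \<bullet> z\<close> is the real part of \<open>z / u\<close> for unimodular
  \<open>u\<close>.\<close>

lemma unimodular_inner:
  fixes u x y :: "'k::real_or_complex"
  assumes "norm u = 1"
  shows "(u * x) \<bullet> (u * y) = x \<bullet> y"
  using assms by (simp add: dot_norm distrib_left[symmetric] norm_mult)

lemma inner_one_of_real [simp]: "(of_real r :: 'k::real_or_complex) \<bullet> 1 = r"
  by (simp add: of_real_def dot_square_norm)

lemma rotate_to_real:
  fixes z :: "'k::real_or_complex"
  obtains u where "norm u = 1" "(u * z) \<bullet> 1 = norm z"
proof (cases "z = 0")
  case True
  then show thesis using that[of 1] by simp
next
  case False
  then show thesis using that[of "of_real (norm z) / z"] by (simp add: norm_divide)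
qed

text \<open>The setting of the approximation argument, free of polynomials. Vanishing off
  \<open>K\<close> makes an element determined by its values on \<open>K\<close>, so that
  functionals can act on plain functions. Closedness under uniform limits is used for the limit
  point in \<open>ekeland\<close> and for the series that embed
  \<open>\<ell>\<^sub>1\<close>.\<close>

locale function_space =
  fixes K :: "'t::topological_space set" and Y :: "('t \<Rightarrow> 'k::real_or_complex) set"
  assumes compact: "compact K" and nonempty: "K \<noteq> {}"
    and continuous: "f \<in> Y \<Longrightarrow> continuous_on K f"
    and vanish: "f \<in> Y \<Longrightarrow> t \<notin> K \<Longrightarrow> f t = 0"
    and lin: "f \<in> Y \<Longrightarrow> g \<in> Y \<Longrightarrow> (\<lambda>t. c * f t + g t) \<in> Y"
    and zero: "(\<lambda>_. 0) \<in> Y"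
    and complete: "(\<And>n. F n \<in> Y) \<Longrightarrow> uniform_limit K F f sequentially \<Longrightarrow>
      (\<And>t. t \<notin> K \<Longrightarrow> f t = 0) \<Longrightarrow> f \<in> Y"
begin

definition nrm :: "('t \<Rightarrow> 'k) \<Rightarrow> real" where
  "nrm f = (SUP t\<in>K. norm (f t))"

definition functional :: "(('t \<Rightarrow> 'k) \<Rightarrow> 'k) \<Rightarrow> bool" where
  "functional L \<longleftrightarrow> (\<forall>f\<in>Y. \<forall>g\<in>Y. \<forall>c. L (\<lambda>t. c * f t + g t) = c * L f + L g) \<and>
     (\<exists>C. \<forall>f\<in>Y. norm (L f) \<le> C * nrm f)"

lemma norm_le_nrm:
  assumes "f \<in> Y" "t \<in> K"
  shows "norm (f t) \<le> nrm f"
proof -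
  have "compact ((\<lambda>t. norm (f t)) ` K)"
    by (intro compact_continuous_image continuous_on_norm continuous assms compact)
  then have "bdd_above ((\<lambda>t. norm (f t)) ` K)"
    by (intro bounded_imp_bdd_above compact_imp_bounded)
  then show ?thesis unfolding nrm_def using assms(2) by (rule cSUP_upper[rotated])
qed

lemma nrm_le: "(\<And>t. t \<in> K \<Longrightarrow> norm (f t) \<le> B) \<Longrightarrow> nrm f \<le> B"
  unfolding nrm_def using nonempty by (rule cSUP_least)

lemma nrm_nonneg: "f \<in> Y \<Longrightarrow> 0 \<le> nrm f"
  using nonempty norm_le_nrm norm_ge_zero order_trans by blast

lemma scale: "f \<in> Y \<Longrightarrow> (\<lambda>t. c * f t) \<in> Y"
  using lin[OF _ zero] by simp

lemma add: "f \<in> Y \<Longrightarrow> g \<in> Y \<Longrightarrow> (\<lambda>t. f t + g t) \<in> Y"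
  using lin[of f g 1] by simp

lemma diff: "f \<in> Y \<Longrightarrow> g \<in> Y \<Longrightarrow> (\<lambda>t. f t - g t) \<in> Y"
  using lin[of g f "- 1"] by simp

lemma scaleR: "f \<in> Y \<Longrightarrow> (\<lambda>t. r *\<^sub>R f t) \<in> Y"
  using scale[of f "of_real r"] by (simp add: scaleR_conv_of_real)

lemma sum: "(\<And>i. i \<in> I \<Longrightarrow> f i \<in> Y) \<Longrightarrow> (\<lambda>t. \<Sum>i\<in>I. f i t) \<in> Y"
  by (induction I rule: infinite_finite_induct) (auto intro: zero add)

lemma nrm_scale_le: "f \<in> Y \<Longrightarrow> nrm (\<lambda>t. c * f t) \<le> norm c * nrm f"
  by (rule nrm_le) (auto simp: norm_mult intro!: mult_left_mono norm_le_nrm)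

lemma nrm_scaleR_le: "f \<in> Y \<Longrightarrow> nrm (\<lambda>t. r *\<^sub>R f t) \<le> \<bar>r\<bar> * nrm f"
  by (rule nrm_le) (auto intro!: mult_left_mono norm_le_nrm)

lemma nrm_add_le: "f \<in> Y \<Longrightarrow> g \<in> Y \<Longrightarrow> nrm (\<lambda>t. f t + g t) \<le> nrm f + nrm g"
  by (rule nrm_le) (auto intro!: norm_triangle_mono norm_le_nrm)

lemma nrm_diff_le: "f \<in> Y \<Longrightarrow> g \<in> Y \<Longrightarrow> nrm (\<lambda>t. f t - g t) \<le> nrm f + nrm g"
  by (rule nrm_le) (auto intro!: order_trans[OF norm_triangle_ineq4] add_mono norm_le_nrm)

lemma nrm_zero: "nrm (\<lambda>_. 0) = 0"
  using nrm_le[of "\<lambda>_. 0" 0] nrm_nonneg[OF zero] by simp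

context
  fixes L assumes L: "functional L"
begin

lemma functional_lin: "f \<in> Y \<Longrightarrow> g \<in> Y \<Longrightarrow> L (\<lambda>t. c * f t + g t) = c * L f + L g"
  using L by (simp add: functional_def)

lemma functional_zero: "L (\<lambda>_. 0) = 0"
  using functional_lin[OF zero zero, of 1] by simp

lemma functional_scale: "f \<in> Y \<Longrightarrow> L (\<lambda>t. c * f t) = c * L f"
  using functional_lin[OF _ zero, of f c] functional_zero by simp

lemma functional_add: "f \<in> Y \<Longrightarrow> g \<in> Y \<Longrightarrow> L (\<lambda>t. f t + g t) = L f + L g"
  using functional_lin[of f g 1] by simp

lemma functional_diff: "f \<in> Y \<Longrightarrow> g \<in> Y \<Longrightarrow> L (\<lambda>t. f t - g t) = L f - L g"
  using functional_lin[of g f "- 1"] by simp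

lemma functional_scaleR: "f \<in> Y \<Longrightarrow> L (\<lambda>t. r *\<^sub>R f t) = r *\<^sub>R L f"
  using functional_scale[of f "of_real r"] by (simp add: scaleR_conv_of_real)

lemma functional_sum:
  "(\<And>i. i \<in> I \<Longrightarrow> f i \<in> Y) \<Longrightarrow> L (\<lambda>t. \<Sum>i\<in>I. f i t) = (\<Sum>i\<in>I. L (f i))"
proof (induction I rule: infinite_finite_induct)
  case (insert i I)
  then show ?case using functional_add[of "f i" "\<lambda>t. \<Sum>i\<in>I. f i t"] by (simp add: sum)
qed (simp_all add: functional_zero)

lemma functional_bound:
  obtains C where "C \<ge> 0" "\<And>f. f \<in> Y \<Longrightarrow> norm (L f) \<le> C * nrm f"
proof -
  obtain C where C: "\<forall>f\<in>Y. norm (L f) \<le> C * nrm f" using L by (auto simp: functional_def)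
  show thesis
  proof (rule that[of "max 0 C"])
    fix f assume f: "f \<in> Y"
    have "C * nrm f \<le> max 0 C * nrm f" using nrm_nonneg[OF f] by (intro mult_right_mono) auto
    then show "norm (L f) \<le> max 0 C * nrm f" using C f by fastforce
  qed simp
qed

text \<open>Rotating \<open>g\<close> by a unimodular scalar makes the value of \<open>L\<close>
  real and nonnegative.\<close>

lemma functional_norm_from_real_part:
  assumes "\<And>g. g \<in> Y \<Longrightarrow> L g \<bullet> 1 \<le> B * nrm g" "B \<ge> 0" "g \<in> Y"
  shows "norm (L g) \<le> B * nrm g"
proof -
  obtain u where u: "norm u = 1" "(u * L g) \<bullet> 1 = norm (L g)" by (rule rotate_to_real)
  have "norm (L g) = L (\<lambda>t. u * g t) \<bullet> 1" using functional_scale[OF assms(3)] u by simp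
  also have "\<dots> \<le> B * nrm (\<lambda>t. u * g t)" by (rule assms(1)[OF scale[OF assms(3)]])
  also have "\<dots> \<le> B * nrm g" using nrm_scale_le[OF assms(3), of u] u assms(2) by (intro mult_left_mono) auto
  finally show ?thesis .
qed

end

lemma functional_point_sum:
  assumes "S \<subseteq> K"
  shows "functional (\<lambda>g. \<Sum>t\<in>S. c t * g t)"
  unfolding functional_def
proof (intro conjI ballI allI)
  fix f g a assume "f \<in> Y" "g \<in> Y"
  show "(\<Sum>t\<in>S. c t * (a * f t + g t)) = a * (\<Sum>t\<in>S. c t * f t) + (\<Sum>t\<in>S. c t * g t)"
    by (simp add: sum_distrib_left sum.distrib[symmetric] algebra_simps)
next
  have "norm (\<Sum>t\<in>S. c t * f t) \<le> (\<Sum>t\<in>S. norm (c t)) * nrm f" if "f \<in> Y" for f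
    unfolding sum_distrib_right
    by (rule order_trans[OF norm_sum sum_mono])
      (use assms that in \<open>auto simp: norm_mult intro!: mult_left_mono norm_le_nrm\<close>)
  then show "\<exists>C. \<forall>f\<in>Y. norm (\<Sum>t\<in>S. c t * f t) \<le> C * nrm f" by blast
qed

lemma functional_minus:
  assumes "functional L" "functional M"
  shows "functional (\<lambda>g. L g - M g)"
  unfolding functional_def
proof (intro conjI ballI allI)
  fix f g a assume "f \<in> Y" "g \<in> Y"
  then show "L (\<lambda>t. a * f t + g t) - M (\<lambda>t. a * f t + g t) = a * (L f - M f) + (L g - M g)"
    using functional_lin[OF assms(1)] functional_lin[OF assms(2)] by (simp add: algebra_simps)
next
  obtain C where C: "\<And>f. f \<in> Y \<Longrightarrow> norm (L f) \<le> C * nrm f" using functional_bound[OF assms(1)] by blast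
  obtain C' where C': "\<And>f. f \<in> Y \<Longrightarrow> norm (M f) \<le> C' * nrm f" using functional_bound[OF assms(2)] by blast
  have "norm (L f - M f) \<le> (C + C') * nrm f" if "f \<in> Y" for f
    using norm_triangle_ineq4[of "L f" "M f"] C[OF that] C'[OF that] by (simp add: algebra_simps)
  then show "\<exists>C. \<forall>f\<in>Y. norm (L f - M f) \<le> C * nrm f" by blast
qed

section \<open>Approximate norm attainment\<close>

text \<open>Greedy maximisation of the real part \<open>l\<close> of \<open>L\<close> over the unit
  ball, where a move from \<open>f\<close> to \<open>g\<close> is allowed only if its gain pays for
  \<open>\<epsilon>\<close> times the distance. Since \<open>l\<close> is bounded on the ball, the
  moves have finite total length and converge; from the limit no profitable move is left. Without
  the penalty a maximiser need not exist.\<close>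

lemma ekeland:
  assumes L: "functional L" and \<epsilon>: "\<epsilon> > 0"
  obtains f where "f \<in> Y" "nrm f \<le> 1" "L f \<bullet> 1 \<ge> 0"
    "\<And>g. g \<in> Y \<Longrightarrow> nrm g \<le> 1 \<Longrightarrow> (L g - L f) \<bullet> 1 \<le> \<epsilon> * nrm (\<lambda>t. g t - f t)"
proof -
  define l where "l g = L g \<bullet> 1" for g
  obtain C where C: "C \<ge> 0" "\<And>f. f \<in> Y \<Longrightarrow> norm (L f) \<le> C * nrm f"
    using functional_bound[OF L] by blast
  have l_le: "\<bar>l f\<bar> \<le> C * nrm f" if "f \<in> Y" for f
    using Cauchy_Schwarz_ineq2[of "L f" 1] C(2)[OF that] by (simp add: l_def)
  have l_le_C: "l f \<le> C" if "f \<in> Y" "nrm f \<le> 1" for f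
    using l_le[OF that(1)] mult_left_mono[OF that(2) C(1)] by simp
  have l_diff: "l (\<lambda>t. f t - g t) = l f - l g" if "f \<in> Y" "g \<in> Y" for f g
    using functional_diff[OF L that] by (simp add: l_def inner_diff_left)
  define S where "S f = {g \<in> Y. nrm g \<le> 1 \<and> \<epsilon> * nrm (\<lambda>t. g t - f t) \<le> l g - l f}" for f
  have S_trans: "h \<in> S f" if "f \<in> Y" "g \<in> S f" "h \<in> S g" for f g h
  proof -
    have "nrm (\<lambda>t. h t - f t) \<le> nrm (\<lambda>t. h t - g t) + nrm (\<lambda>t. g t - f t)"
      using nrm_add_le[of "\<lambda>t. h t - g t" "\<lambda>t. g t - f t"] that by (auto simp: S_def diff)
    then have "\<epsilon> * nrm (\<lambda>t. h t - f t) \<le> \<epsilon> * nrm (\<lambda>t. h t - g t) + \<epsilon> * nrm (\<lambda>t. g t - f t)"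
      using \<epsilon> by (simp add: distrib_left[symmetric])
    then show ?thesis using that unfolding S_def by auto
  qed
  define B where "B = {f \<in> Y. nrm f \<le> 1}"
  have S_refl: "f \<in> S f" if "f \<in> B" for f using that by (auto simp: S_def B_def nrm_zero)
  have ex: "\<exists>g. g \<in> S f \<and> (\<forall>h\<in>S f. l h \<le> l g + \<delta>)" if f: "f \<in> B" and \<delta>: "\<delta> > 0" for f and \<delta> :: real
  proof -
    have bdd: "bdd_above (l ` S f)" using l_le_C by (intro bdd_aboveI[of _ C]) (auto simp: S_def)
    have "\<exists>x\<in>l ` S f. Sup (l ` S f) - \<delta> < x"
      by (rule less_cSupD) (use S_refl[OF f] \<delta> in auto)
    then obtain g where g: "g \<in> S f" "Sup (l ` S f) - \<delta> < l g" by blast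
    have "l h \<le> l g + \<delta>" if "h \<in> S f" for h
      using cSup_upper[OF imageI[OF that, of l] bdd] g(2) by simp
    then show ?thesis using g by blast
  qed
  \<comment> \<open>Starting at 0 yields \<open>L f \<bullet> 1 \<ge> 0\<close> for the limit. Each
    move comes within \<open>(1/2) ^ n\<close> of the best value still allowed; only the convergence
    of this slack to 0 is used.\<close>
  obtain F where F: "\<And>n. (F n \<in> B \<and> (n = 0 \<longrightarrow> F n = (\<lambda>_. 0))) \<and>
      (F (Suc n) \<in> S (F n) \<and> (\<forall>h\<in>S (F n). l h \<le> l (F (Suc n)) + (1/2) ^ n))"
  proof (atomize_elim, rule dependent_nat_choice, goal_cases)
    case 1
    then show ?case using zero by (auto simp: B_def nrm_zero)
  next
    case (2 f n)
    then have f: "f \<in> B" by blast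
    obtain g where "g \<in> S f" "\<forall>h\<in>S f. l h \<le> l g + (1/2) ^ n"
      using ex[OF f, of "(1/2) ^ n"] by auto
    then show ?case by (intro exI[of _ g]) (auto simp: S_def B_def)
  qed
  then have F0: "F 0 = (\<lambda>_. 0)" and FB: "\<And>n. F n \<in> B" and FS: "\<And>n. F (Suc n) \<in> S (F n)"
    and Fmax: "\<And>n h. h \<in> S (F n) \<Longrightarrow> l h \<le> l (F (Suc n)) + (1/2) ^ n" by blast+
  have FY: "F n \<in> Y" for n using FB by (auto simp: B_def)
  have F_S: "F n \<in> S (F m)" if "m \<le> n" for m n
    using that
  proof (induction n rule: dec_induct)
    case base
    then show ?case using S_refl FB by blast
  next
    case (step n)
    then show ?case using S_trans[OF FY _ FS] by blast
  qed
  have incl: "l (F m) \<le> l (F n)" if "m \<le> n" for m n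
  proof -
    have "0 \<le> \<epsilon> * nrm (\<lambda>t. F n t - F m t)" using \<epsilon> nrm_nonneg[OF diff[OF FY FY]] by simp
    then show ?thesis using F_S[OF that] by (auto simp: S_def)
  qed
  then have "incseq (\<lambda>n. l (F n))" by (simp add: incseq_def)
  moreover have "bdd_above (range (\<lambda>n. l (F n)))"
    using l_le_C FB by (intro bdd_aboveI[of _ C]) (auto simp: B_def)
  ultimately have conv: "(\<lambda>n. l (F n)) \<longlonglongrightarrow> (SUP n. l (F n))" by (rule LIMSEQ_incseq_SUP[rotated])
  have "uniformly_Cauchy_on K F"
  proof (rule uniformly_Cauchy_onI')
    fix e :: real assume "e > 0"
    then have "\<epsilon> * e > 0" using \<epsilon> by simp
    then obtain M where M: "\<And>m n. m \<ge> M \<Longrightarrow> n \<ge> M \<Longrightarrow> dist (l (F m)) (l (F n)) < \<epsilon> * e"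
      using LIMSEQ_imp_Cauchy[OF conv] unfolding Cauchy_def by blast
    show "\<exists>M. \<forall>x\<in>K. \<forall>m\<ge>M. \<forall>n>m. dist (F m x) (F n x) < e"
    proof (intro exI[of _ M] ballI allI impI)
      fix x m n assume x: "x \<in> K" and mn: "M \<le> m" "m < n"
      have "\<epsilon> * dist (F m x) (F n x) \<le> \<epsilon> * nrm (\<lambda>t. F n t - F m t)"
        using norm_le_nrm[OF diff[OF FY FY] x, of n m] \<epsilon>
        by (intro mult_left_mono) (auto simp: dist_norm norm_minus_commute)
      also have "\<dots> \<le> l (F n) - l (F m)" using F_S[of m n] mn by (auto simp: S_def)
      also have "\<dots> < \<epsilon> * e" using M[of n m] mn by (simp add: dist_real_def)
      finally show "dist (F m x) (F n x) < e" using \<epsilon> by simp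
    qed
  qed
  then obtain f0 where f0: "uniform_limit K F f0 sequentially"
    using Cauchy_uniformly_convergent unfolding uniformly_convergent_on_def by blast
  define f where "f t = (if t \<in> K then f0 t else 0)" for t
  have lim: "uniform_limit K F f sequentially"
    using f0 by (rule uniform_limit_cong'[THEN iffD1, rotated 2]) (auto simp: f_def)
  have fY: "f \<in> Y" by (rule complete[OF FY lim]) (simp add: f_def)
  have nrm_lim: "(\<lambda>n. nrm (\<lambda>t. f t - F n t)) \<longlonglongrightarrow> 0"
  proof (rule LIMSEQ_I)
    fix r :: real assume "r > 0"
    then have "\<forall>\<^sub>F n in sequentially. \<forall>x\<in>K. dist (F n x) (f x) < r / 2"
      using uniform_limitD[OF lim] half_gt_zero by blast
    then obtain M where M: "\<And>n x. n \<ge> M \<Longrightarrow> x \<in> K \<Longrightarrow> dist (F n x) (f x) < r / 2"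
      unfolding eventually_sequentially by blast
    have "nrm (\<lambda>t. f t - F n t) \<le> r / 2" if "n \<ge> M" for n
      by (rule nrm_le) (use M[OF that] in \<open>auto simp: dist_norm norm_minus_commute less_imp_le\<close>)
    then show "\<exists>no. \<forall>n\<ge>no. norm (nrm (\<lambda>t. f t - F n t) - 0) < r"
      using nrm_nonneg[OF diff[OF fY FY]] \<open>r > 0\<close> by (intro exI[of _ M]) fastforce
  qed
  have "(\<lambda>n. l f - l (F n)) \<longlonglongrightarrow> 0"
  proof (rule Lim_null_comparison)
    show "\<forall>\<^sub>F n in sequentially. norm (l f - l (F n)) \<le> C * nrm (\<lambda>t. f t - F n t)"
      using l_le[OF diff[OF fY FY]] l_diff[OF fY FY] by (simp add: real_norm_def)
    show "(\<lambda>n. C * nrm (\<lambda>t. f t - F n t)) \<longlonglongrightarrow> 0" using tendsto_mult_right_zero[OF nrm_lim] .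
  qed
  then have l_lim: "(\<lambda>n. l (F n)) \<longlonglongrightarrow> l f"
    using tendsto_diff[OF tendsto_const, of "\<lambda>n. l f - l (F n)" 0 sequentially "l f"] by simp
  have nrm_f: "nrm f \<le> 1"
  proof (rule LIMSEQ_le_const)
    show "(\<lambda>n. 1 + nrm (\<lambda>t. f t - F n t)) \<longlonglongrightarrow> 1" using tendsto_add[OF tendsto_const nrm_lim, of 1] by simp
    have "nrm f \<le> 1 + nrm (\<lambda>t. f t - F n t)" for n
      using nrm_add_le[OF FY diff[OF fY FY], of n n] FB[of n] by (auto simp: B_def)
    then show "\<exists>N. \<forall>n\<ge>N. nrm f \<le> 1 + nrm (\<lambda>t. f t - F n t)" by blast
  qed
  have f_S: "f \<in> S (F m)" for m
  proof -
    have "\<epsilon> * nrm (\<lambda>t. f t - F m t) \<le> l f - l (F m)"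
    proof (rule LIMSEQ_le_const)
      show "(\<lambda>n. \<epsilon> * nrm (\<lambda>t. f t - F n t) + (l (F n) - l (F m))) \<longlonglongrightarrow> l f - l (F m)"
        using tendsto_add[OF tendsto_mult_right_zero[OF nrm_lim, of \<epsilon>] tendsto_diff[OF l_lim tendsto_const, of "l (F m)"]]
        by simp
      have "\<epsilon> * nrm (\<lambda>t. f t - F m t) \<le> \<epsilon> * nrm (\<lambda>t. f t - F n t) + (l (F n) - l (F m))" if "n \<ge> m" for n
      proof -
        have "nrm (\<lambda>t. f t - F m t) \<le> nrm (\<lambda>t. f t - F n t) + nrm (\<lambda>t. F n t - F m t)"
          using nrm_add_le[OF diff[OF fY FY] diff[OF FY FY], of n n m] by simp
        then have "\<epsilon> * nrm (\<lambda>t. f t - F m t) \<le> \<epsilon> * nrm (\<lambda>t. f t - F n t) + \<epsilon> * nrm (\<lambda>t. F n t - F m t)"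
          using \<epsilon> by (simp add: distrib_left[symmetric])
        then show ?thesis using F_S[OF that] by (auto simp: S_def)
      qed
      then show "\<exists>N. \<forall>n\<ge>N. \<epsilon> * nrm (\<lambda>t. f t - F m t) \<le> \<epsilon> * nrm (\<lambda>t. f t - F n t) + (l (F n) - l (F m))"
        by blast
    qed
    then show ?thesis using fY nrm_f by (simp add: S_def)
  qed
  show thesis
  proof (rule that[of f])
    have "l (F 0) = 0" using functional_zero[OF L] F0 by (simp add: l_def)
    moreover have "0 \<le> \<epsilon> * nrm (\<lambda>t. f t - F 0 t)" using \<epsilon> nrm_nonneg[OF diff[OF fY FY]] by simp
    ultimately show "L f \<bullet> 1 \<ge> 0" using f_S[of 0] by (auto simp: S_def l_def)
    fix g assume g: "g \<in> Y" "nrm g \<le> 1"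
    show "(L g - L f) \<bullet> 1 \<le> \<epsilon> * nrm (\<lambda>t. g t - f t)"
    proof (rule ccontr)
      assume *: "\<not> ?thesis"
      then have "g \<in> S f" using g by (auto simp: S_def l_def inner_diff_left)
      \<comment> \<open>A move allowed from the limit is allowed from every \<open>F n\<close>, so
        its value is at most \<open>l (F (Suc n)) + (1/2) ^ n\<close> for all \<open>n\<close>,
        hence at most \<open>l f\<close>: there is no gain.\<close>
      then have gS: "g \<in> S (F n)" for n using S_trans[OF FY f_S] by blast
      have "l g \<le> l f"
      proof (rule LIMSEQ_le_const)
        show "(\<lambda>n. l (F (Suc n)) + (1/2) ^ n) \<longlonglongrightarrow> l f"
          using tendsto_add[OF LIMSEQ_Suc[OF l_lim] LIMSEQ_realpow_zero[of "1/2"]] by simp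
        show "\<exists>N. \<forall>n\<ge>N. l g \<le> l (F (Suc n)) + (1/2) ^ n" using Fmax[OF gS] by blast
      qed
      moreover have "0 \<le> \<epsilon> * nrm (\<lambda>t. g t - f t)" using \<epsilon> nrm_nonneg[OF diff[OF g(1) fY]] by simp
      ultimately show False using * by (simp add: l_def inner_diff_left)
    qed
  qed (use fY nrm_f in auto)
qed


text \<open>A point of \<open>K\<close> is harmless if \<open>f\<close> is well inside the unit ball
  there, or if \<open>g\<close> points inward so that the first order term decreases the norm. Every
  point is of one of these kinds, and compactness bounds the larger of the two quantities below by a
  single \<open>w0 > 0\<close>.\<close>

lemma peak_perturbation:
  assumes f: "f \<in> Y" "nrm f \<le> 1" and g: "g \<in> Y"
    and neg: "\<And>t. t \<in> K \<Longrightarrow> norm (f t) = 1 \<Longrightarrow> f t \<bullet> g t < 0"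
  obtains s where "s > 0" "nrm (\<lambda>t. f t + s *\<^sub>R g t) \<le> 1"
proof -
  define w where "w t = max (1 - (norm (f t))\<^sup>2) (- (f t \<bullet> g t))" for t
  have f1: "norm (f t) \<le> 1" if "t \<in> K" for t using norm_le_nrm[OF f(1) that] f(2) by simp
  have "continuous_on K w"
    unfolding w_def by (intro continuous_intros continuous f g)
  then obtain t0 where t0: "t0 \<in> K" "\<And>t. t \<in> K \<Longrightarrow> w t0 \<le> w t"
    using continuous_attains_inf[OF compact nonempty] by blast
  define w0 where "w0 = w t0"
  have "w0 > 0"
  proof (cases "norm (f t0) = 1")
    case True
    then show ?thesis using neg[OF t0(1)] by (simp add: w0_def w_def)
  next
    case False
    then have "(norm (f t0))\<^sup>2 < 1" using f1[OF t0(1)] by (simp add: power_less_one_iff)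
    then show ?thesis by (simp add: w0_def w_def)
  qed
  define M where "M = nrm g"
  have M: "M \<ge> 0" using nrm_nonneg[OF g] by (simp add: M_def)
  \<comment> \<open>Chosen for \<open>s * (2 * M + M\<^sup>2) \<le> w0\<close>: where there is room
    this bounds the growth of the squared norm, and elsewhere it keeps the quadratic term below the
    decrease \<open>2 * s * w0\<close>. The summand 1 avoids a zero denominator.\<close>
  define s where "s = min 1 (w0 / (2 * M + M\<^sup>2 + 1))"
  have den: "2 * M + M\<^sup>2 + 1 > 0" using M by (simp add: add_nonneg_pos)
  have s: "s > 0" "s \<le> 1" using \<open>w0 > 0\<close> den by (auto simp: s_def)
  have "s \<le> w0 / (2 * M + M\<^sup>2 + 1)" by (simp add: s_def)
  then have "s * (2 * M + M\<^sup>2 + 1) \<le> w0" using den by (simp only: pos_le_divide_eq)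
  then have sw: "s * (2 * M) + s * M\<^sup>2 \<le> w0" using s by (simp add: algebra_simps)
  have "norm (f t + s *\<^sub>R g t) \<le> 1" if t: "t \<in> K" for t
  proof -
    have gM: "norm (g t) \<le> M" using norm_le_nrm[OF g t] by (simp add: M_def)
    have "f t \<bullet> g t \<le> norm (f t) * norm (g t)" by (rule norm_cauchy_schwarz)
    also have "\<dots> \<le> 1 * M" by (rule mult_mono) (use f1[OF t] gM in auto)
    finally have fg: "f t \<bullet> g t \<le> M" by simp
    have "(norm (g t))\<^sup>2 \<le> M\<^sup>2" using gM by (intro power_mono) auto
    then have s2: "s * s * (norm (g t))\<^sup>2 \<le> s * (s * M\<^sup>2)" "s * (s * M\<^sup>2) \<le> s * M\<^sup>2"
      using s mult_left_mono[OF mult_right_mono[OF s(2) zero_le_power2[of M]], of s]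
      by (auto simp: mult.assoc intro!: mult_left_mono)
    have eq: "(norm (f t + s *\<^sub>R g t))\<^sup>2 = (norm (f t))\<^sup>2 + s * (2 * (f t \<bullet> g t)) + s * s * (norm (g t))\<^sup>2"
      by (simp add: power2_norm_eq_inner algebra_simps inner_commute)
    have "(norm (f t + s *\<^sub>R g t))\<^sup>2 \<le> 1"
    proof (cases "1 - (norm (f t))\<^sup>2 \<ge> w0")
      case True
      have "s * (2 * (f t \<bullet> g t)) \<le> s * (2 * M)" using fg s by (intro mult_left_mono) auto
      then show ?thesis using eq True s2 sw by linarith
    next
      case False
      then have "w0 \<le> - (f t \<bullet> g t)" using t0(2)[OF t] by (auto simp: w0_def w_def max_def split: if_splits)
      then have "s * (2 * (f t \<bullet> g t)) \<le> s * (- 2 * w0)" using s by (intro mult_left_mono) auto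
      moreover have "s * (s * M\<^sup>2) \<le> s * w0"
      proof (rule mult_left_mono)
        have "0 \<le> s * (2 * M)" using s M by simp
        then show "s * M\<^sup>2 \<le> w0" using sw by linarith
      qed (use s in auto)
      moreover have "0 < s * w0" using s \<open>w0 > 0\<close> by simp
      moreover have "(norm (f t))\<^sup>2 \<le> 1" using f1[OF t] by (simp add: power_le_one)
      ultimately show ?thesis using eq s2 by (simp add: algebra_simps)
    qed
    then show ?thesis by (simp add: power_le_one_iff)
  qed
  then have "nrm (\<lambda>t. f t + s *\<^sub>R g t) \<le> 1" by (rule nrm_le)
  then show thesis using that[of s] s by blast
qed

text \<open>The mean lives on the set where the Ekeland point \<open>f\<close> of \<open>L\<close> attains its norm. Passing from \<open>g\<close>
  to \<open>(\<kappa> - \<delta>) f - g\<close> with \<open>\<kappa> = min (f \<bullet> g)\<close> on that set makes the perturbation lemma applicable.\<close>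

lemma peak_mean:
  assumes L: "functional L" and C: "\<And>g. g \<in> Y \<Longrightarrow> norm (L g) \<le> C * nrm g" and \<epsilon>: "\<epsilon> > 0"
  obtains f where "f \<in> Y" "nrm f \<le> 1"
    "{t \<in> K. norm (f t) = 1} = {} \<longrightarrow> (\<forall>g\<in>Y. L g \<bullet> 1 \<le> \<epsilon> * nrm g)"
    "{t \<in> K. norm (f t) = 1} \<noteq> {} \<longrightarrow>
      (\<exists>m r. mean {t \<in> K. norm (f t) = 1} m \<and> 0 \<le> r \<and> r \<le> C \<and>
        (\<forall>g\<in>Y. L g \<bullet> 1 \<le> r * m (\<lambda>t. f t \<bullet> g t) + \<epsilon> * nrm g))"
proof -
  \<comment> \<open>Half of the error, because the function \<open>h\<close> tested below can have
    norm up to \<open>2 * nrm g + \<delta>'\<close>.\<close>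
  have \<epsilon>2: "\<epsilon> / 2 > 0" using \<epsilon> by simp
  obtain f where f: "f \<in> Y" "nrm f \<le> 1" and r0: "L f \<bullet> 1 \<ge> 0" and
    ek: "\<And>g. g \<in> Y \<Longrightarrow> nrm g \<le> 1 \<Longrightarrow> (L g - L f) \<bullet> 1 \<le> \<epsilon> / 2 * nrm (\<lambda>t. g t - f t)"
    using ekeland[OF L \<epsilon>2] by blast
  define D where "D = {t \<in> K. norm (f t) = 1}"
  define r where "r = L f \<bullet> 1"
  have C0: "0 \<le> C * nrm f" using C[OF f(1)] norm_ge_zero order_trans by blast
  have neg: "L g \<bullet> 1 \<le> \<epsilon> / 2 * nrm g" if g: "g \<in> Y" and g_neg: "\<And>t. t \<in> D \<Longrightarrow> f t \<bullet> g t < 0" for g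
  proof -
    obtain s where s: "s > 0" "nrm (\<lambda>t. f t + s *\<^sub>R g t) \<le> 1"
      using peak_perturbation[OF f g] g_neg by (auto simp: D_def)
    have sg: "(\<lambda>t. s *\<^sub>R g t) \<in> Y" by (rule scaleR[OF g])
    have "s * (L g \<bullet> 1) = (L (\<lambda>t. f t + s *\<^sub>R g t) - L f) \<bullet> 1"
      using functional_add[OF L f(1) sg] functional_scaleR[OF L g] by simp
    also have "\<dots> \<le> \<epsilon> / 2 * nrm (\<lambda>t. s *\<^sub>R g t)" using ek[OF add[OF f(1) sg] s(2)] by simp
    also have "\<dots> \<le> \<epsilon> / 2 * (s * nrm g)"
      using nrm_scaleR_le[OF g, of s] s \<epsilon> by (intro mult_left_mono) auto
    finally have "s * (L g \<bullet> 1) \<le> s * (\<epsilon> / 2 * nrm g)" by (simp add: algebra_simps)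
    then show ?thesis using s(1) by simp
  qed
  \<comment> \<open>\<open>C\<close> bounds \<open>L\<close> only through products with norms, so
    its sign is known only once some norm is positive; a peak point makes \<open>nrm f\<close>
    positive.\<close>
  have C_nonneg: "0 \<le> C" if ne: "D \<noteq> {}"
  proof -
    obtain t where "t \<in> D" using ne by blast
    then have "1 \<le> nrm f" using norm_le_nrm[OF f(1), of t] by (simp add: D_def)
    then show ?thesis using C0 by (simp add: zero_le_mult_iff)
  qed
  have r_le: "r \<le> C" if "D \<noteq> {}"
  proof -
    have "r \<le> norm (L f)" using norm_cauchy_schwarz[of "L f" 1] by (simp add: r_def)
    also have "\<dots> \<le> C * nrm f" by (rule C[OF f(1)])
    also have "\<dots> \<le> C" using mult_left_mono[OF f(2) C_nonneg[OF that]] by simp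
    finally show ?thesis .
  qed
  have "continuous_on K f" by (rule continuous[OF f(1)])
  then have "closedin (top_of_set K) (K \<inter> (\<lambda>t. norm (f t)) -` {1})"
    by (intro continuous_closedin_preimage continuous_on_norm) auto
  moreover have "K \<inter> (\<lambda>t. norm (f t)) -` {1} = D" by (auto simp: D_def)
  ultimately have D: "compact D" using closedin_compact[OF compact] by simp
  have lower: "\<exists>t\<in>D. r * (f t \<bullet> g t) < L g \<bullet> 1 + \<epsilon> * nrm g + \<delta>"
    if ne: "D \<noteq> {}" and g: "g \<in> Y" and \<delta>: "\<delta> > 0" for g \<delta>
  proof -
    have "continuous_on D (\<lambda>t. f t \<bullet> g t)"
      by (intro continuous_on_inner continuous_on_subset[OF continuous] f g) (auto simp: D_def)
    then obtain t0 where t0: "t0 \<in> D" "\<And>t. t \<in> D \<Longrightarrow> f t0 \<bullet> g t0 \<le> f t \<bullet> g t"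
      using continuous_attains_inf[OF D ne] by blast
    define \<kappa> where "\<kappa> = f t0 \<bullet> g t0"
    have "\<bar>\<kappa>\<bar> \<le> norm (f t0) * norm (g t0)" unfolding \<kappa>_def by (rule Cauchy_Schwarz_ineq2)
    then have \<kappa>: "\<bar>\<kappa>\<bar> \<le> nrm g" using t0(1) norm_le_nrm[OF g, of t0] by (simp add: D_def)
    \<comment> \<open>The shift makes \<open>f \<bullet> h\<close> strictly negative. It costs
      \<open>\<delta>' * r\<close> in \<open>L h\<close> and at most
      \<open>\<delta>' * \<epsilon>\<close> through the norm of \<open>h\<close>, together
      \<open>\<delta> / 2\<close>.\<close>
    define \<delta>' where "\<delta>' = \<delta> / (2 * (\<epsilon> + r))"
    have er: "\<epsilon> + r > 0" using \<epsilon> r0 by (simp add: r_def)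
    have \<delta>': "\<delta>' > 0" "\<delta>' * (\<epsilon> + r) = \<delta> / 2" using \<delta> er by (auto simp: \<delta>'_def field_simps)
    define h where "h t = (\<kappa> - \<delta>') *\<^sub>R f t - g t" for t
    have cf: "(\<lambda>t. (\<kappa> - \<delta>') *\<^sub>R f t) \<in> Y" by (rule scaleR[OF f(1)])
    have hY: "h \<in> Y" unfolding h_def by (rule diff[OF cf g])
    have "f t \<bullet> h t < 0" if "t \<in> D" for t
    proof -
      have "f t \<bullet> f t = 1" using that by (simp add: D_def dot_square_norm)
      then have "f t \<bullet> h t = \<kappa> - \<delta>' - f t \<bullet> g t" by (simp add: h_def inner_diff_right)
      then show ?thesis using t0(2)[OF that] \<delta>' by (simp add: \<kappa>_def)
    qed
    then have "L h \<bullet> 1 \<le> \<epsilon> / 2 * nrm h" by (rule neg[OF hY])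
    moreover have "L h \<bullet> 1 = (\<kappa> - \<delta>') * r - L g \<bullet> 1"
      unfolding h_def using functional_diff[OF L cf g] functional_scaleR[OF L f(1)]
      by (simp add: inner_diff_left r_def)
    moreover have "\<epsilon> / 2 * nrm h \<le> \<epsilon> / 2 * (2 * nrm g + \<delta>')"
    proof (rule mult_left_mono)
      have "nrm h \<le> nrm (\<lambda>t. (\<kappa> - \<delta>') *\<^sub>R f t) + nrm g" unfolding h_def by (rule nrm_diff_le[OF cf g])
      also have "nrm (\<lambda>t. (\<kappa> - \<delta>') *\<^sub>R f t) \<le> \<bar>\<kappa> - \<delta>'\<bar> * nrm f" by (rule nrm_scaleR_le[OF f(1)])
      also have "\<dots> \<le> \<bar>\<kappa> - \<delta>'\<bar> * 1" using f(2) by (intro mult_left_mono) auto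
      also have "\<dots> \<le> nrm g + \<delta>'" using \<kappa> \<delta>'(1) by simp
      finally show "nrm h \<le> 2 * nrm g + \<delta>'" by simp
    qed (use \<epsilon> in auto)
    ultimately have "(\<kappa> - \<delta>') * r - L g \<bullet> 1 \<le> \<epsilon> * nrm g + \<epsilon> / 2 * \<delta>'" by (simp add: algebra_simps)
    moreover have "\<epsilon> / 2 * \<delta>' \<le> \<epsilon> * \<delta>'" using \<epsilon> \<delta>' by simp
    ultimately have "r * \<kappa> \<le> L g \<bullet> 1 + \<epsilon> * nrm g + \<delta>' * (\<epsilon> + r)" by (simp add: algebra_simps)
    then have "r * (f t0 \<bullet> g t0) < L g \<bullet> 1 + \<epsilon> * nrm g + \<delta>" using \<delta>' \<delta> by (simp add: \<kappa>_def)
    then show ?thesis using t0(1) by blast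
  qed
  show thesis
  proof (rule that[OF f]; intro impI ballI)
    fix g assume "{t \<in> K. norm (f t) = 1} = {}" and g: "g \<in> Y"
    then have "D = {}" by (simp add: D_def)
    have "L g \<bullet> 1 \<le> \<epsilon> / 2 * nrm g" by (rule neg[OF g]) (use \<open>D = {}\<close> in auto)
    also have "\<dots> \<le> \<epsilon> * nrm g" using \<epsilon> nrm_nonneg[OF g] by (intro mult_right_mono) auto
    finally show "L g \<bullet> 1 \<le> \<epsilon> * nrm g" .
  next
    assume "{t \<in> K. norm (f t) = 1} \<noteq> {}"
    then have ne: "D \<noteq> {}" by (simp add: D_def)
    have bdd: "(\<lambda>t. f t \<bullet> g t) \<in> bounded_on D" if g: "g \<in> Y" for g
    proof (rule bounded_onI[of _ _ "nrm g"])
      fix t assume "t \<in> D"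
      then show "\<bar>f t \<bullet> g t\<bar> \<le> nrm g"
        using Cauchy_Schwarz_ineq2[of "f t" "g t"] norm_le_nrm[OF g, of t] by (simp add: D_def)
    qed
    \<comment> \<open>The constraints ask that the mean of \<open>r * (f \<bullet> g)\<close> be at
      most \<open>L g \<bullet> 1 + \<epsilon> * nrm g\<close>, and \<open>lower\<close> is the
      solvability condition of the minimax theorem. The conclusion is the constraint at
      \<open>- g\<close>.\<close>
    define W where "W = {(\<lambda>t. r * (f t \<bullet> g t), c) | g c. g \<in> Y \<and> c \<ge> L g \<bullet> 1 + \<epsilon> * nrm g}"
    have WI: "(w, c) \<in> W" if "g \<in> Y" "w = (\<lambda>t. r * (f t \<bullet> g t))" "c \<ge> L g \<bullet> 1 + \<epsilon> * nrm g" for w c g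
      using that unfolding W_def by blast
    have WE: "\<exists>g. g \<in> Y \<and> w = (\<lambda>t. r * (f t \<bullet> g t)) \<and> c \<ge> L g \<bullet> 1 + \<epsilon> * nrm g" if "(w, c) \<in> W" for w c
      using that unfolding W_def by blast
    obtain m where m: "mean D m" "\<And>w c. (w, c) \<in> W \<Longrightarrow> m w \<le> c"
    proof (rule exists_mean[of W D])
      show "real_cone W"
        unfolding real_cone_def
      proof (intro conjI allI impI)
        show "(0, 0) \<in> W"
          by (rule WI[OF zero]) (auto simp: zero_fun_def functional_zero[OF L] nrm_zero)
        fix v c assume "(v, c) \<in> W"
        then obtain g where g: "g \<in> Y" "v = (\<lambda>t. r * (f t \<bullet> g t))" "c \<ge> L g \<bullet> 1 + \<epsilon> * nrm g"
          using WE by blast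
        show "(v + w, c + d) \<in> W" if wd: "(w, d) \<in> W" for w d
        proof -
          obtain h where h: "h \<in> Y" "w = (\<lambda>t. r * (f t \<bullet> h t))" "d \<ge> L h \<bullet> 1 + \<epsilon> * nrm h"
            using WE[OF wd] by blast
          have "\<epsilon> * nrm (\<lambda>t. g t + h t) \<le> \<epsilon> * (nrm g + nrm h)"
            using \<epsilon> by (intro mult_left_mono nrm_add_le g h) auto
          then show ?thesis
            by (intro WI[OF add[OF g(1) h(1)]])
              (use g h functional_add[OF L g(1) h(1)] in \<open>auto simp: algebra_simps fun_eq_iff\<close>)
        qed
        show "(a *\<^sub>R v, a * c) \<in> W" if "a > 0" for a :: real
        proof (rule WI[OF scaleR[OF g(1), of a]])
          have "L (\<lambda>t. a *\<^sub>R g t) \<bullet> 1 + \<epsilon> * nrm (\<lambda>t. a *\<^sub>R g t) \<le> a * (L g \<bullet> 1) + \<epsilon> * (a * nrm g)"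
            using functional_scaleR[OF L g(1), of a] nrm_scaleR_le[OF g(1), of a] that \<epsilon>
            by (auto intro!: mult_left_mono)
          also have "\<dots> = a * (L g \<bullet> 1 + \<epsilon> * nrm g)" by (simp add: algebra_simps)
          also have "\<dots> \<le> a * c" using g(3) that by (intro mult_left_mono) auto
          finally show "L (\<lambda>t. a *\<^sub>R g t) \<bullet> 1 + \<epsilon> * nrm (\<lambda>t. a *\<^sub>R g t) \<le> a * c" .
        qed (use g in \<open>auto simp: fun_eq_iff algebra_simps\<close>)
      qed
      show "w \<in> bounded_on D" if "(w, c) \<in> W" for w c
        using WE[OF that] bdd by auto
      show "\<exists>x\<in>D. w x < c + \<delta>" if wc: "(w, c) \<in> W" and \<delta>: "\<delta> > 0" for w c \<delta>
      proof -
        obtain g where g: "g \<in> Y" "w = (\<lambda>t. r * (f t \<bullet> g t))" "c \<ge> L g \<bullet> 1 + \<epsilon> * nrm g"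
          using WE[OF wc] by blast
        then show ?thesis using lower[OF ne g(1) \<delta>] by force
      qed
    qed blast
    have "L g \<bullet> 1 \<le> r * m (\<lambda>t. f t \<bullet> g t) + \<epsilon> * nrm g" if g: "g \<in> Y" for g
    proof -
      have ng: "(\<lambda>t. - 1 * g t) \<in> Y" by (rule scale[OF g])
      have "m (\<lambda>t. r * (f t \<bullet> (- 1 * g t))) \<le> L (\<lambda>t. - 1 * g t) \<bullet> 1 + \<epsilon> * nrm (\<lambda>t. - 1 * g t)"
        by (rule m(2)[OF WI[OF ng]]) auto
      moreover have "L (\<lambda>t. - 1 * g t) \<bullet> 1 = - (L g \<bullet> 1)" using functional_scale[OF L g, of "- 1"] by simp
      moreover have "nrm (\<lambda>t. - 1 * g t) = nrm g" by (simp add: nrm_def)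
      moreover have "m (\<lambda>t. r * (f t \<bullet> (- 1 * g t))) = - r * m (\<lambda>t. f t \<bullet> g t)"
        using mean_scale[OF m(1) bdd[OF g], of "- r"] by simp
      ultimately show ?thesis by simp
    qed
    then show "\<exists>m r. mean {t \<in> K. norm (f t) = 1} m \<and> 0 \<le> r \<and> r \<le> C \<and>
        (\<forall>g\<in>Y. L g \<bullet> 1 \<le> r * m (\<lambda>t. f t \<bullet> g t) + \<epsilon> * nrm g)"
      using m(1) r0 r_le[OF ne] unfolding D_def[symmetric] r_def by blast
  qed
qed

end

section \<open>Independent cells and copies of \<open>\<ell>\<^sub>1\<close>\<close>

lemma ultrafilter_finite_choice:
  assumes "finite C" and U: "\<And>P. eventually P U \<or> eventually (\<lambda>x. \<not> P x) U" "U \<noteq> bot"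
    and "eventually (\<lambda>x. \<exists>c\<in>C. P c x) U"
  obtains c where "c \<in> C" "eventually (P c) U"
proof (rule ccontr)
  assume "\<not> thesis"
  then have "\<forall>c\<in>C. eventually (\<lambda>x. \<not> P c x) U" using that U(1) by blast
  then have "eventually (\<lambda>x. \<forall>c\<in>C. \<not> P c x) U" using assms(1) by (simp add: eventually_ball_finite)
  then have "eventually (\<lambda>x. False) U" using assms(4) by eventually_elim blast
  then show False using U(2) by (simp add: trivial_limit_def)
qed

text \<open>A set \<open>Z\<close> is good if some \<open>A \<subseteq> Z\<close> has \<open>\<Phi> A > \<gamma> m A\<close>, where \<open>\<Phi> A\<close> is the limit of the integrals of
  \<open>q S\<close> over \<open>A\<close> along the ultrafilter. Goodness survives intersection both with the points where \<open>q S\<close>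
  is large (a nearly maximal \<open>A\<close> as in the Hahn decomposition) and with those where it is small (a point
  of \<open>Z\<close> all of whose neighbourhoods are good). Minimising the set of cell centres that can be used in a
  good set makes one pair of cells usable in all good subsets simultaneously.\<close>

lemma independent_cells:
  fixes q :: "'s \<Rightarrow> 't::topological_space \<Rightarrow> 'k::real_or_complex"
  assumes U: "U \<noteq> bot" "\<And>P. eventually P U \<or> eventually (\<lambda>x. \<not> P x) U"
    and D: "compact D" and mean: "mean D m"
    and ok: "\<forall>\<^sub>F S in U. ok S" and cont: "\<And>S. ok S \<Longrightarrow> continuous_on D (q S)"
    and bound: "\<And>S t. ok S \<Longrightarrow> t \<in> D \<Longrightarrow> norm (q S t) \<le> 1"
    and gap: "\<And>t. t \<in> D \<Longrightarrow> \<forall>\<^sub>F S in U. m (\<lambda>x. q S x \<bullet> 1) - q S t \<bullet> 1 \<ge> \<delta>"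
    and \<delta>: "\<delta> > 0" and \<eta>: "\<eta> > 0"
  obtains a b and \<sigma> :: "nat \<Rightarrow> 's" where "(a - b) \<bullet> 1 \<ge> \<delta> / 3 - 2 * \<eta>" "\<And>n. ok (\<sigma> n)"
    "\<And>e n. \<exists>t\<in>D. \<forall>i<n. norm (q (\<sigma> i) t - (if e i then a else b)) \<le> \<eta>"
proof -
  define \<nu> where "\<nu> A = m (indicator A)" for A
  define I where "I S A = m (\<lambda>x. indicator A x * (q S x \<bullet> 1))" for S A
  have re_le: "\<bar>q S t \<bullet> 1\<bar> \<le> 1" if "ok S" "t \<in> D" for S t
    using Cauchy_Schwarz_ineq2[of "q S t" 1] bound[OF that] by simp
  have re_bdd: "(\<lambda>x. q S x \<bullet> 1) \<in> bounded_on D" if "ok S" for S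
    using re_le[OF that] by (rule bounded_onI)
  have ind_bdd: "(\<lambda>x. indicator A x * (q S x \<bullet> 1)) \<in> bounded_on D" if "ok S" for S A
    using re_bdd[OF that] by (intro bounded_on_mult bounded_on_indicator)
  have I_le: "\<bar>I S A\<bar> \<le> \<nu> A" if S: "ok S" for S A
  proof -
    have "I S A \<le> \<nu> A" unfolding I_def \<nu>_def
      by (rule mean_mono[OF mean ind_bdd[OF S]]) (use re_le[OF S] in \<open>force simp: indicator_def abs_le_iff\<close>)+
    moreover have "m (\<lambda>x. (- 1) * (indicator A x * (q S x \<bullet> 1))) \<le> \<nu> A" unfolding \<nu>_def
      by (rule mean_mono[OF mean]) (use ind_bdd[OF S] re_le[OF S] in \<open>force simp: indicator_def abs_le_iff\<close>)+
    then have "- I S A \<le> \<nu> A" using mean_scale[OF mean ind_bdd[OF S], of "- 1"] by (simp add: I_def)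
    ultimately show ?thesis by simp
  qed
  have \<nu>_le: "\<nu> A \<le> 1" for A unfolding \<nu>_def by (rule mean_upper[OF mean]) (auto simp: indicator_def)
  have \<nu>_nonneg: "\<nu> A \<ge> 0" for A
    using mean_mono[OF mean, of "\<lambda>_. 0" "indicator A"] mean_const[OF mean, of 0] by (simp add: \<nu>_def)
  have "\<exists>l. ((\<lambda>S. I S A) \<longlongrightarrow> l) U" for A
  proof -
    have "\<forall>\<^sub>F S in U. norm (I S A) \<le> 1"
      using ok by eventually_elim (use I_le \<nu>_le order_trans in fastforce)
    then show ?thesis using ultrafilter_limit[OF U] by metis
  qed
  \<comment> \<open>The ultrafilter makes the integrals over all sets \<open>A\<close> converge at
    once. By \<open>gap\<close> the pointwise limits of the real parts stay at least
    \<open>\<delta>\<close> below the limit \<open>\<Phi> D\<close> of their means; this failure of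
    dominated convergence is the source of the oscillation.\<close>
  then obtain \<Phi> where \<Phi>: "\<And>A. ((\<lambda>S. I S A) \<longlongrightarrow> \<Phi> A) U" by metis
  have \<Phi>_le: "\<bar>\<Phi> A\<bar> \<le> \<nu> A" for A
  proof (rule tendsto_upperbound[OF tendsto_rabs[OF \<Phi>]])
    show "\<forall>\<^sub>F S in U. \<bar>I S A\<bar> \<le> \<nu> A" using ok by eventually_elim (rule I_le)
  qed (use U in auto)
  have ind_Un: "(indicator (A \<union> B) x :: real) = indicator A x + indicator B x" if "A \<inter> B = {}" for A B :: "'t set" and x
    using that by (auto simp: indicator_def)
  have \<nu>_add: "\<nu> (A \<union> B) = \<nu> A + \<nu> B" if "A \<inter> B = {}" for A B
    unfolding \<nu>_def ind_Un[OF that, abs_def] by (rule mean_add[OF mean]) auto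
  have I_add: "I S (A \<union> B) = I S A + I S B" if "A \<inter> B = {}" "ok S" for A B S
    unfolding I_def ind_Un[OF that(1)] distrib_right by (rule mean_add[OF mean]) (rule ind_bdd[OF that(2)])+
  have \<Phi>_add: "\<Phi> (A \<union> B) = \<Phi> A + \<Phi> B" if "A \<inter> B = {}" for A B
  proof (rule tendsto_unique[OF U(1) \<Phi>])
    have "\<forall>\<^sub>F S in U. I S A + I S B = I S (A \<union> B)"
      using ok by eventually_elim (use I_add[OF that] in auto)
    then show "((\<lambda>S. I S (A \<union> B)) \<longlongrightarrow> \<Phi> A + \<Phi> B) U"
      using tendsto_add[OF \<Phi>[of A] \<Phi>[of B]] by (rule Lim_transform_eventually[rotated])
  qed
  define \<beta> where "\<beta> = \<Phi> D"
  have I_D: "I S D = m (\<lambda>x. q S x \<bullet> 1)" if "ok S" for S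
    unfolding I_def by (rule mean_cong[OF mean ind_bdd[OF that]]) auto
  have \<nu>_D: "\<nu> D = 1"
    using mean_cong[OF mean, of "indicator D" "\<lambda>_. 1"] mean_const[OF mean, of 1] by (simp add: \<nu>_def)
  have \<beta>_le: "\<beta> \<le> 1" using \<Phi>_le[of D] \<nu>_D by (simp add: \<beta>_def)
  \<comment> \<open>Thirds of \<open>\<delta>\<close>. At each point the real part of
    \<open>q S\<close> is eventually below \<open>\<alpha>\<close>, one third being spent on
    \<open>I S D < \<beta> + \<delta> / 3\<close>; another third separates \<open>\<gamma>\<close>
    from the density \<open>\<beta>\<close> of \<open>D\<close>. The band between
    \<open>\<alpha>\<close> and \<open>\<gamma>\<close> becomes the distance of the two
    cells.\<close>
  define \<gamma> where "\<gamma> = \<beta> - \<delta> / 3"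
  define \<alpha> where "\<alpha> = \<beta> - 2 * \<delta> / 3"
  have \<gamma>1: "\<gamma> < 1" using \<beta>_le \<delta> by (simp add: \<gamma>_def)
  define good where "good Z \<longleftrightarrow> (\<exists>A\<subseteq>Z. \<gamma> * \<nu> A < \<Phi> A)" for Z
  have good_D: "good D" using \<delta> \<nu>_D by (auto simp: good_def \<beta>_def[symmetric] \<gamma>_def intro!: exI[of _ D])
  have "\<nu> {} = 0" "\<Phi> {} = 0" using \<nu>_add[of "{}" "{}"] \<Phi>_add[of "{}" "{}"] by simp_all
  then have good_ne: "Z \<noteq> {}" if "good Z" for Z using that by (auto simp: good_def)
  have good_mono: "good Z'" if "good Z" "Z \<subseteq> Z'" for Z Z' using that by (auto simp: good_def)
  \<comment> \<open>If the additive function \<open>\<Phi> - \<gamma> * \<nu>\<close> is positive on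
    a set, it is positive on one of any two pieces. Good sets are thus partition regular.\<close>
  have good_Un: "good Z1 \<or> good Z2" if "good Z" "Z \<subseteq> Z1 \<union> Z2" for Z Z1 Z2
  proof (rule ccontr)
    assume no: "\<not> ?thesis"
    obtain A where A: "A \<subseteq> Z" "\<gamma> * \<nu> A < \<Phi> A" using \<open>good Z\<close> by (auto simp: good_def)
    have "\<Phi> (A \<inter> Z1) \<le> \<gamma> * \<nu> (A \<inter> Z1)" "\<Phi> (A - Z1) \<le> \<gamma> * \<nu> (A - Z1)"
      using no that(2) A(1) unfolding good_def by (meson Int_lower2 not_le, meson Diff_subset_conv not_le order_trans)
    moreover have dis: "(A \<inter> Z1) \<inter> (A - Z1) = {}" and un: "(A \<inter> Z1) \<union> (A - Z1) = A" by auto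
    ultimately show False
      using A(2) \<nu>_add[OF dis] \<Phi>_add[OF dis] unfolding un by (simp add: algebra_simps)
  qed
  have good_UN: "\<exists>c\<in>C. good (Z \<inter> W c)" if "finite C" "good Z" "Z \<subseteq> (\<Union>c\<in>C. W c)" for C Z and W :: "'c \<Rightarrow> 't set"
    using that
  proof (induction C arbitrary: Z rule: finite_induct)
    case empty
    then show ?case using good_ne by auto
  next
    case (insert c C)
    have "good (Z \<inter> W c) \<or> good (Z \<inter> (\<Union>c\<in>C. W c))"
      by (rule good_Un[OF insert.prems(1)]) (use insert.prems(2) in auto)
    then show ?case
    proof
      assume "good (Z \<inter> (\<Union>c\<in>C. W c))"
      then obtain c' where "c' \<in> C" "good (Z \<inter> (\<Union>c\<in>C. W c) \<inter> W c')" using insert.IH[of "Z \<inter> (\<Union>c\<in>C. W c)"] by auto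
      then show ?thesis using good_mono[of "Z \<inter> (\<Union>c\<in>C. W c) \<inter> W c'" "Z \<inter> W c'"] by blast
    qed blast
  qed
  have high: "\<forall>\<^sub>F S in U. good (Z \<inter> {t \<in> D. q S t \<bullet> 1 \<ge> \<gamma>})" if Z: "good Z" "Z \<subseteq> D" for Z
  proof -
    obtain A0 where A0: "A0 \<subseteq> Z" "\<gamma> * \<nu> A0 < \<Phi> A0" using Z(1) by (auto simp: good_def)
    \<comment> \<open>Raising the density slightly, from \<open>\<gamma>\<close> to
      \<open>g\<close>, buys the room in which near maximality of \<open>A\<close> for
      \<open>\<Psi>\<close> is enough.\<close>
    have "\<exists>g. \<gamma> < g \<and> g * \<nu> A0 < \<Phi> A0"
    proof -
      have "\<nu> A0 > 0" using A0(2) \<Phi>_le[of A0] \<nu>_nonneg[of A0] by (cases "\<nu> A0 = 0") auto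
      then have "\<gamma> < \<Phi> A0 / \<nu> A0" using A0(2) by (simp add: field_simps)
      then obtain g where "\<gamma> < g" "g < \<Phi> A0 / \<nu> A0" using dense by blast
      then show ?thesis using \<open>\<nu> A0 > 0\<close> by (intro exI[of _ g]) (auto simp: field_simps)
    qed
    then obtain g where g: "\<gamma> < g" "g * \<nu> A0 < \<Phi> A0" by blast
    define \<Psi> where "\<Psi> A = \<Phi> A - g * \<nu> A" for A
    have \<Psi>_add: "\<Psi> (A \<union> B) = \<Psi> A + \<Psi> B" if "A \<inter> B = {}" for A B
      using \<nu>_add[OF that] \<Phi>_add[OF that] by (simp add: \<Psi>_def algebra_simps)
    have \<Psi>_le: "\<Psi> A \<le> (1 + \<bar>g\<bar>) * \<nu> A" for A
    proof -
      have "- g * \<nu> A \<le> \<bar>g\<bar> * \<nu> A" using \<nu>_nonneg[of A] by (intro mult_right_mono) auto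
      then show ?thesis using \<Phi>_le[of A] by (simp add: \<Psi>_def algebra_simps)
    qed
    have g0: "1 + \<bar>g\<bar> > 0" by simp
    define s where "s = Sup (\<Psi> ` Pow Z)"
    have bdd: "bdd_above (\<Psi> ` Pow Z)"
    proof (rule bdd_aboveI[of _ "1 + \<bar>g\<bar>"])
      fix x assume "x \<in> \<Psi> ` Pow Z"
      then obtain A where "x = \<Psi> A" by blast
      then show "x \<le> 1 + \<bar>g\<bar>" using \<Psi>_le[of A] mult_left_mono[OF \<nu>_le[of A], of "1 + \<bar>g\<bar>"] by simp
    qed
    have s_upper: "\<Psi> A \<le> s" if "A \<subseteq> Z" for A unfolding s_def using bdd that by (auto intro: cSUP_upper)
    have "s > 0" using s_upper[OF A0(1)] g(2) by (simp add: \<Psi>_def)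
    \<comment> \<open>If \<open>B\<close> is the part of \<open>A\<close> where \<open>q S\<close>
      is large, averaging gives \<open>(g - \<gamma>) * \<nu> B > 2 * p * \<nu> A\<close>. As
      \<open>\<nu> A > s1\<close>, the right side exceeds the defect \<open>d \<le> p * s1\<close>
      tolerated in the maximality of \<open>A\<close>, so \<open>B\<close> still has density above
      \<open>\<gamma>\<close>. The bound \<open>d \<le> s / 2\<close> is what ensures
      \<open>\<nu> A > s1\<close>.\<close>
    define p where "p = (g - \<gamma>)\<^sup>2 / (2 - 2 * \<gamma>)"
    define s1 where "s1 = s / (2 * (1 + \<bar>g\<bar>))"
    have pos: "p > 0" using g \<gamma>1 by (simp add: p_def)
    have s1_pos: "s1 > 0" using \<open>s > 0\<close> g0 by (simp add: s1_def)
    define d where "d = min (s / 2) (p * s1 )"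
    have "d > 0" using \<open>s > 0\<close> pos s1_pos by (simp add: d_def)
    then obtain A where A: "A \<subseteq> Z" "s - d < \<Psi> A"
      using less_cSupD[of "\<Psi> ` Pow Z" "s - d"] unfolding s_def by auto
    \<comment> \<open>If a part of \<open>A\<close> had \<open>\<Psi>\<close> below
      \<open>- d\<close>, removing it would push \<open>\<Psi>\<close> above the supremum
      \<open>s\<close>.\<close>
    have lower: "- d \<le> \<Psi> B" if "B \<subseteq> A" for B
    proof -
      have "\<Psi> A = \<Psi> B + \<Psi> (A - B)" using \<Psi>_add[of B "A - B"] that by (simp add: Un_absorb1)
      moreover have "\<Psi> (A - B) \<le> s" using A(1) by (intro s_upper) blast
      ultimately show ?thesis using A(2) by simp
    qed
    have "\<Psi> A > s / 2" using A(2) by (auto simp: d_def)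
    then have \<nu>_A: "\<nu> A > s1" and \<Psi>_A: "\<Psi> A > 0" using \<Psi>_le[of A] \<open>s > 0\<close> g0 by (auto simp: s1_def field_simps)
    have "\<forall>\<^sub>F S in U. g * \<nu> A < I S A"
      using order_tendstoD(1)[OF \<Phi>] \<Psi>_A by (simp add: \<Psi>_def)
    with ok show ?thesis
    proof eventually_elim
      case (elim S)
      define B where "B = A \<inter> {t \<in> D. q S t \<bullet> 1 \<ge> \<gamma>}"
      have "I S A \<le> m (\<lambda>x. indicator B x + \<gamma> * indicator (A - B) x)"
        unfolding I_def
      proof (rule mean_mono[OF mean ind_bdd[OF elim(1)]])
        fix x assume "x \<in> D"
        then show "indicator A x * (q S x \<bullet> 1) \<le> indicator B x + \<gamma> * indicator (A - B) x"
          using re_le[OF elim(1), of x] by (auto simp: indicator_def B_def)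
      qed (intro bounded_on_add bounded_on_mult bounded_on_const bounded_on_indicator)
      also have "\<dots> = \<nu> B + \<gamma> * \<nu> (A - B)"
        using mean_add[OF mean bounded_on_indicator
            bounded_on_mult[OF bounded_on_const bounded_on_indicator], of B \<gamma> "A - B"]
          mean_scale[OF mean bounded_on_indicator, of \<gamma> "A - B"] by (simp add: \<nu>_def)
      also have "\<nu> (A - B) = \<nu> A - \<nu> B" using \<nu>_add[of B "A - B"] by (simp add: B_def Un_absorb1 Un_Diff_Int)
      finally have "g * \<nu> A < \<nu> B + \<gamma> * (\<nu> A - \<nu> B)" using elim(2) by simp
      then have "(g - \<gamma>) * \<nu> A < (1 - \<gamma>) * \<nu> B" by (simp add: algebra_simps)
      then have "\<nu> B > (g - \<gamma>) * \<nu> A / (1 - \<gamma>)" using \<gamma>1 by (simp add: field_simps)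
      then have "(g - \<gamma>) * \<nu> B > (g - \<gamma>) * ((g - \<gamma>) * \<nu> A / (1 - \<gamma>))"
        using g(1) by (intro mult_strict_left_mono) auto
      moreover have "(g - \<gamma>) * ((g - \<gamma>) * \<nu> A / (1 - \<gamma>)) = 2 * (p * \<nu> A)"
        using \<gamma>1 by (simp add: p_def power2_eq_square field_simps)
      moreover have "p * \<nu> A \<ge> d"
      proof -
        have "d \<le> p * s1" by (simp add: d_def)
        also have "\<dots> \<le> p * \<nu> A" using pos \<nu>_A by (intro mult_left_mono) auto
        finally show ?thesis .
      qed
      ultimately have "(g - \<gamma>) * \<nu> B > d" using \<open>d > 0\<close> by linarith
      moreover have "\<Psi> B \<ge> - d" by (rule lower) (simp add: B_def)
      ultimately have "\<gamma> * \<nu> B < \<Phi> B" by (simp add: \<Psi>_def algebra_simps)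
      moreover have "B \<subseteq> Z \<inter> {t \<in> D. q S t \<bullet> 1 \<ge> \<gamma>}" using A(1) by (auto simp: B_def)
      ultimately show ?case unfolding good_def by blast
    qed
  qed
  have low: "\<forall>\<^sub>F S in U. good (Z \<inter> {t \<in> D. q S t \<bullet> 1 \<le> \<alpha>})"
    if Z: "good Z" and cl: "closedin (top_of_set D) Z" for Z
  proof -
    have ZD: "Z \<subseteq> D" using cl by (simp add: closedin_subset[of "top_of_set D", simplified])
    have "compact Z" using closedin_compact[OF D cl] .
    have "\<exists>t\<in>Z. \<forall>V. open V \<longrightarrow> t \<in> V \<longrightarrow> good (Z \<inter> V)"
    proof (rule ccontr)
      assume "\<not> ?thesis"
      then have "\<forall>t\<in>Z. \<exists>V. open V \<and> t \<in> V \<and> \<not> good (Z \<inter> V)" by blast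
      then obtain V where V: "\<And>t. t \<in> Z \<Longrightarrow> open (V t) \<and> t \<in> V t \<and> \<not> good (Z \<inter> V t)" by metis
      obtain C where C: "C \<subseteq> Z" "finite C" "Z \<subseteq> (\<Union>c\<in>C. V c)"
        by (rule compactE_image[OF \<open>compact Z\<close>, of Z V]) (use V in auto)
      then show False using good_UN[OF C(2) Z C(3)] V by blast
    qed
    then obtain t where t: "t \<in> Z" "\<And>V. open V \<Longrightarrow> t \<in> V \<Longrightarrow> good (Z \<inter> V)" by blast
    have "\<forall>\<^sub>F S in U. I S D < \<beta> + \<delta> / 3"
      using order_tendstoD(2)[OF \<Phi>[of D]] \<delta> by (simp add: \<beta>_def)
    with ok gap[OF subsetD[OF ZD t(1)]] show ?thesis
    proof eventually_elim
      case (elim S)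
      have less: "q S t \<bullet> 1 < \<alpha>" using elim I_D by (auto simp: \<alpha>_def)
      have "continuous_on D (\<lambda>x. q S x \<bullet> 1)" using cont[OF elim(1)] by (intro continuous_intros)
      then have "openin (top_of_set D) (D \<inter> (\<lambda>x. q S x \<bullet> 1) -` {..<\<alpha>})"
        by (rule continuous_openin_preimage_gen) simp
      then obtain V where V: "open V" "D \<inter> (\<lambda>x. q S x \<bullet> 1) -` {..<\<alpha>} = D \<inter> V"
        unfolding openin_open by blast
      have "good (Z \<inter> V)" by (rule t(2)[OF V(1)]) (use V(2) less t(1) ZD in auto)
      moreover have "Z \<inter> V \<subseteq> Z \<inter> {t \<in> D. q S t \<bullet> 1 \<le> \<alpha>}"
      proof
        fix x assume x: "x \<in> Z \<inter> V"
        then have "x \<in> D \<inter> (\<lambda>x. q S x \<bullet> 1) -` {..<\<alpha>}" using V(2) ZD by blast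
        then show "x \<in> Z \<inter> {t \<in> D. q S t \<bullet> 1 \<le> \<alpha>}" using x by auto
      qed
      ultimately show ?case by (rule good_mono)
    qed
  qed
  have centre_mem: "c \<in> ball c \<eta>" for c :: 'k using \<eta> by simp
  \<comment> \<open>A finite \<open>\<eta>\<close>-net of the unit ball of the scalars, so that the
    cells of every admissible \<open>q S\<close> cover \<open>D\<close>. The cells are closed
    because \<open>low\<close> works only in closed sets.\<close>
  obtain C where C: "finite C" "cball (0::'k) 1 \<subseteq> (\<Union>c\<in>C. ball c \<eta>)"
    using centre_mem by (rule_tac compactE_image[OF compact_cball, of UNIV "\<lambda>c::'k. ball c \<eta>" 0 1]) blast+
  define cell where "cell S c = {t \<in> D. norm (q S t - c) \<le> \<eta>}" for S c
  have cells: "D \<subseteq> (\<Union>c\<in>C. cell S c)" if "ok S" for S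
  proof
    fix t assume t: "t \<in> D"
    then have "q S t \<in> cball 0 1" using bound[OF that] by simp
    then obtain c where "c \<in> C" "q S t \<in> ball c \<eta>" using C(2) by blast
    then show "t \<in> (\<Union>c\<in>C. cell S c)" using t by (auto simp: cell_def dist_norm norm_minus_commute intro!: bexI[of _ c])
  qed
  have cell_closed: "closedin (top_of_set D) (cell S c)" if "ok S" for S c
  proof -
    have "closedin (top_of_set D) (D \<inter> (\<lambda>t. norm (q S t - c)) -` {..\<eta>})"
      by (intro continuous_closedin_preimage continuous_intros cont[OF that])
    moreover have "D \<inter> (\<lambda>t. norm (q S t - c)) -` {..\<eta>} = cell S c" by (auto simp: cell_def)
    ultimately show ?thesis by simp
  qed
  define J where "J Z = {c \<in> C. \<forall>\<^sub>F S in U. good (Z \<inter> cell S c)}" for Z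
  have J_mono: "J Z \<subseteq> J Z'" if "Z \<subseteq> Z'" for Z Z'
    unfolding J_def using that by (auto elim!: eventually_mono intro: good_mono)
  define GC where "GC = {Z. good Z \<and> closedin (top_of_set D) Z}"
  have "D \<in> GC" using good_D by (simp add: GC_def)
  then obtain Z0 where Z0: "Z0 \<in> GC" and min: "\<And>Z. Z \<in> GC \<Longrightarrow> card (J Z0) \<le> card (J Z)"
    using ex_has_least_nat[of "\<lambda>Z. Z \<in> GC" D "\<lambda>Z. card (J Z)"] by blast
  have fin_J: "finite (J Z)" for Z using C(1) by (simp add: J_def)
  have J_eq: "J Z = J Z0" if "Z \<in> GC" "Z \<subseteq> Z0" for Z
    by (rule card_seteq[OF fin_J J_mono[OF that(2)] min[OF that(1)]])
  have Z0D: "Z0 \<subseteq> D" using Z0 closedin_subset[of "top_of_set D" Z0] by (simp add: GC_def)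
  \<comment> \<open>Used for two half planes \<open>R\<close>: the ultrafilter fixes one centre for
    almost all \<open>S\<close>, and its cell meets the half plane, so the centre itself is within
    \<open>\<eta>\<close> of it.\<close>
  have centre: "\<exists>c\<in>J Z0. \<exists>S. ok S \<and> Z0 \<inter> {t \<in> D. R (q S t)} \<inter> cell S c \<noteq> {}"
    if R: "\<forall>\<^sub>F S in U. good (Z0 \<inter> {t \<in> D. R (q S t)})" for R
  proof -
    have "\<forall>\<^sub>F S in U. \<exists>c\<in>C. good (Z0 \<inter> {t \<in> D. R (q S t)} \<inter> cell S c)"
      using R ok
    proof eventually_elim
      case (elim S)
      show ?case by (rule good_UN[OF C(1) elim(1)]) (use cells[OF elim(2)] in auto)
    qed
    then obtain c where c: "c \<in> C" "\<forall>\<^sub>F S in U. good (Z0 \<inter> {t \<in> D. R (q S t)} \<inter> cell S c)"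
      by (rule ultrafilter_finite_choice[OF C(1) U(2) U(1)])
    from c(2) have "\<forall>\<^sub>F S in U. good (Z0 \<inter> cell S c)"
      by eventually_elim (erule good_mono, blast)
    then have "c \<in> J Z0" using c(1) by (simp add: J_def)
    moreover have "\<exists>S. ok S \<and> good (Z0 \<inter> {t \<in> D. R (q S t)} \<inter> cell S c)"
      using eventually_happens'[OF U(1) eventually_conj[OF ok c(2)]] .
    ultimately show ?thesis using good_ne by blast
  qed
  have re_diff: "\<bar>z \<bullet> 1 - c \<bullet> 1\<bar> \<le> \<eta>" if "norm (z - c) \<le> \<eta>" for z c :: 'k
    using Cauchy_Schwarz_ineq2[of "z - c" 1] that by (simp add: inner_diff_left)
  have "good Z0" "closedin (top_of_set D) Z0" using Z0 by (auto simp: GC_def)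
  obtain a where a: "a \<in> J Z0" "a \<bullet> 1 \<ge> \<gamma> - \<eta>"
  proof -
    obtain a S t where "a \<in> J Z0" "t \<in> cell S a" "q S t \<bullet> 1 \<ge> \<gamma>"
      using centre[of "\<lambda>z. z \<bullet> 1 \<ge> \<gamma>", OF high[OF \<open>good Z0\<close> Z0D]] by blast
    then show thesis using that re_diff[of "q S t" a] by (force simp: cell_def)
  qed
  obtain b where b: "b \<in> J Z0" "b \<bullet> 1 \<le> \<alpha> + \<eta>"
  proof -
    obtain b S t where "b \<in> J Z0" "t \<in> cell S b" "q S t \<bullet> 1 \<le> \<alpha>"
      using centre[of "\<lambda>z. z \<bullet> 1 \<le> \<alpha>", OF low[OF \<open>good Z0\<close> \<open>closedin (top_of_set D) Z0\<close>]] by blast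
    then show thesis using that re_diff[of "q S t" b] by (force simp: cell_def)
  qed
  have step: "\<exists>S. ok S \<and> (\<forall>Z\<in>F. Z \<inter> cell S a \<in> GC \<and> Z \<inter> cell S b \<in> GC)"
    if F: "finite F" "\<And>Z. Z \<in> F \<Longrightarrow> Z \<in> GC \<and> Z \<subseteq> Z0" for F
  proof -
    have "\<forall>\<^sub>F S in U. good (Z \<inter> cell S a) \<and> good (Z \<inter> cell S b)" if "Z \<in> F" for Z
    proof (rule eventually_conj)
      have "a \<in> J Z" "b \<in> J Z" using J_eq F(2)[OF that] a(1) b(1) by auto
      then show "\<forall>\<^sub>F S in U. good (Z \<inter> cell S a)" "\<forall>\<^sub>F S in U. good (Z \<inter> cell S b)" by (auto simp: J_def)
    qed
    then have "\<forall>\<^sub>F S in U. \<forall>Z\<in>F. good (Z \<inter> cell S a) \<and> good (Z \<inter> cell S b)"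
      using F(1) by (simp add: eventually_ball_finite)
    then obtain S where "ok S" "\<forall>Z\<in>F. good (Z \<inter> cell S a) \<and> good (Z \<inter> cell S b)"
      using eventually_happens'[OF U(1) eventually_conj[OF ok]] by blast
    then show ?thesis using F(2) cell_closed by (auto simp: GC_def intro!: exI[of _ S] closedin_Int)
  qed
  \<comment> \<open>The state is a finite family of good closed sets with the latest index. Each
    round cuts all members by one and the same pair of cells, so after \<open>n\<close> rounds every
    pattern of length \<open>n\<close> is realised by a member. The initial index is never read,
    since \<open>\<sigma> n\<close> comes from \<open>x (Suc n)\<close>.\<close>
  obtain x where x: "\<And>n. (finite (fst (x n)) \<and> (\<forall>Z\<in>fst (x n). Z \<in> GC \<and> Z \<subseteq> Z0) \<and> Z0 \<in> fst (x 0)) \<and>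
      (ok (snd (x (Suc n))) \<and> (\<forall>Z\<in>fst (x n). Z \<inter> cell (snd (x (Suc n))) a \<in> fst (x (Suc n)) \<and>
         Z \<inter> cell (snd (x (Suc n))) b \<in> fst (x (Suc n))))"
  proof -
    obtain x where x: "\<And>n. (finite (fst (x n)) \<and> (\<forall>Z\<in>fst (x n). Z \<in> GC \<and> Z \<subseteq> Z0) \<and> (n = 0 \<longrightarrow> Z0 \<in> fst (x n))) \<and>
      (ok (snd (x (Suc n))) \<and> (\<forall>Z\<in>fst (x n). Z \<inter> cell (snd (x (Suc n))) a \<in> fst (x (Suc n)) \<and>
         Z \<inter> cell (snd (x (Suc n))) b \<in> fst (x (Suc n))))"
    proof (atomize_elim, rule dependent_nat_choice, goal_cases)
      case 1
      show ?case using Z0 by (intro exI[of _ "({Z0}, undefined)"]) auto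
    next
      case (2 y n)
      then obtain S where S: "ok S" "\<forall>Z\<in>fst y. Z \<inter> cell S a \<in> GC \<and> Z \<inter> cell S b \<in> GC"
        using step[of "fst y"] by auto
      show ?case
        by (rule exI[of _ "((\<lambda>Z. Z \<inter> cell S a) ` fst y \<union> (\<lambda>Z. Z \<inter> cell S b) ` fst y, S)"])
          (use 2 S in auto)
    qed
    then show thesis by (intro that[of x]) blast
  qed
  define \<sigma> where "\<sigma> n = snd (x (Suc n))" for n
  show thesis
  proof (rule that[of a b \<sigma>])
    show "(a - b) \<bullet> 1 \<ge> \<delta> / 3 - 2 * \<eta>" using a(2) b(2) by (simp add: inner_diff_left \<gamma>_def \<alpha>_def)
    show "ok (\<sigma> n)" for n using x[of n] by (simp add: \<sigma>_def)
    fix e :: "nat \<Rightarrow> bool" and n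
    have "\<exists>Z\<in>fst (x n). \<forall>t\<in>Z. t \<in> D \<and> (\<forall>i<n. norm (q (\<sigma> i) t - (if e i then a else b)) \<le> \<eta>)"
    proof (induction n)
      case 0
      have "Z0 \<in> fst (x 0)" using x[of 0] by (elim conjE)
      then show ?case using Z0D by (intro bexI[of _ Z0]) auto
    next
      case (Suc n)
      then obtain Z where Z: "Z \<in> fst (x n)" "\<forall>t\<in>Z. t \<in> D \<and> (\<forall>i<n. norm (q (\<sigma> i) t - (if e i then a else b)) \<le> \<eta>)"
        by blast
      have "\<forall>Z\<in>fst (x n). Z \<inter> cell (\<sigma> n) a \<in> fst (x (Suc n)) \<and> Z \<inter> cell (\<sigma> n) b \<in> fst (x (Suc n))"
        using x[of n] unfolding \<sigma>_def by (elim conjE)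
      then have "Z \<inter> cell (\<sigma> n) (if e n then a else b) \<in> fst (x (Suc n))" using Z(1) by simp
      then show ?case using Z(2)
        by (rule_tac bexI[of _ "Z \<inter> cell (\<sigma> n) (if e n then a else b)"]) (auto simp: less_Suc_eq cell_def)
    qed
    then obtain Z where Z: "Z \<in> fst (x n)" "\<forall>t\<in>Z. t \<in> D \<and> (\<forall>i<n. norm (q (\<sigma> i) t - (if e i then a else b)) \<le> \<eta>)"
      by blast
    moreover have "\<forall>Z\<in>fst (x n). Z \<in> GC \<and> Z \<subseteq> Z0" using x[of n] by (elim conjE)
    ultimately have "Z \<noteq> {}" using good_ne by (auto simp: GC_def)
    then show "\<exists>t\<in>D. \<forall>i<n. norm (q (\<sigma> i) t - (if e i then a else b)) \<le> \<eta>" using Z(2) by blast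
  qed
qed

section \<open>Copies of \<open>\<ell>\<^sub>1\<close> from independent sequences\<close>

lemma abs_sum_components:
  fixes a :: "nat \<Rightarrow> 'k::euclidean_space"
  obtains b where "b \<in> Basis" "(\<Sum>i<n. norm (a i)) \<le> DIM('k) * (\<Sum>i<n. \<bar>a i \<bullet> b\<bar>)"
proof -
  have "(\<Sum>i<n. norm (a i)) \<le> (\<Sum>i<n. \<Sum>b\<in>Basis. \<bar>a i \<bullet> b\<bar>)"
    by (intro sum_mono norm_le_l1)
  also have "\<dots> = (\<Sum>b\<in>Basis. \<Sum>i<n. \<bar>a i \<bullet> b\<bar>)" by (rule sum.swap)
  finally have le: "(\<Sum>i<n. norm (a i)) \<le> (\<Sum>b\<in>Basis. \<Sum>i<n. \<bar>a i \<bullet> b\<bar>)" .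
  \<comment> \<open>Pigeonhole over the real basis: one real component carries enough of the sum,
    and its signs can be followed by the patterns of an independent sequence.\<close>
  have "\<exists>b\<in>Basis. (\<Sum>i<n. norm (a i)) \<le> DIM('k) * (\<Sum>i<n. \<bar>a i \<bullet> b\<bar>)"
  proof (rule ccontr)
    assume "\<not> ?thesis"
    then have "\<And>b. b \<in> (Basis :: 'k set) \<Longrightarrow> (\<Sum>i<n. \<bar>a i \<bullet> b\<bar>) < (\<Sum>i<n. norm (a i)) / DIM('k)"
      by (auto simp: not_le field_simps)
    then have "(\<Sum>b\<in>(Basis :: 'k set). \<Sum>i<n. \<bar>a i \<bullet> b\<bar>) < (\<Sum>b\<in>(Basis :: 'k set). (\<Sum>i<n. norm (a i)) / DIM('k))"
      by (intro sum_strict_mono) auto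
    then show False using le by simp
  qed
  then show thesis using that by blast
qed

context function_space
begin

text \<open>Rosenthal's argument. Evaluate at a point following the signs of one real component of
  \<open>c\<close> and at a point following the opposite signs: up to small errors the difference is
  \<open>a - b\<close> times the sum of the \<open>c i\<close> with those signs, whose chosen
  component is the sum of the absolute values. Division by \<open>f\<close>, of modulus 1 on
  \<open>D\<close>, does not change norms.\<close>

lemma contains_ell1_if_independent:
  fixes y :: "nat \<Rightarrow> 't \<Rightarrow> 'k"
  assumes D: "D \<subseteq> K" and f: "\<And>t. t \<in> D \<Longrightarrow> norm (f t) = 1"
    and y: "\<And>n. y n \<in> Y" "\<And>n. nrm (y n) \<le> 1"
    and indep: "\<And>e n. \<exists>t\<in>D. \<forall>i<n. norm (y i t / f t - (if e i then a else b)) \<le> \<eta>"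
    and gap: "2 * \<eta> * DIM('k) < norm (a - b)" 
  shows "contains_ell1 Y nrm"
proof -
  define T where "T c = (\<lambda>t. \<Sum>n. c n * y n t)" for c :: "nat \<Rightarrow> 'k"
  have ell1D: "summable (\<lambda>n. norm (c n))" if "c \<in> ell1" for c :: "nat \<Rightarrow> 'k" using that by (simp add: ell1_def)
  have term_le: "norm (c n * y n t) \<le> norm (c n)" if "t \<in> K" for c n t
    using mult_left_mono[OF order_trans[OF norm_le_nrm[OF y(1) that] y(2)], of "norm (c n)"]
    by (simp add: norm_mult)
  have sm: "summable (\<lambda>n. norm (c n * y n t))" if c: "c \<in> ell1" for c t
  proof (cases "t \<in> K")
    case True
    show ?thesis by (rule summable_comparison_test'[OF ell1D[OF c], of 0]) (use term_le[OF True] in auto)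
  next
    case False
    then show ?thesis using vanish[OF y(1)] by simp
  qed
  have tail: "norm (T c t - (\<Sum>i<n. c i * y i t)) \<le> (\<Sum>i. norm (c (i + n)))" if c: "c \<in> ell1" and t: "t \<in> K" for c n t
  proof -
    have s: "summable (\<lambda>i. c i * y i t)" using summable_norm_cancel[OF sm[OF c]] .
    have "T c t - (\<Sum>i<n. c i * y i t) = (\<Sum>i. c (i + n) * y (i + n) t)"
      unfolding T_def using suminf_minus_initial_segment[OF s, of n] by simp
    also have "norm \<dots> \<le> (\<Sum>i. norm (c (i + n)))"
      by (rule norm_suminf_le) (use term_le[OF t] summable_ignore_initial_segment[OF ell1D[OF c]] in auto)
    finally show ?thesis .
  qed
  have tail0: "(\<lambda>n. \<Sum>i. norm (c (i + n))) \<longlonglongrightarrow> 0" if c: "c \<in> ell1" for c :: "nat \<Rightarrow> 'k"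
    using suminf_exist_split2[OF ell1D[OF c]] by simp
  have TY: "T c \<in> Y" if c: "c \<in> ell1" for c
  proof (rule complete)
    show "(\<lambda>t. \<Sum>i<n. c i * y i t) \<in> Y" for n by (rule sum) (rule scale[OF y(1)])
    show "T c t = 0" if "t \<notin> K" for t using vanish[OF y(1) that] by (simp add: T_def)
    show "uniform_limit K (\<lambda>n t. \<Sum>i<n. c i * y i t) (T c) sequentially"
    proof (rule uniform_limitI)
      fix r :: real assume "r > 0"
      then have "\<forall>\<^sub>F n in sequentially. (\<Sum>i. norm (c (i + n))) < r" using order_tendstoD(2)[OF tail0[OF c]] by blast
      then show "\<forall>\<^sub>F n in sequentially. \<forall>t\<in>K. dist (\<Sum>i<n. c i * y i t) (T c t) < r"
      proof eventually_elim
        case (elim n)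
        have "dist (\<Sum>i<n. c i * y i t) (T c t) < r" if "t \<in> K" for t
          using tail[OF c that, of n] elim by (simp add: dist_norm norm_minus_commute)
        then show ?case by blast
      qed
    qed
  qed
  \<comment> \<open>Half of what remains of \<open>norm (a - b) / DIM('k)\<close> after the error
    \<open>\<eta>\<close> of each of the two evaluations; the other half is lost because the
    difference of two values is at most twice the norm.\<close>
  define \<kappa> where "\<kappa> = (norm (a - b) / DIM('k) - 2 * \<eta>) / 2"
  have DIM: "DIM('k) > 0" by simp
  have \<kappa>: "\<kappa> > 0" using gap DIM by (simp add: \<kappa>_def field_simps)
  have fin: "2 * \<kappa> * (\<Sum>i<n. norm (c i)) \<le> 2 * nrm (T c) + 2 * (\<Sum>i. norm (c (i + n)))"
    if c: "c \<in> ell1" for c n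
  proof -
    obtain v where v: "v \<in> Basis" "(\<Sum>i<n. norm (c i)) \<le> DIM('k) * (\<Sum>i<n. \<bar>c i \<bullet> v\<bar>)"
      by (rule abs_sum_components)
    define e where "e i \<longleftrightarrow> c i \<bullet> v \<ge> 0" for i
    define \<epsilon> :: "nat \<Rightarrow> 'k" where "\<epsilon> i = (if e i then 1 else - 1)" for i
    obtain t where t: "t \<in> D" "\<forall>i<n. norm (y i t / f t - (if e i then a else b)) \<le> \<eta>"
      using indep[where e=e] by blast
    obtain t' where t': "t' \<in> D" "\<forall>i<n. norm (y i t' / f t' - (if \<not> e i then a else b)) \<le> \<eta>"
      using indep[where e="\<lambda>i. \<not> e i"] by blast
    have part: "norm (\<Sum>i<n. c i * (y i t / f t)) \<le> nrm (T c) + (\<Sum>i. norm (c (i + n)))" if "t \<in> D" for t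
    proof -
      have "(\<Sum>i<n. c i * (y i t / f t)) = (\<Sum>i<n. c i * y i t) / f t" by (simp add: sum_divide_distrib)
      then have "norm (\<Sum>i<n. c i * (y i t / f t)) = norm (\<Sum>i<n. c i * y i t)" using f[OF that] by (simp add: norm_divide)
      also have "\<dots> \<le> norm (T c t) + norm (T c t - (\<Sum>i<n. c i * y i t))"
        by (metis add_diff_cancel_left' diff_add_cancel norm_minus_commute norm_triangle_sub)
      also have "\<dots> \<le> nrm (T c) + (\<Sum>i. norm (c (i + n)))"
        using that D by (intro add_mono norm_le_nrm TY c tail) auto
      finally show ?thesis .
    qed
    let ?U = "\<Sum>i<n. c i * (y i t / f t)" and ?V = "\<Sum>i<n. c i * (y i t' / f t')"
    let ?A = "(a - b) * (\<Sum>i<n. \<epsilon> i * c i)" and ?E = "\<Sum>i<n. c i * (y i t / f t - y i t' / f t' - \<epsilon> i * (a - b))"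
    have "norm (?U - ?V) \<le> 2 * nrm (T c) + 2 * (\<Sum>i. norm (c (i + n)))"
      using norm_triangle_ineq4[of ?U ?V]
        part[OF t(1)] part[OF t'(1)] by simp
    moreover have "?U - ?V = ?A + ?E"
      by (simp add: sum_distrib_left sum.distrib[symmetric] sum_subtractf[symmetric] algebra_simps)
    moreover have "norm ?E \<le> 2 * \<eta> * (\<Sum>i<n. norm (c i))"
    proof -
      have "norm (c i * (y i t / f t - y i t' / f t' - \<epsilon> i * (a - b))) \<le> 2 * \<eta> * norm (c i)" if "i < n" for i
      proof -
        have "y i t / f t - y i t' / f t' - \<epsilon> i * (a - b) =
            (y i t / f t - (if e i then a else b)) - (y i t' / f t' - (if \<not> e i then a else b))"
          by (simp add: \<epsilon>_def)
        then have "norm (y i t / f t - y i t' / f t' - \<epsilon> i * (a - b)) \<le>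
            norm (y i t / f t - (if e i then a else b)) + norm (y i t' / f t' - (if \<not> e i then a else b))"
          by (simp only: norm_triangle_ineq4)
        also have "\<dots> \<le> \<eta> + \<eta>" using t(2) t'(2) that by (intro add_mono) blast+
        finally have "norm (y i t / f t - y i t' / f t' - \<epsilon> i * (a - b)) \<le> \<eta> + \<eta>" .
        from mult_left_mono[OF this norm_ge_zero[of "c i"]] show ?thesis
          by (simp only: norm_mult) (simp only: algebra_simps)
      qed
      then show ?thesis unfolding sum_distrib_left by (intro order_trans[OF norm_sum sum_mono]) auto
    qed
    moreover have "norm ?A \<ge> norm (a - b) / DIM('k) * (\<Sum>i<n. norm (c i))"
    proof -
      have "(\<Sum>i<n. \<bar>c i \<bullet> v\<bar>) = (\<Sum>i<n. \<epsilon> i * c i) \<bullet> v"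
        by (auto simp: inner_sum_left \<epsilon>_def e_def intro!: sum.cong)
      also have "\<dots> \<le> norm (\<Sum>i<n. \<epsilon> i * c i)" using norm_cauchy_schwarz[of "\<Sum>i<n. \<epsilon> i * c i" v] v(1) by simp
      finally have "(\<Sum>i<n. norm (c i)) \<le> DIM('k) * norm (\<Sum>i<n. \<epsilon> i * c i)"
        using v(2) by (rule_tac order_trans[OF v(2) mult_left_mono]) auto
      then have "(\<Sum>i<n. norm (c i)) / DIM('k) \<le> norm (\<Sum>i<n. \<epsilon> i * c i)"
        using DIM by (simp add: pos_divide_le_eq mult.commute)
      from mult_left_mono[OF this norm_ge_zero[of "a - b"]] show ?thesis by (simp add: norm_mult)
    qed
    moreover have "norm ?A \<le> norm (?A + ?E) + norm ?E"
      using norm_triangle_ineq4[of "?A + ?E" ?E]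
      by (simp only: add_diff_cancel_right')
    ultimately have "norm (a - b) / DIM('k) * (\<Sum>i<n. norm (c i)) - 2 * \<eta> * (\<Sum>i<n. norm (c i))
        \<le> 2 * nrm (T c) + 2 * (\<Sum>i. norm (c (i + n)))" by simp
    then show ?thesis by (simp add: \<kappa>_def left_diff_distrib)
  qed
  have lower: "\<kappa> * (\<Sum>n. norm (c n)) \<le> nrm (T c)" if c: "c \<in> ell1" for c
  proof -
    have "2 * \<kappa> * (\<Sum>n. norm (c n)) \<le> 2 * nrm (T c) + 2 * 0"
    proof (rule LIMSEQ_le)
      show "(\<lambda>n. 2 * \<kappa> * (\<Sum>i<n. norm (c i))) \<longlonglongrightarrow> 2 * \<kappa> * (\<Sum>n. norm (c n))"
        by (intro tendsto_intros summable_LIMSEQ ell1D c)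
      show "(\<lambda>n. 2 * nrm (T c) + 2 * (\<Sum>i. norm (c (i + n)))) \<longlonglongrightarrow> 2 * nrm (T c) + 2 * 0"
        by (intro tendsto_intros tail0 c)
    qed (use fin[OF c] in blast)
    then show ?thesis by simp
  qed
  have upper: "nrm (T c) \<le> 1 * (\<Sum>n. norm (c n))" if c: "c \<in> ell1" for c
  proof (rule nrm_le)
    fix t assume "t \<in> K"
    then show "norm (T c t) \<le> 1 * (\<Sum>n. norm (c n))" using tail[OF c, of t 0] by simp
  qed
  show ?thesis
    unfolding contains_ell1_def
  proof (intro exI[of _ T] conjI ballI allI)
    fix c d :: "nat \<Rightarrow> 'k" and z assume cd: "c \<in> ell1" "d \<in> ell1"
    show "T (\<lambda>n. z * c n + d n) = (\<lambda>t. z * T c t + T d t)"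
    proof
      fix t
      have s: "summable (\<lambda>n. c n * y n t)" "summable (\<lambda>n. d n * y n t)"
        using cd by (auto intro: summable_norm_cancel sm)
      have "(\<Sum>n. (z * c n + d n) * y n t) = (\<Sum>n. z * (c n * y n t) + d n * y n t)"
        by (simp add: algebra_simps)
      also have "\<dots> = z * (\<Sum>n. c n * y n t) + (\<Sum>n. d n * y n t)"
        using s by (simp add: suminf_add[symmetric] suminf_mult summable_mult)
      finally show "T (\<lambda>n. z * c n + d n) t = z * T c t + T d t" by (simp add: T_def)
    qed
  next
    show "\<exists>c>0. \<exists>C. \<forall>a\<in>ell1. c * (\<Sum>n. norm (a n)) \<le> nrm (T a) \<and> nrm (T a) \<le> C * (\<Sum>n. norm (a n))"
      using \<kappa> lower upper by blast
  qed (rule TY)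
qed

text \<open>A form of Haydon's theorem: for finite \<open>S\<close>, separation of the mean from the convex combinations
  of the points of \<open>S\<close> yields one function \<open>y S\<close>, and these are the input for the independent cells.\<close>

lemma mean_norm_approx_weights:
  assumes no_ell1: "\<not> contains_ell1 Y nrm"
    and f: "f \<in> Y" and D: "D = {t \<in> K. norm (f t) = 1}" "D \<noteq> {}" and m: "mean D m" and \<delta>: "\<delta> > 0"
  obtains S a where "weights D S a"
    "\<And>g. g \<in> Y \<Longrightarrow> m (\<lambda>t. f t \<bullet> g t) - (\<Sum>t\<in>S. a t * (f t \<bullet> g t)) \<le> \<delta> * nrm g"
proof (rule ccontr)
  note result = that
  assume no: "\<not> thesis"
  define h where "h g = (\<lambda>t. f t \<bullet> g t)" for g
  have DK: "D \<subseteq> K" and f1: "\<And>t. t \<in> D \<Longrightarrow> norm (f t) = 1" using D by auto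
  have h_le: "\<bar>h g t\<bar> \<le> nrm g" if "g \<in> Y" "t \<in> D" for g t
    using Cauchy_Schwarz_ineq2[of "f t" "g t"] norm_le_nrm[of g t] that f1 DK by (auto simp: h_def)
  have h_bdd: "h g \<in> bounded_on D" if "g \<in> Y" for g using h_le[OF that] by (rule bounded_onI)
  have h_add: "h (\<lambda>t. f t + g t) = (\<lambda>t. h f t + h g t)" for f g by (simp add: h_def inner_add_right)
  have h_scale: "h (\<lambda>t. r *\<^sub>R g t) = (\<lambda>t. r * h g t)" for r g by (simp add: h_def)
  \<comment> \<open>If no function separates \<open>m\<close> from all points of \<open>S\<close> at
    once, the minimax theorem gives a mean on \<open>S\<close>, hence weights on \<open>S\<close>
    satisfying the conclusion; these are excluded by \<open>no\<close>.\<close>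
  have sep: "\<exists>g\<in>Y. nrm g \<le> 1 \<and> (\<forall>t\<in>S. m (h g) - h g t \<ge> \<delta>)" if S: "finite S" "S \<noteq> {}" "S \<subseteq> D" for S
  proof (rule ccontr)
    assume *: "\<not> ?thesis"
    define W where "W = {(\<lambda>t. m (h g) - h g t, c) | g c. g \<in> Y \<and> c \<ge> \<delta> * nrm g}"
    have WI: "(w, c) \<in> W" if "g \<in> Y" "w = (\<lambda>t. m (h g) - h g t)" "c \<ge> \<delta> * nrm g" for w c g
      using that unfolding W_def by blast
    have WE: "\<exists>g. g \<in> Y \<and> w = (\<lambda>t. m (h g) - h g t) \<and> c \<ge> \<delta> * nrm g" if "(w, c) \<in> W" for w c
      using that unfolding W_def by blast
    obtain M where M: "mean S M" "\<And>w c. (w, c) \<in> W \<Longrightarrow> M w \<le> c"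
    proof (rule exists_mean[of W S])
      show "real_cone W"
        unfolding real_cone_def
      proof (intro conjI allI impI)
        have "h (\<lambda>_. 0) = (\<lambda>_. 0)" by (simp add: h_def)
        then show "(0, 0) \<in> W"
          by (intro WI[OF zero]) (auto simp: zero_fun_def nrm_zero mean_const[OF m])
        fix v c assume "(v, c) \<in> W"
        then obtain g where g: "g \<in> Y" "v = (\<lambda>t. m (h g) - h g t)" "c \<ge> \<delta> * nrm g" using WE by blast
        show "(v + w, c + d) \<in> W" if wd: "(w, d) \<in> W" for w d
        proof -
          obtain g' where g': "g' \<in> Y" "w = (\<lambda>t. m (h g') - h g' t)" "d \<ge> \<delta> * nrm g'" using WE[OF wd] by blast
          have "\<delta> * nrm (\<lambda>t. g t + g' t) \<le> \<delta> * (nrm g + nrm g')"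
            using \<delta> by (intro mult_left_mono nrm_add_le g g') auto
          then have "c + d \<ge> \<delta> * nrm (\<lambda>t. g t + g' t)" using g(3) g'(3) by (simp add: distrib_left)
          then show ?thesis
            unfolding g(2) g'(2)
            by (intro WI[OF add[OF g(1) g'(1)]])
              (simp_all add: mean_add[OF m h_bdd[OF g(1)] h_bdd[OF g'(1)]] h_add fun_eq_iff)
        qed
        show "(r *\<^sub>R v, r * c) \<in> W" if "r > 0" for r :: real
        proof (rule WI[OF scaleR[OF g(1), of r]])
          have "\<delta> * nrm (\<lambda>t. r *\<^sub>R g t) \<le> \<delta> * (r * nrm g)"
            using nrm_scaleR_le[OF g(1), of r] that \<delta> by (intro mult_left_mono) auto
          also have "\<dots> = r * (\<delta> * nrm g)" by simp
          also have "\<dots> \<le> r * c" using g(3) that by (intro mult_left_mono) auto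
          finally show "\<delta> * nrm (\<lambda>t. r *\<^sub>R g t) \<le> r * c" .
        qed (simp add: g(2) mean_scale[OF m h_bdd[OF g(1)], of r] h_scale fun_eq_iff right_diff_distrib)
      qed
      show "w \<in> bounded_on S" if wc: "(w, c) \<in> W" for w c
      proof -
        obtain g where g: "g \<in> Y" "w = (\<lambda>t. m (h g) - h g t)" using WE[OF wc] by blast
        show ?thesis
        proof (rule bounded_onI[of _ _ "\<bar>m (h g)\<bar> + nrm g"])
          fix t assume "t \<in> S"
          then have "\<bar>h g t\<bar> \<le> nrm g" using h_le[OF g(1)] S(3) by blast
          then show "\<bar>w t\<bar> \<le> \<bar>m (h g)\<bar> + nrm g" using g(2) by simp
        qed
      qed
      show "\<exists>t\<in>S. w t < c + e" if wc: "(w, c) \<in> W" and e: "e > 0" for w c e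
      proof (rule ccontr)
        assume **: "\<not> ?thesis"
        obtain g where g: "g \<in> Y" "w = (\<lambda>t. m (h g) - h g t)" "c \<ge> \<delta> * nrm g" using WE[OF wc] by blast
        have big: "m (h g) - h g t \<ge> \<delta> * nrm g + e" if "t \<in> S" for t using ** g that by force
        obtain t where t: "t \<in> S" using S(2) by blast
        have "nrm g > 0"
        proof (rule ccontr)
          assume "\<not> nrm g > 0"
          then have z: "nrm g = 0" using nrm_nonneg[OF g(1)] by simp
          have "\<bar>m (h g)\<bar> \<le> 0" by (rule mean_abs_le[OF m]) (use h_le[OF g(1)] z in auto)
          moreover have "\<bar>h g t\<bar> \<le> 0" using h_le[OF g(1), of t] z t S(3) by auto
          ultimately show False using big[OF t] z e by simp
        qed
        define r where "r = inverse (nrm g)"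
        have r: "r > 0" "r * nrm g = 1" using \<open>nrm g > 0\<close> by (auto simp: r_def)
        have "nrm (\<lambda>t. r *\<^sub>R g t) \<le> 1" using nrm_scaleR_le[OF g(1), of r] r by simp
        moreover have "m (h (\<lambda>t. r *\<^sub>R g t)) - h (\<lambda>t. r *\<^sub>R g t) t \<ge> \<delta>" if "t \<in> S" for t
        proof -
          have "r * (m (h g) - h g t) \<ge> r * (\<delta> * nrm g + e)" using big[OF that] r by (intro mult_left_mono) auto
          moreover have "r * (\<delta> * nrm g + e) = \<delta> * (r * nrm g) + r * e" by (simp add: algebra_simps)
          moreover have "r * e > 0" using r e by simp
          ultimately show ?thesis
            using r mean_scale[OF m h_bdd[OF g(1)], of r] by (simp add: h_scale right_diff_distrib)
        qed
        ultimately show False using * scaleR[OF g(1), of r] by blast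
      qed
    qed blast
    obtain a where a: "weights S S a" "\<And>u. M u = (\<Sum>t\<in>S. a t * u t)" using mean_finite[OF M(1) S(1)] by blast
    have "weights D S a" using a(1) S(3) by (auto simp: weights_def)
    moreover have "m (\<lambda>t. f t \<bullet> g t) - (\<Sum>t\<in>S. a t * (f t \<bullet> g t)) \<le> \<delta> * nrm g" if g: "g \<in> Y" for g
    proof -
      have "M (\<lambda>t. m (h g) - h g t) \<le> \<delta> * nrm g" by (rule M(2)[OF WI[OF g]]) auto
      moreover have "M (\<lambda>t. m (h g) - h g t) = m (h g) - (\<Sum>t\<in>S. a t * h g t)"
        using a by (simp add: weights_def right_diff_distrib sum_subtractf sum_distrib_right[symmetric])
      ultimately show ?thesis by (simp add: h_def)
    qed
    ultimately show False using no result by blast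
  qed
  then have "\<forall>S. \<exists>g. finite S \<longrightarrow> S \<noteq> {} \<longrightarrow> S \<subseteq> D \<longrightarrow> g \<in> Y \<and> nrm g \<le> 1 \<and> (\<forall>t\<in>S. m (h g) - h g t \<ge> \<delta>)"
    by blast
  from choice[OF this] obtain y where "\<forall>S. finite S \<longrightarrow> S \<noteq> {} \<longrightarrow> S \<subseteq> D \<longrightarrow>
      y S \<in> Y \<and> nrm (y S) \<le> 1 \<and> (\<forall>t\<in>S. m (h (y S)) - h (y S) t \<ge> \<delta>)" ..
  then have y: "\<And>S. finite S \<Longrightarrow> S \<noteq> {} \<Longrightarrow> S \<subseteq> D \<Longrightarrow>
      y S \<in> Y \<and> nrm (y S) \<le> 1 \<and> (\<forall>t\<in>S. m (h (y S)) - h (y S) t \<ge> \<delta>)" by blast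
  define ok where "ok S \<longleftrightarrow> finite S \<and> S \<noteq> {} \<and> S \<subseteq> D" for S
  have yY: "y S \<in> Y" "nrm (y S) \<le> 1" if "ok S" for S using y that by (auto simp: ok_def)
  \<comment> \<open>On the peak set \<open>f \<bullet> g\<close> is the real part of
    \<open>g / f\<close>, so division by \<open>f\<close> brings the separating functions into the
    form required by \<open>independent_cells\<close>.\<close>
  define q where "q S t = y S t / f t" for S t
  have re_q: "q S t \<bullet> 1 = h (y S) t" if "t \<in> D" for S t
  proof -
    have "f t \<noteq> 0" using f1[OF that] by force
    then show ?thesis using unimodular_inner[OF f1[OF that], of "q S t" 1] by (simp add: q_def h_def inner_commute)
  qed
  \<comment> \<open>Refining the filter of finite subsets of \<open>D\<close> puts every point of
    \<open>D\<close> into almost all \<open>S\<close>, so the separation on each finite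
    \<open>S\<close> becomes \<open>gap\<close> at each point of \<open>D\<close>.\<close>
  obtain U where U: "U \<le> finite_subsets_at_top D" "U \<noteq> bot" "\<And>P. eventually P U \<or> eventually (\<lambda>x. \<not> P x) U"
    using exists_ultrafilter[OF finite_subsets_at_top_neq_bot] by blast
  have ev: "\<forall>\<^sub>F S in U. ok S \<and> t \<in> S" if "t \<in> D" for t
  proof (rule filter_leD[OF U(1)])
    show "\<forall>\<^sub>F S in finite_subsets_at_top D. ok S \<and> t \<in> S"
      unfolding eventually_finite_subsets_at_top ok_def by (rule exI[of _ "{t}"]) (use that in auto)
  qed
  have m_q: "m (\<lambda>x. q S x \<bullet> 1) = m (h (y S))" if "ok S" for S
    by (rule mean_cong[OF m, symmetric]) (use h_bdd yY(1)[OF that] re_q in auto)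
  \<comment> \<open>Then \<open>2 * \<eta> * DIM('k)\<close> is \<open>\<delta> / 12\<close>,
    whereas the centres differ by at least
    \<open>\<delta> / 3 - 2 * \<eta> \<ge> \<delta> / 4\<close>.\<close>
  define \<eta> where "\<eta> = \<delta> / (24 * DIM('k))"
  have DIM: "DIM('k) \<ge> 1" using DIM_positive[where 'a='k] by linarith
  have \<eta>: "\<eta> > 0" using \<delta> DIM by (simp add: \<eta>_def)
  have "continuous_on K (\<lambda>t. norm (f t))" by (intro continuous_on_norm continuous f)
  then have "closedin (top_of_set K) (K \<inter> (\<lambda>t. norm (f t)) -` {1})"
    by (intro continuous_closedin_preimage) auto
  moreover have "K \<inter> (\<lambda>t. norm (f t)) -` {1} = D" by (auto simp: D)
  ultimately have compact_D: "compact D" using closedin_compact[OF compact] by simp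
  obtain t where "t \<in> D" using D(2) by blast
  from ev[OF this] have ok: "\<forall>\<^sub>F S in U. ok S" by eventually_elim blast
  have cont: "continuous_on D (q S)" if "ok S" for S
    unfolding q_def using f1
    by (intro continuous_on_divide continuous_on_subset[OF continuous DK] yY that f) force
  have bound: "norm (q S t) \<le> 1" if "ok S" "t \<in> D" for S t
    using norm_le_nrm[OF yY(1)[OF that(1)], of t] yY(2)[OF that(1)] that(2) f1 DK by (auto simp: q_def norm_divide)
  have gap: "\<forall>\<^sub>F S in U. \<delta> \<le> m (\<lambda>x. q S x \<bullet> 1) - q S t \<bullet> 1" if t: "t \<in> D" for t
    using ev[OF t] by eventually_elim (use y re_q[OF t] m_q in \<open>auto simp: ok_def\<close>)
  obtain a b and \<sigma> :: "nat \<Rightarrow> 't set" where ab: "(a - b) \<bullet> 1 \<ge> \<delta> / 3 - 2 * \<eta>" and \<sigma>: "\<And>n. ok (\<sigma> n)"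
    and ind: "\<And>e n. \<exists>t\<in>D. \<forall>i<n. norm (q (\<sigma> i) t - (if e i then a else b)) \<le> \<eta>"
    by (rule independent_cells[OF U(2,3) compact_D m ok cont bound gap \<delta> \<eta>])
      (assumption | blast)+
  have "contains_ell1 Y nrm"
  proof (rule contains_ell1_if_independent[OF DK f1])
    show "y (\<sigma> n) \<in> Y" "nrm (y (\<sigma> n)) \<le> 1" for n using yY \<sigma> by auto
    show "\<exists>t\<in>D. \<forall>i<n. norm (y (\<sigma> i) t / f t - (if e i then a else b)) \<le> \<eta>" for e n
      using ind by (simp add: q_def)
    have "2 * \<eta> * DIM('k) = \<delta> / 12" using DIM by (simp add: \<eta>_def)
    moreover have "\<eta> * 1 \<le> \<eta> * DIM('k)" using \<eta> DIM by (intro mult_left_mono) auto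
    moreover have "(a - b) \<bullet> 1 \<le> norm (a - b)" using norm_cauchy_schwarz[of "a - b" 1] by simp
    ultimately show "2 * \<eta> * DIM('k) < norm (a - b)" using ab \<delta> by linarith
  qed
  then show False using no_ell1 by blast
qed

end

section \<open>Approximation of functionals by finite sums\<close>

context function_space
begin

text \<open>The function \<open>f\<close> is a dual certificate: its norm is at most 1, and the
  point sum takes at \<open>f\<close> the sum of the moduli of its coefficients as value. The empty
  sum is allowed; it serves functionals whose Ekeland point has an empty peak set.\<close>

definition peak_sum :: "('t \<Rightarrow> 'k) \<Rightarrow> 't set \<Rightarrow> ('t \<Rightarrow> 'k) \<Rightarrow> bool" where
  "peak_sum f S c \<longleftrightarrow> f \<in> Y \<and> nrm f \<le> 1 \<and> finite S \<and> S \<subseteq> K \<and>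
     (\<forall>t\<in>S. norm (f t) = 1 \<and> c t * f t = of_real (norm (c t)))"

text \<open>Dividing the weights \<open>r * a t\<close> by the unimodular \<open>f t\<close> gives
  them the phase that \<open>peak_sum\<close> demands without changing their moduli.\<close>

lemma peak_sum_of_weights:
  assumes f: "f \<in> Y" "nrm f \<le> 1" and S: "weights {t \<in> K. norm (f t) = 1} S a" and r: "r \<ge> 0"
  obtains c where "peak_sum f S c" "(\<Sum>t\<in>S. norm (c t)) = r"
    "\<forall>g. (\<Sum>t\<in>S. c t * g t) \<bullet> 1 = r * (\<Sum>t\<in>S. a t * (f t \<bullet> g t))"
proof
  let ?c = "\<lambda>t. of_real (r * a t) / f t"
  have S': "finite S" "S \<subseteq> K" "sum a S = 1" and f1: "\<And>t. t \<in> S \<Longrightarrow> norm (f t) = 1"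
    and a: "\<And>t. t \<in> S \<Longrightarrow> a t \<ge> 0"
    using S by (auto simp: weights_def)
  have f0: "f t \<noteq> 0" if "t \<in> S" for t using f1[OF that] by force
  have nc: "norm (?c t) = r * a t" if "t \<in> S" for t
    using f1[OF that] a[OF that] r by (simp add: norm_divide norm_mult)
  show "peak_sum f S ?c"
    unfolding peak_sum_def using f S' f1 nc f0 by auto
  show "(\<Sum>t\<in>S. norm (?c t)) = r" using nc S'(3) by (simp add: sum_distrib_left[symmetric])
  have "(?c t * g t) \<bullet> 1 = r * (a t * (f t \<bullet> g t))" if t: "t \<in> S" for t and g :: "'t \<Rightarrow> 'k"
  proof -
    have "f t \<bullet> g t = (f t * 1) \<bullet> (f t * (g t / f t))" using f0[OF t] by simp
    also have "\<dots> = (g t / f t) \<bullet> 1" using unimodular_inner[OF f1[OF t]] by (simp only: inner_commute)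
    finally have "(g t / f t) \<bullet> 1 = f t \<bullet> g t" by simp
    moreover have "?c t * g t = (r * a t) *\<^sub>R (g t / f t)" by (simp add: scaleR_conv_of_real)
    ultimately show ?thesis by simp
  qed
  then show "\<forall>g. (\<Sum>t\<in>S. ?c t * g t) \<bullet> 1 = r * (\<Sum>t\<in>S. a t * (f t \<bullet> g t))"
    by (simp add: inner_sum_left sum_distrib_left)
qed

text \<open>Basis elements have modulus 1, so real components are real parts of rotated numbers.
  Control of real parts on rotated arguments thus controls moduli.\<close>

lemma norm_le_sum_rotated:
  fixes z :: "'k"
  shows "norm z \<le> (\<Sum>b\<in>Basis. \<bar>(inverse b * z) \<bullet> 1\<bar>)"
proof -
  have "z \<bullet> b = (inverse b * z) \<bullet> 1" if b: "b \<in> Basis" for b :: 'k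
  proof -
    have "norm (inverse b) = 1" "b \<noteq> 0" using b by (auto simp: norm_inverse)
    then show ?thesis using unimodular_inner[of "inverse b" z b] by simp
  qed
  then show ?thesis using norm_le_l1[of z] by simp
qed

lemma peak_set_bounded_on:
  assumes "g \<in> Y"
  shows "(\<lambda>t. f t \<bullet> g t) \<in> bounded_on {t \<in> K. norm (f t) = 1}"
proof (rule bounded_onI[of _ _ "nrm g"])
  fix t assume "t \<in> {t \<in> K. norm (f t) = 1}"
  then show "\<bar>f t \<bullet> g t\<bar> \<le> nrm g"
    using Cauchy_Schwarz_ineq2[of "f t" "g t"] norm_le_nrm[OF assms, of t] by simp
qed

text \<open>The real part of \<open>L\<close> has to be approximated at the rotations \<open>b\<^sup>-\<^sup>1 g\<close> for \<open>b\<close> in the real basis of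
  the scalars in order to control \<open>L g\<close> itself.\<close>

lemma functional_weak_approx:
  assumes L: "functional L" and C: "C \<ge> 0" "\<And>g. g \<in> Y \<Longrightarrow> norm (L g) \<le> C * nrm g"
    and G: "finite G" "G \<subseteq> Y" and \<delta>: "\<delta> > 0"
  obtains f S c where "peak_sum f S c" "\<And>g. g \<in> G \<Longrightarrow> norm (L g - (\<Sum>t\<in>S. c t * g t)) < \<delta>"
proof -
  \<comment> \<open>Real parts are controlled up to \<open>2 * d\<close>, one \<open>d\<close> from
    Ekeland and one from sampling the mean; summed over the basis this gives
    \<open>\<delta> / 2\<close>.\<close>
  define d where "d = \<delta> / (4 * DIM('k))"
  have DIM: "DIM('k) > 0" by simp
  have d: "d > 0" using \<delta> DIM by (simp add: d_def)
  define M where "M = (\<Sum>g\<in>G. nrm g) + 1"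
  have nn: "nrm g \<ge> 0" if "g \<in> G" for g using nrm_nonneg G(2) that by blast
  have M: "M > 0" "\<And>g. g \<in> G \<Longrightarrow> nrm g \<le> M"
  proof -
    show "M > 0" using sum_nonneg[of G nrm] nn by (simp add: M_def add_nonneg_pos)
    show "nrm g \<le> M" if "g \<in> G" for g using member_le_sum[OF that, of nrm] nn G(1) by (simp add: M_def)
  qed
  have "d / M > 0" using d M by simp
  obtain f where f: "f \<in> Y" "nrm f \<le> 1"
    "{t \<in> K. norm (f t) = 1} = {} \<longrightarrow> (\<forall>g\<in>Y. L g \<bullet> 1 \<le> d / M * nrm g)"
    "{t \<in> K. norm (f t) = 1} \<noteq> {} \<longrightarrow>
      (\<exists>m r. mean {t \<in> K. norm (f t) = 1} m \<and> 0 \<le> r \<and> r \<le> C \<and>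
        (\<forall>g\<in>Y. L g \<bullet> 1 \<le> r * m (\<lambda>t. f t \<bullet> g t) + d / M * nrm g))"
    by (rule peak_mean[OF L C(2) \<open>d / M > 0\<close>])
  define D where "D = {t \<in> K. norm (f t) = 1}"
  \<comment> \<open>The negatives of the basis elements turn one-sided bounds into bounds for
    absolute values.\<close>
  define H where "H = (\<lambda>(b, g) t. inverse b * g t) ` ((Basis \<union> uminus ` Basis) \<times> G)"
  have "finite H" unfolding H_def using G by (intro finite_imageI finite_cartesian_product) auto
  moreover have "H \<subseteq> Y"
  proof
    fix h assume "h \<in> H"
    then obtain b g where bg: "g \<in> G" "h = (\<lambda>t. inverse b * g t)" by (auto simp: H_def)
    then show "h \<in> Y" using scale[of g "inverse b"] G(2) by auto
  qed
  ultimately have H: "finite H" "H \<subseteq> Y" .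
  have nH: "nrm h \<le> M" if h: "h \<in> H" for h
  proof -
    obtain p where p: "p \<in> (Basis \<union> uminus ` Basis) \<times> G" "h = (\<lambda>(b, g) t. inverse b * g t) p"
      using h unfolding H_def by (rule imageE)
    obtain b g where "p = (b, g)" by (cases p)
    then have bg: "b \<in> Basis \<union> uminus ` Basis" "g \<in> G" "h = (\<lambda>t. inverse b * g t)"
      using p by simp_all
    then have "norm (inverse b) = 1" by (auto simp: norm_inverse)
    moreover have "g \<in> Y" using bg(2) G by blast
    ultimately have "nrm h \<le> nrm g" using nrm_scale_le[of g "inverse b"] bg(3) by simp
    then show ?thesis using M(2)[OF bg(2)] by simp
  qed
  have "\<exists>S c. peak_sum f S c \<and> (\<forall>h\<in>H. (L h - (\<Sum>t\<in>S. c t * h t)) \<bullet> 1 \<le> 2 * d)"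
  proof (cases "D = {}")
    case True
    have "L h \<bullet> 1 \<le> 2 * d" if "h \<in> H" for h
    proof -
      have "L h \<bullet> 1 \<le> d / M * nrm h" using f(3) True H(2) that by (auto simp: D_def)
      also have "\<dots> \<le> d / M * M" using nH[OF that] \<open>d / M > 0\<close> by (intro mult_left_mono) auto
      finally show ?thesis using M(1) d by simp
    qed
    then show ?thesis using f by (intro exI[of _ "{}"]) (auto simp: peak_sum_def)
  next
    case False
    then obtain m r where m: "mean D m" "0 \<le> r" "r \<le> C"
      "\<And>g. g \<in> Y \<Longrightarrow> L g \<bullet> 1 \<le> r * m (\<lambda>t. f t \<bullet> g t) + d / M * nrm g"
      using f(4) unfolding D_def by blast
    have C1: "d / (C + 1) > 0" using d C by simp
    have "(\<lambda>h t. f t \<bullet> h t) ` H \<subseteq> bounded_on D"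
      unfolding D_def by (intro image_subsetI peak_set_bounded_on subsetD[OF H(2)])
    then obtain S a where Sa: "weights D S a"
      "\<And>u. u \<in> (\<lambda>h t. f t \<bullet> h t) ` H \<Longrightarrow> \<bar>m u - (\<Sum>t\<in>S. a t * u t)\<bar> \<le> d / (C + 1)"
      using mean_approx_weights[OF m(1) False finite_imageI[OF H(1)] _ C1] by blast
    obtain c where c: "peak_sum f S c" "\<forall>g. (\<Sum>t\<in>S. c t * g t) \<bullet> 1 = r * (\<Sum>t\<in>S. a t * (f t \<bullet> g t))"
      using peak_sum_of_weights[OF f(1,2) Sa(1)[unfolded D_def] m(2)] by blast
    have "(L h - (\<Sum>t\<in>S. c t * h t)) \<bullet> 1 \<le> 2 * d" if h: "h \<in> H" for h
    proof -
      have "(L h - (\<Sum>t\<in>S. c t * h t)) \<bullet> 1 \<le>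
          r * (m (\<lambda>t. f t \<bullet> h t) - (\<Sum>t\<in>S. a t * (f t \<bullet> h t))) + d / M * nrm h"
        using m(4)[of h] H h c(2) by (simp add: inner_diff_left right_diff_distrib subset_iff)
      also have "\<dots> \<le> r * (d / (C + 1)) + d / M * M"
      proof (intro add_mono mult_left_mono)
        show "m (\<lambda>t. f t \<bullet> h t) - (\<Sum>t\<in>S. a t * (f t \<bullet> h t)) \<le> d / (C + 1)"
          using Sa(2)[of "\<lambda>t. f t \<bullet> h t"] h by auto
      qed (use m nH[OF h] \<open>d / M > 0\<close> in auto)
      also have "\<dots> \<le> (C + 1) * (d / (C + 1)) + d"
        using m C1 M by (intro add_mono mult_right_mono) auto
      finally show ?thesis using C by simp
    qed
    then show ?thesis using c by blast
  qed
  then obtain S c where Sc: "peak_sum f S c" "\<And>h. h \<in> H \<Longrightarrow> (L h - (\<Sum>t\<in>S. c t * h t)) \<bullet> 1 \<le> 2 * d"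
    by blast
  show thesis
  proof (rule that[OF Sc(1)])
    fix g assume g: "g \<in> G"
    define z where "z = L g - (\<Sum>t\<in>S. c t * g t)"
    have "\<bar>(inverse b * z) \<bullet> 1\<bar> \<le> 2 * d" if b: "b \<in> Basis" for b
    proof -
      have "(inverse e * z) \<bullet> 1 \<le> 2 * d" if "e \<in> Basis \<union> uminus ` Basis" for e
      proof -
        have "(\<lambda>t. inverse e * g t) \<in> H" unfolding H_def using that g by force
        then have "(L (\<lambda>t. inverse e * g t) - (\<Sum>t\<in>S. c t * (inverse e * g t))) \<bullet> 1 \<le> 2 * d" by (rule Sc(2))
        moreover have "L (\<lambda>t. inverse e * g t) = inverse e * L g"
          using functional_scale[OF L] G g by blast
        moreover have "(\<Sum>t\<in>S. c t * (inverse e * g t)) = inverse e * (\<Sum>t\<in>S. c t * g t)"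
          by (simp add: sum_distrib_left algebra_simps)
        ultimately show ?thesis by (simp add: z_def right_diff_distrib)
      qed
      from this[of b] this[of "- b"] show ?thesis using b by (simp add: abs_le_iff)
    qed
    then have "(\<Sum>b\<in>(Basis :: 'k set). \<bar>(inverse b * z) \<bullet> 1\<bar>) \<le> (\<Sum>b\<in>(Basis :: 'k set). 2 * d)"
      by (rule sum_mono)
    then have "norm z \<le> DIM('k) * (2 * d)" using norm_le_sum_rotated[of z] by simp
    then show "norm (L g - (\<Sum>t\<in>S. c t * g t)) < \<delta>" using \<delta> DIM by (simp add: d_def z_def)
  qed
qed

text \<open>Half of \<open>\<delta>\<close> pays for Ekeland and half for the norm approximation of
  the mean, scaled by \<open>r \<le> C\<close>. The bound on the sum of the moduli is what makes the
  iteration in \<open>functional_series\<close> summable.\<close>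

lemma functional_norm_approx:
  assumes no_ell1: "\<not> contains_ell1 Y nrm"
    and L: "functional L" and C: "C \<ge> 0" "\<And>g. g \<in> Y \<Longrightarrow> norm (L g) \<le> C * nrm g" and \<delta>: "\<delta> > 0"
  obtains f S c where "peak_sum f S c" "(\<Sum>t\<in>S. norm (c t)) \<le> C"
    "\<And>g. g \<in> Y \<Longrightarrow> norm (L g - (\<Sum>t\<in>S. c t * g t)) \<le> \<delta> * nrm g"
proof -
  have "\<delta> / 2 > 0" using \<delta> by simp
  obtain f where f: "f \<in> Y" "nrm f \<le> 1"
    "{t \<in> K. norm (f t) = 1} = {} \<longrightarrow> (\<forall>g\<in>Y. L g \<bullet> 1 \<le> \<delta> / 2 * nrm g)"
    "{t \<in> K. norm (f t) = 1} \<noteq> {} \<longrightarrow>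
      (\<exists>m r. mean {t \<in> K. norm (f t) = 1} m \<and> 0 \<le> r \<and> r \<le> C \<and>
        (\<forall>g\<in>Y. L g \<bullet> 1 \<le> r * m (\<lambda>t. f t \<bullet> g t) + \<delta> / 2 * nrm g))"
    by (rule peak_mean[OF L C(2) \<open>\<delta> / 2 > 0\<close>])
  define D where "D = {t \<in> K. norm (f t) = 1}"
  have "\<exists>S c. peak_sum f S c \<and> (\<Sum>t\<in>S. norm (c t)) \<le> C \<and>
      (\<forall>h\<in>Y. (L h - (\<Sum>t\<in>S. c t * h t)) \<bullet> 1 \<le> \<delta> * nrm h)"
  proof (cases "D = {}")
    case True
    have "L h \<bullet> 1 \<le> \<delta> * nrm h" if "h \<in> Y" for h
    proof -
      have "L h \<bullet> 1 \<le> \<delta> / 2 * nrm h" using f(3) True that by (auto simp: D_def)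
      also have "\<dots> \<le> \<delta> * nrm h" using \<delta> nrm_nonneg[OF that] by (intro mult_right_mono) auto
      finally show ?thesis .
    qed
    then show ?thesis using f C by (intro exI[of _ "{}"]) (auto simp: peak_sum_def)
  next
    case False
    then obtain m r where m: "mean D m" "0 \<le> r" "r \<le> C"
      "\<And>g. g \<in> Y \<Longrightarrow> L g \<bullet> 1 \<le> r * m (\<lambda>t. f t \<bullet> g t) + \<delta> / 2 * nrm g"
      using f(4) unfolding D_def by blast
    define e where "e = \<delta> / (2 * (C + 1))"
    have e: "e > 0" using \<delta> C by (simp add: e_def)
    have "C + 1 \<noteq> 0" using C by simp
    then have Ce: "(C + 1) * e = \<delta> / 2" by (simp add: e_def divide_simps)
    obtain S a where Sa: "weights D S a"
      "\<And>g. g \<in> Y \<Longrightarrow> m (\<lambda>t. f t \<bullet> g t) - (\<Sum>t\<in>S. a t * (f t \<bullet> g t)) \<le> e * nrm g"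
      using mean_norm_approx_weights[OF no_ell1 f(1) D_def False m(1) e] by blast
    obtain c where c: "peak_sum f S c" "(\<Sum>t\<in>S. norm (c t)) = r"
      "\<forall>g. (\<Sum>t\<in>S. c t * g t) \<bullet> 1 = r * (\<Sum>t\<in>S. a t * (f t \<bullet> g t))"
      using peak_sum_of_weights[OF f(1,2) Sa(1)[unfolded D_def] m(2)] by blast
    have "(L h - (\<Sum>t\<in>S. c t * h t)) \<bullet> 1 \<le> \<delta> * nrm h" if h: "h \<in> Y" for h
    proof -
      have "(L h - (\<Sum>t\<in>S. c t * h t)) \<bullet> 1 \<le>
          r * (m (\<lambda>t. f t \<bullet> h t) - (\<Sum>t\<in>S. a t * (f t \<bullet> h t))) + \<delta> / 2 * nrm h"
        using m(4)[OF h] c(3) by (simp add: inner_diff_left right_diff_distrib)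
      also have "\<dots> \<le> r * (e * nrm h) + \<delta> / 2 * nrm h"
        using Sa(2)[OF h] m(2) by (intro add_right_mono mult_left_mono)
      also have "\<dots> \<le> (C + 1) * (e * nrm h) + \<delta> / 2 * nrm h"
        using m e nrm_nonneg[OF h] by (intro add_right_mono mult_right_mono) auto
      also have "\<dots> = ((C + 1) * e + \<delta> / 2) * nrm h" by (simp add: algebra_simps)
      also have "\<dots> = \<delta> * nrm h" unfolding Ce by simp
      finally show ?thesis .
    qed
    then show ?thesis using c m(3) by blast
  qed
  then obtain S c where Sc: "peak_sum f S c" "(\<Sum>t\<in>S. norm (c t)) \<le> C"
    "\<And>h. h \<in> Y \<Longrightarrow> (L h - (\<Sum>t\<in>S. c t * h t)) \<bullet> 1 \<le> \<delta> * nrm h"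
    by blast
  have "S \<subseteq> K" using Sc(1) by (simp add: peak_sum_def)
  show thesis
  proof (rule that[OF Sc(1,2)])
    fix g assume "g \<in> Y"
    then show "norm (L g - (\<Sum>t\<in>S. c t * g t)) \<le> \<delta> * nrm g"
      using functional_norm_from_real_part[OF functional_minus[OF L functional_point_sum[OF \<open>S \<subseteq> K\<close>]]] Sc(3) \<delta>
      by fastforce
  qed
qed

text \<open>Each round approximates the current remainder with error half of its bound, so the
  remainder after \<open>n\<close> rounds is bounded by \<open>C / 2 ^ n\<close>. The same number
  bounds the coefficients of that round, which therefore total at most \<open>2 * C\<close>.\<close>

lemma functional_series:
  assumes no_ell1: "\<not> contains_ell1 Y nrm"
    and L: "functional L" and C: "C > 0" "\<And>g. g \<in> Y \<Longrightarrow> norm (L g) \<le> C * nrm g"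
  obtains S c where "\<And>n::nat. finite (S n)" "\<And>n. S n \<subseteq> K" "\<And>n. (\<Sum>t\<in>S n. norm (c n t)) \<le> C / 2 ^ n"
    "\<And>g. g \<in> Y \<Longrightarrow> (\<lambda>n. \<Sum>t\<in>S n. c n t * g t) sums L g"
proof -
  have step: "\<exists>S c. finite S \<and> S \<subseteq> K \<and> (\<Sum>t\<in>S. norm (c t)) \<le> B \<and>
      (\<forall>g\<in>Y. norm (M g - (\<Sum>t\<in>S. c t * g t)) \<le> B / 2 * nrm g)"
    if M: "functional M" and B: "B > 0" "\<forall>g\<in>Y. norm (M g) \<le> B * nrm g" for M B
  proof -
    obtain f S c where "peak_sum f S c" "(\<Sum>t\<in>S. norm (c t)) \<le> B"
      "\<And>g. g \<in> Y \<Longrightarrow> norm (M g - (\<Sum>t\<in>S. c t * g t)) \<le> B / 2 * nrm g"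
      using functional_norm_approx[OF no_ell1 M, of B "B / 2"] B by auto
    then show ?thesis unfolding peak_sum_def by blast
  qed
  define P where "P n x \<longleftrightarrow> functional (fst x) \<and> (\<forall>g\<in>Y. norm (fst x g) \<le> C / 2 ^ n * nrm g) \<and>
      (n = 0 \<longrightarrow> fst x = L)" for n :: nat and x :: "_ \<times> 't set \<times> ('t \<Rightarrow> 'k)"
  define Q where "Q n x y \<longleftrightarrow> finite (fst (snd y)) \<and> fst (snd y) \<subseteq> K \<and>
      (\<Sum>t\<in>fst (snd y). norm (snd (snd y) t)) \<le> C / 2 ^ n \<and>
      fst y = (\<lambda>g. fst x g - (\<Sum>t\<in>fst (snd y). snd (snd y) t * g t))"
    for n :: nat and x y :: "_ \<times> 't set \<times> ('t \<Rightarrow> 'k)"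
  obtain x where x: "\<And>n. P n (x n) \<and> Q n (x n) (x (Suc n))"
  proof (atomize_elim, rule dependent_nat_choice, goal_cases)
    case 1
    show ?case using L C by (intro exI[of _ "(L, undefined)"]) (auto simp: P_def)
  next
    case (2 y n)
    have "C / 2 ^ n > 0" using C by simp
    then obtain S c where Sc: "finite S" "S \<subseteq> K" "(\<Sum>t\<in>S. norm (c t)) \<le> C / 2 ^ n"
      "\<forall>g\<in>Y. norm (fst y g - (\<Sum>t\<in>S. c t * g t)) \<le> C / 2 ^ n / 2 * nrm g"
      using step[of "fst y" "C / 2 ^ n"] 2 by (auto simp: P_def)
    have "functional (\<lambda>g. fst y g - (\<Sum>t\<in>S. c t * g t))"
      using 2 functional_minus functional_point_sum[OF Sc(2)] by (auto simp: P_def)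
    then show ?case using Sc
      by (intro exI[of _ "(\<lambda>g. fst y g - (\<Sum>t\<in>S. c t * g t), S, c)"]) (auto simp: P_def Q_def field_simps)
  qed
  \<comment> \<open>Round \<open>n\<close> writes its points and coefficients into state
    \<open>Suc n\<close>; the undefined ones of the initial state are never read.\<close>
  define S where "S n = fst (snd (x (Suc n)))" for n
  define c where "c n = snd (snd (x (Suc n)))" for n
  have Q: "finite (S n)" "S n \<subseteq> K" "(\<Sum>t\<in>S n. norm (c n t)) \<le> C / 2 ^ n"
    "fst (x (Suc n)) = (\<lambda>g. fst (x n) g - (\<Sum>t\<in>S n. c n t * g t))" for n
    using x[of n] by (auto simp: Q_def S_def c_def)
  show thesis
  proof (rule that[of S c])
    fix g assume g: "g \<in> Y"
    have "fst (x n) g = L g - (\<Sum>i<n. \<Sum>t\<in>S i. c i t * g t)" for n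
      using x[of 0] by (induction n) (auto simp: P_def Q(4))
    then have eq: "(\<Sum>i<n. \<Sum>t\<in>S i. c i t * g t) - L g = - fst (x n) g" for n by simp
    have "(\<lambda>n. (\<Sum>i<n. \<Sum>t\<in>S i. c i t * g t) - L g) \<longlonglongrightarrow> 0"
    proof (rule Lim_null_comparison)
      show "\<forall>\<^sub>F n in sequentially. norm ((\<Sum>i<n. \<Sum>t\<in>S i. c i t * g t) - L g) \<le> C * nrm g * (1 / 2) ^ n"
      proof (intro always_eventually allI)
        fix n
        have "norm (fst (x n) g) \<le> C / 2 ^ n * nrm g" using x[of n] g by (simp add: P_def)
        then show "norm ((\<Sum>i<n. \<Sum>t\<in>S i. c i t * g t) - L g) \<le> C * nrm g * (1 / 2) ^ n"
          unfolding eq by (simp add: power_one_over field_simps)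
      qed
      show "(\<lambda>n. C * nrm g * (1 / 2) ^ n) \<longlonglongrightarrow> 0"
        using tendsto_mult_right_zero[OF LIMSEQ_realpow_zero[of "1 / 2"]] by simp
    qed
    then show "(\<lambda>n. \<Sum>t\<in>S n. c n t * g t) sums L g" unfolding sums_def by (simp add: LIM_zero_iff)
  qed (rule Q)+
qed

end

section \<open>Scalar measures\<close>

lemma has_sum_disjoint_UN:
  fixes c :: "'i \<Rightarrow> 'k::banach"
  assumes "disjoint_family_on T J" "c summable_on (\<Union>n\<in>J. T n)"
  shows "((\<lambda>n. infsum c (T n)) has_sum infsum c (\<Union>n\<in>J. T n)) J"
proof (rule has_sum_Sigma[where B=T and f="\<lambda>(n, i). c i", OF isUCont_plus])
  have inj: "inj_on snd (Sigma J T)"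
    using assms(1) by (auto simp: inj_on_def disjoint_family_on_def)
  have im: "snd ` Sigma J T = (\<Union>n\<in>J. T n)" by force
  have eq: "(\<lambda>(n, i). c i) = c \<circ> snd" by auto
  show "((\<lambda>(n, i). c i) has_sum infsum c (\<Union>n\<in>J. T n)) (Sigma J T)"
    unfolding eq has_sum_reindex[OF inj, symmetric] im using assms(2) by (rule has_sum_infsum)
  show "((\<lambda>i. case (n, i) of (n, i) \<Rightarrow> c i) has_sum infsum c (T n)) (T n)" if "n \<in> J" for n
  proof -
    have "c summable_on T n" using assms(2) by (rule summable_on_subset_banach) (use that in auto)
    then show ?thesis by simp
  qed
qed

lemma infsum_disjoint_UN_finite:
  fixes c :: "'i \<Rightarrow> 'k::banach"
  assumes "finite J" "disjoint_family_on T J" "c summable_on (\<Union>n\<in>J. T n)"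
  shows "infsum c (\<Union>n\<in>J. T n) = (\<Sum>n\<in>J. infsum c (T n))"
  using has_sum_disjoint_UN[OF assms(2,3)] assms(1) by (simp add: has_sum_finite_iff)

text \<open>The measure with atoms \<open>c i\<close> at \<open>\<phi> i\<close>. It is indexed by a
  family and not by a set of points because a point may occur in several rounds of
  \<open>functional_series\<close>.\<close>

definition point_measure_sum :: "'i set \<Rightarrow> ('i \<Rightarrow> 'k::real_or_complex) \<Rightarrow> ('i \<Rightarrow> 'b) \<Rightarrow> 'b set \<Rightarrow> 'k" where
  "point_measure_sum I c \<phi> A = infsum c {i \<in> I. \<phi> i \<in> A}"

context
  fixes I :: "'i set" and c :: "'i \<Rightarrow> 'k::real_or_complex" and \<phi> :: "'i \<Rightarrow> 'b"
  assumes summable: "(\<lambda>i. norm (c i)) summable_on I"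
begin

lemma abs_summable_sub: "(\<lambda>i. norm (c i)) summable_on {i \<in> I. P i}"
  by (rule summable_on_subset_banach[OF summable]) auto

lemma summable_sub: "c summable_on {i \<in> I. P i}"
  using abs_summable_sub by (rule abs_summable_summable)

lemma scalar_measure_point_measure_sum: "scalar_measure M (point_measure_sum I c \<phi>)"
  unfolding scalar_measure_def
proof (intro allI impI)
  fix A :: "nat \<Rightarrow> 'b set" assume "disjoint_family A"
  then have dis: "disjoint_family_on (\<lambda>n. {i \<in> I. \<phi> i \<in> A n}) UNIV"
    unfolding disjoint_family_on_def by blast
  have un: "(\<Union>n. {i \<in> I. \<phi> i \<in> A n}) = {i \<in> I. \<phi> i \<in> (\<Union>n. A n)}" by auto
  have "((\<lambda>n. infsum c {i \<in> I. \<phi> i \<in> A n}) has_sum infsum c (\<Union>n. {i \<in> I. \<phi> i \<in> A n})) UNIV"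
    by (rule has_sum_disjoint_UN[OF dis]) (simp only: un summable_sub)
  then show "(\<lambda>n. point_measure_sum I c \<phi> (A n)) sums point_measure_sum I c \<phi> (\<Union>n. A n)"
    unfolding point_measure_sum_def un by (rule has_sum_imp_sums)
qed

text \<open>Only an inequality, since atoms at the same point may cancel.\<close>

lemma variation_point_measure_sum:
  "variation M (point_measure_sum I c \<phi>) E \<le> ennreal (\<Sum>\<^sub>\<infinity>i\<in>{i \<in> I. \<phi> i \<in> E}. norm (c i))"
  unfolding variation_def
proof (rule SUP_least)
  fix \<A> assume "\<A> \<in> {\<A>. finite \<A> \<and> \<A> \<subseteq> sets M \<and> disjoint \<A> \<and> \<Union>\<A> = E}"
  then have A: "finite \<A>" "disjoint \<A>" "\<Union>\<A> = E" by auto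
  have dis: "disjoint_family_on (\<lambda>B. {i \<in> I. \<phi> i \<in> B}) \<A>"
    using A(2) unfolding disjoint_family_on_def disjoint_def by blast
  have un: "(\<Union>B\<in>\<A>. {i \<in> I. \<phi> i \<in> B}) = {i \<in> I. \<phi> i \<in> E}" using A(3) by auto
  have "(\<Sum>B\<in>\<A>. norm (point_measure_sum I c \<phi> B)) \<le> (\<Sum>B\<in>\<A>. \<Sum>\<^sub>\<infinity>i\<in>{i \<in> I. \<phi> i \<in> B}. norm (c i))"
    unfolding point_measure_sum_def by (intro sum_mono norm_infsum_bound abs_summable_sub)
  also have "\<dots> = (\<Sum>\<^sub>\<infinity>i\<in>{i \<in> I. \<phi> i \<in> E}. norm (c i))"
    using infsum_disjoint_UN_finite[OF A(1) dis, of "\<lambda>i. norm (c i)"] abs_summable_sub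
    by (simp add: un)
  finally show "(\<Sum>B\<in>\<A>. ennreal (norm (point_measure_sum I c \<phi> B))) \<le> \<dots>"
    by (simp add: ennreal_leI)
qed

text \<open>For a simple function the sum over its values is the sum of \<open>c i * s (\<phi> i)\<close> grouped by value.\<close>

lemma integral_point_measure_sum:
  assumes g: "g \<in> borel_measurable M" and \<phi>: "\<And>i. i \<in> I \<Longrightarrow> \<phi> i \<in> space M"
    and s: "\<And>n. simple_function M (s n)" and lim: "uniform_limit (space M) s g sequentially"
    and B: "\<And>x. x \<in> space M \<Longrightarrow> norm (g x) \<le> B"
  shows "has_scalar_integral M (point_measure_sum I c \<phi>) g (\<Sum>\<^sub>\<infinity>i\<in>I. c i * g (\<phi> i))"
  unfolding has_scalar_integral_def
proof (intro exI[of _ s] conjI allI)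
  let ?C = "\<Sum>\<^sub>\<infinity>i\<in>I. norm (c i)"
  have elem: "(\<Sum>y\<in>s n ` space M. y * point_measure_sum I c \<phi> (s n -` {y} \<inter> space M)) = (\<Sum>\<^sub>\<infinity>i\<in>I. c i * s n (\<phi> i))"
    and sm: "(\<lambda>i. c i * s n (\<phi> i)) summable_on I" for n
  proof -
    have fin: "finite (s n ` space M)" using s[of n] by (simp add: simple_function_def)
    then obtain R where R: "\<And>y. y \<in> s n ` space M \<Longrightarrow> norm y \<le> R"
      using finite_imp_bounded bounded_iff by metis
    have "(\<lambda>i. norm (c i * s n (\<phi> i))) summable_on I"
    proof (rule Infinite_Sum.abs_summable_on_comparison_test)
      show "(\<lambda>i. norm (c i * of_real R :: 'k)) summable_on I"
        using summable_on_cmult_left[OF summable, of "\<bar>R\<bar>"] by (simp add: norm_mult)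
      show "norm (c i * s n (\<phi> i)) \<le> norm (c i * of_real R :: 'k)" if "i \<in> I" for i
        using R[of "s n (\<phi> i)"] \<phi>[OF that] by (auto simp: norm_mult intro!: mult_left_mono)
    qed
    then show sm: "(\<lambda>i. c i * s n (\<phi> i)) summable_on I" by (rule abs_summable_summable)
    let ?T = "\<lambda>y. {i \<in> I. \<phi> i \<in> s n -` {y} \<inter> space M}"
    have dis: "disjoint_family_on ?T (s n ` space M)" by (auto simp: disjoint_family_on_def)
    have un: "(\<Union>y\<in>s n ` space M. ?T y) = I" using \<phi> by auto
    have "(\<Sum>y\<in>s n ` space M. y * point_measure_sum I c \<phi> (s n -` {y} \<inter> space M)) =
        (\<Sum>y\<in>s n ` space M. \<Sum>\<^sub>\<infinity>i\<in>?T y. c i * s n (\<phi> i))"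
    proof (rule sum.cong)
      fix y
      have "(\<Sum>\<^sub>\<infinity>i\<in>?T y. c i * s n (\<phi> i)) = (\<Sum>\<^sub>\<infinity>i\<in>?T y. y * c i)"
        by (rule infsum_cong) auto
      also have "\<dots> = y * infsum c (?T y)" by (rule infsum_cmult_right) (rule summable_sub)
      finally show "y * point_measure_sum I c \<phi> (s n -` {y} \<inter> space M) = (\<Sum>\<^sub>\<infinity>i\<in>?T y. c i * s n (\<phi> i))"
        by (simp add: point_measure_sum_def)
    qed simp
    also have "\<dots> = (\<Sum>\<^sub>\<infinity>i\<in>I. c i * s n (\<phi> i))"
      using infsum_disjoint_UN_finite[OF fin dis, of "\<lambda>i. c i * s n (\<phi> i)"] sm by (simp only: un)
    finally show "(\<Sum>y\<in>s n ` space M. y * point_measure_sum I c \<phi> (s n -` {y} \<inter> space M)) =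
      (\<Sum>\<^sub>\<infinity>i\<in>I. c i * s n (\<phi> i))" .
  qed
  have smg: "(\<lambda>i. c i * g (\<phi> i)) summable_on I"
  proof (rule abs_summable_summable, rule Infinite_Sum.abs_summable_on_comparison_test)
    show "(\<lambda>i. norm (c i * of_real B :: 'k)) summable_on I"
      using summable_on_cmult_left[OF summable, of "\<bar>B\<bar>"] by (simp add: norm_mult)
    show "norm (c i * g (\<phi> i)) \<le> norm (c i * of_real B :: 'k)" if "i \<in> I" for i
      using B[OF \<phi>[OF that]] by (auto simp: norm_mult intro!: mult_left_mono)
  qed
  show "(\<lambda>n. \<Sum>y\<in>s n ` space M. y * point_measure_sum I c \<phi> (s n -` {y} \<inter> space M))
      \<longlonglongrightarrow> (\<Sum>\<^sub>\<infinity>i\<in>I. c i * g (\<phi> i))"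
    unfolding elem
  proof (rule tendstoI)
    fix e :: real assume e: "e > 0"
    have C0: "?C \<ge> 0" by (rule infsum_nonneg) simp
    define d where "d = e / (2 * (?C + 1))"
    have d: "d > 0" using e C0 by (simp add: d_def)
    have "?C * d < e"
    proof -
      have "?C * d \<le> (?C + 1) * d" using d by (intro mult_right_mono) auto
      also have "\<dots> = e / 2" using C0 by (simp add: d_def divide_simps)
      finally show ?thesis using e by simp
    qed
    have "\<forall>\<^sub>F n in sequentially. \<forall>x\<in>space M. dist (s n x) (g x) < d"
      using uniform_limitD[OF lim d] .
    then show "\<forall>\<^sub>F n in sequentially. dist (\<Sum>\<^sub>\<infinity>i\<in>I. c i * s n (\<phi> i)) (\<Sum>\<^sub>\<infinity>i\<in>I. c i * g (\<phi> i)) < e"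
    proof eventually_elim
      case (elim n)
      have b: "norm (c i * s n (\<phi> i) - c i * g (\<phi> i)) \<le> norm (c i) * d" if "i \<in> I" for i
        using elim \<phi>[OF that] by (auto simp: right_diff_distrib[symmetric] norm_mult dist_norm less_imp_le intro!: mult_left_mono)
      have as: "(\<lambda>i. norm (c i * s n (\<phi> i) - c i * g (\<phi> i))) summable_on I"
      proof (rule Infinite_Sum.abs_summable_on_comparison_test)
        show "(\<lambda>i. norm (c i * of_real d :: 'k)) summable_on I"
          using summable_on_cmult_left[OF summable, of "\<bar>d\<bar>"] by (simp add: norm_mult)
        show "norm (c i * s n (\<phi> i) - c i * g (\<phi> i)) \<le> norm (c i * of_real d :: 'k)" if "i \<in> I" for i
          using b[OF that] d by (simp add: norm_mult)
      qed
      have "(\<Sum>\<^sub>\<infinity>i\<in>I. c i * s n (\<phi> i)) - (\<Sum>\<^sub>\<infinity>i\<in>I. c i * g (\<phi> i)) = (\<Sum>\<^sub>\<infinity>i\<in>I. c i * s n (\<phi> i) - c i * g (\<phi> i))"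
        using infsum_add[OF sm[of n] summable_on_uminus[THEN iffD2, OF smg]] by (simp add: infsum_uminus)
      also have "norm \<dots> \<le> (\<Sum>\<^sub>\<infinity>i\<in>I. norm (c i * s n (\<phi> i) - c i * g (\<phi> i)))"
        by (rule norm_infsum_bound[OF as])
      also have "\<dots> \<le> (\<Sum>\<^sub>\<infinity>i\<in>I. norm (c i) * d)"
        by (rule infsum_mono) (use as b summable_on_cmult_left[OF summable] in auto)
      also have "\<dots> = ?C * d" by (rule infsum_cmult_left) (use summable in auto)
      finally show ?case using \<open>?C * d < e\<close> by (simp add: dist_norm)
    qed
  qed
qed (use s lim in auto)

end

section \<open>Uniform approximation by simple functions\<close>

lemma uniform_limit_inverse_Suc:
  assumes "\<And>n x. x \<in> S \<Longrightarrow> dist (z n x) (f x) < inverse (real (Suc n))"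
  shows "uniform_limit S z f sequentially"
proof (rule uniform_limitI)
  fix e :: real assume "e > 0"
  then have "\<forall>\<^sub>F n in sequentially. inverse (real (Suc n)) < e"
    using order_tendstoD(2)[OF LIMSEQ_inverse_real_of_nat] by blast
  then show "\<forall>\<^sub>F n in sequentially. \<forall>x\<in>S. dist (z n x) (f x) < e"
    by eventually_elim (use assms less_trans in blast)
qed

lemma simple_function_uniform_approx:
  fixes g :: "'b \<Rightarrow> 'k::euclidean_space"
  assumes g: "g \<in> borel_measurable M" and B: "\<And>x. x \<in> space M \<Longrightarrow> norm (g x) \<le> B"
  obtains s where "\<And>n::nat. simple_function M (s n)" "uniform_limit (space M) s g sequentially"
proof -
  have "\<exists>s. simple_function M s \<and> (\<forall>x\<in>space M. dist (s x) (g x) < e)" if e: "e > 0" for e :: real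
  proof -
    have mem: "c \<in> ball c e" for c :: 'k using e by simp
    obtain C where C: "finite C" "cball (0::'k) B \<subseteq> (\<Union>c\<in>C. ball c e)"
      by (rule compactE_image[OF compact_cball, of UNIV "\<lambda>c::'k. ball c e" 0 B]) (use mem in \<open>blast intro: open_ball\<close>)+
    obtain h :: "nat \<Rightarrow> 'k" and n where h: "C = h ` {i. i < n}"
      using finite_imp_nat_seg_image_inj_on[OF C(1)] by blast
    \<comment> \<open>Taking the least index among the net points near \<open>g x\<close> makes the
      selection measurable.\<close>
    define s where "s x = h (LEAST i. dist (h i) (g x) < e)" for x
    have ex: "\<exists>i<n. dist (h i) (g x) < e" if "x \<in> space M" for x
    proof -
      have "g x \<in> cball 0 B" using B[OF that] by simp
      then show ?thesis using C(2) h by fastforce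
    qed
    have "(\<lambda>x. LEAST i. dist (h i) (g x) < e) \<in> measurable M (count_space UNIV)"
      using g by (intro measurable_Least) measurable
    then have "s \<in> borel_measurable M"
      unfolding s_def by (rule measurable_compose) simp
    moreover have "s ` space M \<subseteq> h ` {..n}"
    proof
      fix y assume "y \<in> s ` space M"
      then obtain x where x: "x \<in> space M" "y = s x" by blast
      obtain i where i: "i < n" "dist (h i) (g x) < e" using ex[OF x(1)] by blast
      then have "(LEAST i. dist (h i) (g x) < e) \<le> i" by (intro Least_le)
      then show "y \<in> h ` {..n}" using i x by (auto simp: s_def)
    qed
    then have "finite (s ` space M)" by (rule finite_subset) simp
    ultimately have "simple_function M s" by (rule simple_function_borel_measurable)
    moreover have "dist (s x) (g x) < e" if "x \<in> space M" for x
      unfolding s_def using ex[OF that] by (auto intro: LeastI)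
    ultimately show ?thesis by blast
  qed
  then have "\<forall>n. \<exists>s. simple_function M s \<and> (\<forall>x\<in>space M. dist (s x) (g x) < inverse (real (Suc n)))" by simp
  then obtain s where s: "\<And>n. simple_function M (s n)" "\<And>n x. x \<in> space M \<Longrightarrow> dist (s n x) (g x) < inverse (real (Suc n))"
    by metis
  have "uniform_limit (space M) s g sequentially"
    by (rule uniform_limit_inverse_Suc[OF s(2)])
  then show thesis using that s(1) by blast
qed

section \<open>Integration against bounded scalar measures\<close>

lemma
  assumes "scalar_measure M \<mu>"
  shows scalar_measure_empty: "\<mu> {} = 0"
    and scalar_measure_Un: "A \<in> sets M \<Longrightarrow> B \<in> sets M \<Longrightarrow> A \<inter> B = {} \<Longrightarrow> \<mu> (A \<union> B) = \<mu> A + \<mu> B"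
proof -
  have sums: "(\<lambda>i. \<mu> (A i)) sums \<mu> (\<Union>i. A i)" if "range A \<subseteq> sets M" "disjoint_family A" for A :: "nat \<Rightarrow> _"
    using assms that unfolding scalar_measure_def by blast
  have "(\<lambda>i::nat. \<mu> {}) sums \<mu> {}" using sums[of "\<lambda>_. {}"] by (simp add: disjoint_family_on_def)
  then have "summable (\<lambda>i::nat. \<mu> {})" by (rule sums_summable)
  then have "(\<lambda>i::nat. \<mu> {}) \<longlonglongrightarrow> 0" by (rule summable_LIMSEQ_zero)
  then show 0: "\<mu> {} = 0" by (simp add: LIMSEQ_const_iff)
  assume AB: "A \<in> sets M" "B \<in> sets M" "A \<inter> B = {}"
  have "(\<lambda>i. \<mu> (binaryset A B i)) sums \<mu> (\<Union>i. binaryset A B i)"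
    by (rule sums) (use AB in \<open>auto simp: disjoint_family_on_def binaryset_def\<close>)
  moreover have "(\<lambda>i. \<mu> (binaryset A B i)) sums (\<mu> A + \<mu> B)"
    using sums_finite[of "{0, 1}" "\<lambda>i. \<mu> (binaryset A B i)"] 0 by (auto simp: binaryset_def)
  ultimately show "\<mu> (A \<union> B) = \<mu> A + \<mu> B" using sums_unique2 by (fastforce simp: UN_binaryset_eq)
qed

lemma scalar_measure_UN:
  assumes \<mu>: "scalar_measure M \<mu>" and "finite J" "\<And>j. j \<in> J \<Longrightarrow> A j \<in> sets M" "disjoint_family_on A J"
  shows "\<mu> (\<Union>j\<in>J. A j) = (\<Sum>j\<in>J. \<mu> (A j))"
  using assms(2-)
proof (induction J rule: finite_induct)
  case empty
  then show ?case using scalar_measure_empty[OF \<mu>] by simp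
next
  case (insert j J)
  have "\<mu> (A j \<union> (\<Union>j\<in>J. A j)) = \<mu> (A j) + \<mu> (\<Union>j\<in>J. A j)"
    by (rule scalar_measure_Un[OF \<mu>]) (use insert in \<open>auto simp: disjoint_family_on_def\<close>)
  then show ?case using insert by (auto simp: disjoint_family_on_def)
qed

text \<open>Split each real component by sign: additivity turns each part into a component of the
  measure of one union, hence at most \<open>B\<close>. Two signs and \<open>DIM('k)\<close>
  components give the factor. Bounded scalar measures thus have finite variation.\<close>

lemma scalar_measure_sum_norm_le:
  fixes \<mu> :: "'b set \<Rightarrow> 'k::real_or_complex" and B :: real
  assumes \<mu>: "scalar_measure M \<mu>" and B: "\<And>A. A \<in> sets M \<Longrightarrow> norm (\<mu> A) \<le> B"
    and J: "finite J" "\<And>j. j \<in> J \<Longrightarrow> A j \<in> sets M" "disjoint_family_on A J"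
  shows "(\<Sum>j\<in>J. norm (\<mu> (A j))) \<le> 2 * DIM('k) * B"
proof -
  have part: "\<bar>\<Sum>j\<in>J'. \<mu> (A j) \<bullet> b\<bar> \<le> B" if "J' \<subseteq> J" "b \<in> Basis" for J' b
  proof -
    have "(\<Sum>j\<in>J'. \<mu> (A j)) = \<mu> (\<Union>j\<in>J'. A j)"
      using that J by (intro scalar_measure_UN[OF \<mu>, symmetric]) (auto intro: finite_subset disjoint_family_on_mono)
    moreover have "(\<Union>j\<in>J'. A j) \<in> sets M" using that J by (intro sets.finite_UN) (auto intro: finite_subset)
    ultimately have "norm (\<Sum>j\<in>J'. \<mu> (A j)) \<le> B" using B by simp
    then show ?thesis using Basis_le_norm[OF that(2), of "\<Sum>j\<in>J'. \<mu> (A j)"] by (simp add: inner_sum_left)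
  qed
  have "(\<Sum>j\<in>J. norm (\<mu> (A j))) \<le> (\<Sum>j\<in>J. \<Sum>b\<in>Basis. \<bar>\<mu> (A j) \<bullet> b\<bar>)" by (intro sum_mono norm_le_l1)
  also have "\<dots> = (\<Sum>b\<in>Basis. \<Sum>j\<in>J. \<bar>\<mu> (A j) \<bullet> b\<bar>)" by (rule sum.swap)
  also have "\<dots> \<le> (\<Sum>b\<in>(Basis::'k set). 2 * B)"
  proof (rule sum_mono)
    fix b :: 'k assume b: "b \<in> Basis"
    let ?P = "{j \<in> J. \<mu> (A j) \<bullet> b \<ge> 0}"
    have "(\<Sum>j\<in>J. \<bar>\<mu> (A j) \<bullet> b\<bar>) = (\<Sum>j\<in>?P. \<bar>\<mu> (A j) \<bullet> b\<bar>) + (\<Sum>j\<in>J - ?P. \<bar>\<mu> (A j) \<bullet> b\<bar>)"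
      using sum.subset_diff[of ?P J "\<lambda>j. \<bar>\<mu> (A j) \<bullet> b\<bar>"] J(1) by simp
    also have "(\<Sum>j\<in>?P. \<bar>\<mu> (A j) \<bullet> b\<bar>) = (\<Sum>j\<in>?P. \<mu> (A j) \<bullet> b)" by (rule sum.cong) auto
    also have "(\<Sum>j\<in>J - ?P. \<bar>\<mu> (A j) \<bullet> b\<bar>) = - (\<Sum>j\<in>J - ?P. \<mu> (A j) \<bullet> b)"
      unfolding sum_negf[symmetric] by (rule sum.cong) auto
    finally show "(\<Sum>j\<in>J. \<bar>\<mu> (A j) \<bullet> b\<bar>) \<le> 2 * B"
      using part[of ?P b] part[of "J - ?P" b] b by (simp add: abs_le_iff)
  qed
  finally show ?thesis by (simp add: mult.commute mult.left_commute)
qed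

definition simple_integral_over :: "'b measure \<Rightarrow> ('b set \<Rightarrow> 'k::real_or_complex) \<Rightarrow> ('b \<Rightarrow> 'k) \<Rightarrow> 'k" where
  "simple_integral_over M \<mu> s = (\<Sum>y\<in>s ` space M. y * \<mu> (s -` {y} \<inter> space M))"

context
  fixes M :: "'b measure" and \<mu> :: "'b set \<Rightarrow> 'k::real_or_complex"
  assumes \<mu>: "scalar_measure M \<mu>"
begin

text \<open>Applied to a pair of simple functions: both, and any combination of them, are functions
  of the pair, so their integrals are sums over the same cells and linearity holds termwise.\<close>

lemma simple_integral_over_comp:
  assumes t: "simple_function M t"
  shows "simple_integral_over M \<mu> (\<lambda>x. F (t x)) = (\<Sum>z\<in>t ` space M. F z * \<mu> (t -` {z} \<inter> space M))"
proof -
  have fin: "finite (t ` space M)" using t by (simp add: simple_function_def)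
  have ms: "t -` {z} \<inter> space M \<in> sets M" if "z \<in> t ` space M" for z using t that by (auto simp: simple_function_def)
  let ?V = "\<lambda>y. {z \<in> t ` space M. F z = y}"
  have "(\<lambda>x. F (t x)) -` {y} \<inter> space M = (\<Union>z\<in>?V y. t -` {z} \<inter> space M)" for y by auto
  moreover have "\<mu> (\<Union>z\<in>?V y. t -` {z} \<inter> space M) = (\<Sum>z\<in>?V y. \<mu> (t -` {z} \<inter> space M))" for y
    by (rule scalar_measure_UN[OF \<mu>]) (use fin ms in \<open>auto simp: disjoint_family_on_def\<close>)
  ultimately have "simple_integral_over M \<mu> (\<lambda>x. F (t x)) =
      (\<Sum>y\<in>F ` t ` space M. \<Sum>z\<in>?V y. F z * \<mu> (t -` {z} \<inter> space M))"
    unfolding simple_integral_over_def by (auto simp: sum_distrib_left image_image intro!: sum.cong)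
  also have "\<dots> = (\<Sum>z\<in>t ` space M. F z * \<mu> (t -` {z} \<inter> space M))"
    using sum.image_gen[OF fin, of "\<lambda>z. F z * \<mu> (t -` {z} \<inter> space M)" F] by simp
  finally show ?thesis .
qed

lemma simple_integral_over_lin:
  assumes s: "simple_function M s" "simple_function M s'"
  shows "simple_integral_over M \<mu> (\<lambda>x. a * s x + s' x) = a * simple_integral_over M \<mu> s + simple_integral_over M \<mu> s'"
proof -
  let ?t = "\<lambda>x. (s x, s' x)"
  have t: "simple_function M ?t" using s by (rule simple_function_Pair)
  show ?thesis
    using simple_integral_over_comp[OF t, of "\<lambda>z. a * fst z + snd z"]
      simple_integral_over_comp[OF t, of fst] simple_integral_over_comp[OF t, of snd]
    by (simp add: sum_distrib_left sum.distrib[symmetric] algebra_simps)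
qed

lemma simple_integral_over_bound:
  fixes B r :: real
  assumes B: "\<And>A. A \<in> sets M \<Longrightarrow> norm (\<mu> A) \<le> B" and s: "simple_function M s"
    and r: "\<And>x. x \<in> space M \<Longrightarrow> norm (s x) \<le> r" "r \<ge> 0"
  shows "norm (simple_integral_over M \<mu> s) \<le> 2 * DIM('k) * B * r"
proof -
  have fin: "finite (s ` space M)" using s by (simp add: simple_function_def)
  have "norm (simple_integral_over M \<mu> s) \<le> (\<Sum>y\<in>s ` space M. norm (y * \<mu> (s -` {y} \<inter> space M)))"
    unfolding simple_integral_over_def by (rule norm_sum)
  also have "\<dots> \<le> (\<Sum>y\<in>s ` space M. r * norm (\<mu> (s -` {y} \<inter> space M)))"
    by (rule sum_mono) (use r in \<open>auto simp: norm_mult intro!: mult_right_mono\<close>)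
  also have "\<dots> = r * (\<Sum>y\<in>s ` space M. norm (\<mu> (s -` {y} \<inter> space M)))" by (simp add: sum_distrib_left)
  also have "\<dots> \<le> r * (2 * DIM('k) * B)"
  proof (rule mult_left_mono[OF scalar_measure_sum_norm_le[OF \<mu> B fin]])
    show "s -` {y} \<inter> space M \<in> sets M" if "y \<in> s ` space M" for y using s that by (auto simp: simple_function_def)
  qed (use r(2) in \<open>auto simp: disjoint_family_on_def\<close>)
  finally show ?thesis by (simp add: mult.commute)
qed

lemma has_scalar_integral_lin:
  assumes "has_scalar_integral M \<mu> f a" "has_scalar_integral M \<mu> g b"
  shows "has_scalar_integral M \<mu> (\<lambda>x. c * f x + g x) (c * a + b)"
proof -
  obtain s where s: "\<And>n::nat. simple_function M (s n)" "uniform_limit (space M) s f sequentially"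
    "(\<lambda>n. simple_integral_over M \<mu> (s n)) \<longlonglongrightarrow> a"
    using assms(1) unfolding has_scalar_integral_def simple_integral_over_def by blast
  obtain s' where s': "\<And>n::nat. simple_function M (s' n)" "uniform_limit (space M) s' g sequentially"
    "(\<lambda>n. simple_integral_over M \<mu> (s' n)) \<longlonglongrightarrow> b"
    using assms(2) unfolding has_scalar_integral_def simple_integral_over_def by blast
  show ?thesis
    unfolding has_scalar_integral_def simple_integral_over_def[symmetric]
  proof (intro exI[of _ "\<lambda>n x. c * s n x + s' n x"] conjI allI)
    show "simple_function M (\<lambda>x. c * s n x + s' n x)" for n
      using simple_function_compose[OF simple_function_Pair[OF s(1) s'(1)], of "\<lambda>z. c * fst z + snd z" n n]
      by (simp add: comp_def)
    show "uniform_limit (space M) (\<lambda>n x. c * s n x + s' n x) (\<lambda>x. c * f x + g x) sequentially"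
      by (intro uniform_limit_add s'(2) bounded_linear.uniform_limit[OF bounded_linear_mult_right] s(2))
    show "(\<lambda>n. simple_integral_over M \<mu> (\<lambda>x. c * s n x + s' n x)) \<longlonglongrightarrow> c * a + b"
      unfolding simple_integral_over_lin[OF s(1) s'(1)] by (intro tendsto_intros s s')
  qed
qed

lemma has_scalar_integral_exists:
  fixes B r :: real
  assumes B: "\<And>A. A \<in> sets M \<Longrightarrow> norm (\<mu> A) \<le> B"
    and f: "f \<in> borel_measurable M" "\<And>x. x \<in> space M \<Longrightarrow> norm (f x) \<le> r"
  obtains a where "has_scalar_integral M \<mu> f a"
proof -
  obtain s where s: "\<And>n::nat. simple_function M (s n)" "uniform_limit (space M) s f sequentially"
    using simple_function_uniform_approx[OF f] by blast
  have "B \<ge> 0" using B[of "{}"] norm_ge_zero order_trans by blast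
  define k where "k = 2 * DIM('k) * B + 1"
  have k: "k > 0" using \<open>B \<ge> 0\<close> by (simp add: k_def add_nonneg_pos)
  have diff: "simple_integral_over M \<mu> (s m) - simple_integral_over M \<mu> (s n)
      = simple_integral_over M \<mu> (\<lambda>x. - 1 * s n x + s m x)" for m n
    using simple_integral_over_lin[OF s(1)[of n] s(1)[of m], of "- 1"] by simp
  have "Cauchy (\<lambda>n. simple_integral_over M \<mu> (s n))"
  proof (rule metric_CauchyI)
    fix e :: real assume e: "e > 0"
    define d where "d = e / (2 * k)"
    have d: "d > 0" using e k by (simp add: d_def)
    obtain n0 where n0: "\<And>n x. n \<ge> n0 \<Longrightarrow> x \<in> space M \<Longrightarrow> dist (s n x) (f x) < d / 2"
      using uniform_limitD[OF s(2) half_gt_zero[OF d]] unfolding eventually_sequentially by blast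
    have "dist (simple_integral_over M \<mu> (s m)) (simple_integral_over M \<mu> (s n)) < e" if mn: "m \<ge> n0" "n \<ge> n0" for m n
    proof -
      have "norm (- 1 * s n x + s m x) \<le> d" if "x \<in> space M" for x
        using n0[OF mn(1) that] n0[OF mn(2) that] dist_triangle2[of "s m x" "s n x" "f x"] by (simp add: dist_norm)
      moreover have "simple_function M (\<lambda>x. - 1 * s n x + s m x)"
        using simple_function_diff[OF s(1)[of m] s(1)[of n]] by simp
      ultimately have "norm (simple_integral_over M \<mu> (s m) - simple_integral_over M \<mu> (s n)) \<le> (2 * DIM('k) * B) * d"
        unfolding diff using d by (intro simple_integral_over_bound[OF B]) auto
      also have "\<dots> \<le> k * d" using d by (intro mult_right_mono) (auto simp: k_def)
      also have "\<dots> < e" using e k by (simp add: d_def)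
      finally show ?thesis by (simp add: dist_norm)
    qed
    then show "\<exists>n0. \<forall>m\<ge>n0. \<forall>n\<ge>n0. dist (simple_integral_over M \<mu> (s m)) (simple_integral_over M \<mu> (s n)) < e" by blast
  qed
  then obtain a where "(\<lambda>n. simple_integral_over M \<mu> (s n)) \<longlonglongrightarrow> a"
    using Cauchy_convergent convergent_def by blast
  then show thesis using that s unfolding has_scalar_integral_def simple_integral_over_def by blast
qed

lemma has_scalar_integral_bound:
  fixes B r :: real
  assumes B: "\<And>A. A \<in> sets M \<Longrightarrow> norm (\<mu> A) \<le> B"
    and f: "has_scalar_integral M \<mu> f a" and r: "\<And>x. x \<in> space M \<Longrightarrow> norm (f x) \<le> r" "r \<ge> 0"
  shows "norm a \<le> 2 * DIM('k) * B * r"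
proof (rule field_le_epsilon)
  fix e :: real assume e: "e > 0"
  have "B \<ge> 0" using B[of "{}"] norm_ge_zero order_trans by blast
  define k where "k = 2 * DIM('k) * B"
  have k: "k \<ge> 0" using \<open>B \<ge> 0\<close> by (simp add: k_def)
  define d where "d = e / (k + 1)"
  have d: "d > 0" using e k by (simp add: d_def)
  obtain s where s: "\<And>n::nat. simple_function M (s n)" "uniform_limit (space M) s f sequentially"
    "(\<lambda>n. simple_integral_over M \<mu> (s n)) \<longlonglongrightarrow> a"
    using f unfolding has_scalar_integral_def simple_integral_over_def by blast
  have "norm a \<le> k * (r + d)"
  proof (rule tendsto_upperbound[OF tendsto_norm[OF s(3)]])
    show "\<forall>\<^sub>F n in sequentially. norm (simple_integral_over M \<mu> (s n)) \<le> k * (r + d)"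
      using uniform_limitD[OF s(2) d]
    proof eventually_elim
      case (elim n)
      have "norm (s n x) \<le> r + d" if "x \<in> space M" for x
      proof -
        have "norm (s n x) \<le> norm (f x) + norm (s n x - f x)" by (rule norm_triangle_sub)
        then show ?thesis using elim that r(1)[OF that] by (fastforce simp: dist_norm)
      qed
      then show ?case unfolding k_def using simple_integral_over_bound[OF B s(1)[of n], of "r + d"] r(2) d by simp
    qed
  qed simp
  also have "k * (r + d) \<le> k * r + (k + 1) * d" using k d by (simp add: algebra_simps)
  also have "(k + 1) * d = e" using k by (simp add: d_def)
  finally show "norm a \<le> 2 * DIM('k) * B * r + e" by (simp add: k_def)
qed

text \<open>The difference of two values is an integral of the zero function.\<close>

lemma has_scalar_integral_unique:
  fixes B :: real
  assumes B: "\<And>A. A \<in> sets M \<Longrightarrow> norm (\<mu> A) \<le> B"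
    and "has_scalar_integral M \<mu> f a" "has_scalar_integral M \<mu> f b"
  shows "a = b"
  using has_scalar_integral_bound[OF B has_scalar_integral_lin[OF assms(2,3), of "- 1"], of 0] by simp

end

section \<open>Functionals on a Banach space over the scalar field\<close>

text \<open>A real functional \<open>u\<close> is the real part of the functional \<open>\<phi>\<close> determined by
  \<open>u (c x) = Re (c \<phi> x)\<close> for all scalars \<open>c\<close>.\<close>

lemma real_functional_scalar:
  fixes l :: "'k::real_or_complex \<Rightarrow> real"
  assumes l: "\<And>a b. l (a + b) = l a + l b" "\<And>r a. l (r *\<^sub>R a) = r * l a"
  shows "\<exists>!d. \<forall>c. l c = (c * d) \<bullet> 1"
proof -
  have lin_l: "linear l" using l by (intro linearI) auto
  \<comment> \<open>\<open>A d\<close> represents the real functional sending \<open>c\<close> to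
    \<open>(c * d) \<bullet> 1\<close>. Testing with \<open>inverse d\<close> shows injectivity of
    \<open>A\<close>; finite dimension gives surjectivity, which produces \<open>d\<close> from
    \<open>l\<close>.\<close>
  define A where "A d = (\<Sum>b\<in>Basis. ((b * d) \<bullet> 1) *\<^sub>R b)" for d :: 'k
  have expand: "f c = (\<Sum>b\<in>Basis. (c \<bullet> b) * f b)" if f: "linear f" for f :: "'k \<Rightarrow> real" and c
  proof -
    have "f c = f (\<Sum>b\<in>Basis. (c \<bullet> b) *\<^sub>R b)" by (simp add: euclidean_representation)
    also have "\<dots> = (\<Sum>b\<in>Basis. f ((c \<bullet> b) *\<^sub>R b))" by (rule linear_sum[OF f])
    also have "\<dots> = (\<Sum>b\<in>Basis. (c \<bullet> b) * f b)" by (simp add: linear_scale[OF f])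
    finally show ?thesis .
  qed
  have lin_d: "linear (\<lambda>c. (c * d) \<bullet> 1)" for d :: 'k
    by (intro linearI) (auto simp: distrib_right inner_add_left)
  have A: "c \<bullet> A d = (c * d) \<bullet> 1" for c d
  proof -
    have "(c * d) \<bullet> 1 = (\<Sum>b\<in>Basis. (c \<bullet> b) * ((b * d) \<bullet> 1))"
      by (rule expand[OF lin_d])
    then show ?thesis by (simp add: A_def inner_sum_right mult.commute)
  qed
  have "linear A"
    unfolding A_def by (intro linear_compose_sum ballI linearI)
      (auto simp: distrib_left inner_add_left scaleR_add_left)
  moreover have "inj A"
  proof (rule linear_injective_0[OF \<open>linear A\<close>, THEN iffD2], intro allI impI)
    fix d assume "A d = 0"
    then have z: "(c * d) \<bullet> 1 = 0" for c using A[of c d] by simp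
    show "d = 0"
    proof (rule ccontr)
      assume "d \<noteq> 0"
      then show False using z[of "inverse d"] by (simp add: dot_square_norm)
    qed
  qed
  ultimately have "surj A" by (rule eucl.linear_inj_imp_surj)
  then obtain d where d: "A d = (\<Sum>b\<in>Basis. l b *\<^sub>R b)" by (metis surjD)
  have "l c = (c * d) \<bullet> 1" for c
  proof -
    have "l c = (\<Sum>b\<in>Basis. (c \<bullet> b) * l b)" by (rule expand[OF lin_l])
    also have "\<dots> = c \<bullet> A d" unfolding d by (simp add: inner_sum_right mult.commute)
    finally show ?thesis using A by simp
  qed
  moreover have "d' = d" if "\<forall>c. l c = (c * d') \<bullet> 1" for d'
  proof -
    have "(c * (d' - d)) \<bullet> 1 = 0" for c
      using that calculation[of c] by (simp add: right_diff_distrib inner_diff_left)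
    then have "A (d' - d) = 0" using A[of "A (d' - d)" "d' - d"] by simp
    then show ?thesis using \<open>inj A\<close> \<open>linear A\<close> by (metis eq_iff_diff_eq_0 linear_injective_0)
  qed
  ultimately show ?thesis by blast
qed

context banach_space_over
begin

text \<open>A description by pointwise closed conditions in place of the operator norm, as the
  product topology requires.\<close>

lemma dual_ball_iff: "\<phi> \<in> dual_ball smul \<longleftrightarrow>
    (\<forall>x y. \<phi> (x + y) = \<phi> x + \<phi> y) \<and> (\<forall>c x. \<phi> (smul c x) = c * \<phi> x) \<and> (\<forall>x. norm (\<phi> x) \<le> norm x)"
  (is "_ \<longleftrightarrow> ?R")
proof
  assume \<phi>: "\<phi> \<in> dual_ball smul"
  then have "bounded_linear \<phi>" "onorm \<phi> \<le> 1" "Vector_Spaces.linear smul (*) \<phi>"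
    by (auto simp: dual_ball_def dual_space_def)
  moreover have "norm (\<phi> x) \<le> norm x" for x
    using onorm[OF calculation(1), of x] mult_right_mono[OF calculation(2) norm_ge_zero[of x]] by simp
  ultimately show ?R unfolding Vector_Spaces.linear_iff by blast
next
  assume R: ?R
  have "vector_space smul" by unfold_locales
  moreover have "vector_space ((*) :: 'k \<Rightarrow> 'k \<Rightarrow> 'k)" by unfold_locales (auto simp: algebra_simps)
  ultimately have lin: "Vector_Spaces.linear smul (*) \<phi>" unfolding Vector_Spaces.linear_iff using R by blast
  have bl: "bounded_linear \<phi>"
  proof (rule bounded_linear_intro[of _ 1])
    show "\<phi> (r *\<^sub>R x) = r *\<^sub>R \<phi> x" for r x
      using R smul_of_real[of r x] by (metis scaleR_conv_of_real)
  qed (use R in auto)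
  have "onorm \<phi> \<le> 1" by (rule onorm_bound) (use R in auto)
  then show "\<phi> \<in> dual_ball smul" using lin bl by (simp add: dual_ball_def dual_space_def)
qed

lemma zero_in_dual_ball: "(\<lambda>_. 0) \<in> dual_ball smul"
  by (simp add: dual_ball_iff)

lemma dual_sphere_subset: "dual_sphere smul \<subseteq> dual_ball smul"
  by (auto simp: dual_sphere_def dual_ball_def)

text \<open>Banach-Alaoglu: the product of the balls of radius \<open>norm x\<close> is compact by
  Tychonoff, and the linearity conditions cut out a closed subset.\<close>

lemma compact_dual_ball: "compact (dual_ball smul)"
proof -
  have co: "continuous_on UNIV (\<lambda>\<phi>::'a \<Rightarrow> 'k. \<phi> x)" for x by simp
  have "compactin (product_topology (\<lambda>_. euclidean) UNIV) (PiE UNIV (\<lambda>x::'a. cball (0::'k) (norm x)))"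
    unfolding compactin_PiE by simp
  then have c: "compact (PiE UNIV (\<lambda>x::'a. cball (0::'k) (norm x)))"
    by (simp add: euclidean_product_topology)
  have "closed ((\<Inter>x y. {\<phi>::'a \<Rightarrow> 'k. \<phi> (x + y) = \<phi> x + \<phi> y}) \<inter> (\<Inter>c x. {\<phi>. \<phi> (smul c x) = c * \<phi> x}))"
    by (intro closed_Int closed_INT ballI closed_Collect_eq continuous_intros co)
  from compact_Int_closed[OF c this] show ?thesis
  proof (rule back_subst[of compact])
    show "PiE UNIV (\<lambda>x. cball 0 (norm x)) \<inter>
      ((\<Inter>x y. {\<phi>. \<phi> (x + y) = \<phi> x + \<phi> y}) \<inter> (\<Inter>c x. {\<phi>. \<phi> (smul c x) = c * \<phi> x})) = dual_ball smul"
      by (auto simp: dual_ball_iff PiE_def Pi_def)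
  qed
qed

text \<open>The cone is generated by \<open>u v \<le> norm v\<close> and, since \<open>t\<close>
  ranges over all reals, by the equality \<open>u x0 = norm x0\<close>.\<close>

lemma exists_norming_real_functional:
  fixes x0 :: 'a
  obtains u where "\<And>x y. u (x + y) = u x + u y" "\<And>r x. u (r *\<^sub>R x) = r * u x"
    "\<And>x. u x \<le> norm x" "u x0 = norm x0"
proof -
  define G :: "('a \<times> real) set" where "G = {(v + t *\<^sub>R x0, c + t * norm x0) | v t c. norm v \<le> c}"
  have GI: "(v + t *\<^sub>R x0, c + t * norm x0) \<in> G" if "norm v \<le> c" for v t c using that by (auto simp: G_def)
  obtain u where u: "\<And>x y. u (x + y) = u x + u y" "\<And>r x. u (r *\<^sub>R x) = r * u x" "\<And>v c. (v, c) \<in> G \<Longrightarrow> u v \<le> c"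
  proof (rule hahn_banach_cone[of UNIV G])
    show "real_cone G"
      unfolding real_cone_def
    proof (intro conjI allI impI)
      show "(0, 0) \<in> G" using GI[of 0 0 0] by simp
      fix v c assume "(v, c) \<in> G"
      then obtain v1 t1 c1 where 1: "v = v1 + t1 *\<^sub>R x0" "c = c1 + t1 * norm x0" "norm v1 \<le> c1" by (auto simp: G_def)
      show "(v + w, c + d) \<in> G" if wd: "(w, d) \<in> G" for w d
      proof -
        obtain v2 t2 c2 where 2: "w = v2 + t2 *\<^sub>R x0" "d = c2 + t2 * norm x0" "norm v2 \<le> c2" using wd by (auto simp: G_def)
        show ?thesis
          using GI[OF norm_triangle_mono[OF 1(3) 2(3)], of "t1 + t2"] unfolding 1(1,2) 2(1,2) by (simp add: algebra_simps)
      qed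
      show "(t *\<^sub>R v, t * c) \<in> G" if "t > 0" for t :: real
      proof -
        have "norm (t *\<^sub>R v1) \<le> t * c1" using 1(3) that by simp
        from GI[OF this, of "t * t1"] show ?thesis unfolding 1(1,2) by (simp add: algebra_simps)
      qed
    qed
    show "c \<ge> 0" if c: "(0, c) \<in> G" for c
    proof -
      obtain v t c1 where 1: "v + t *\<^sub>R x0 = 0" "c = c1 + t * norm x0" "norm v \<le> c1" using c by (auto simp: G_def)
      then have "norm v = \<bar>t\<bar> * norm x0" by (metis add_eq_0_iff norm_minus_cancel norm_scaleR)
      moreover have "- t * norm x0 \<le> \<bar>t\<bar> * norm x0" by (intro mult_right_mono) auto
      ultimately show ?thesis using 1 by simp
    qed
    show "\<exists>c. (v, c) \<in> G" for v using GI[of v "norm v" 0] by auto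
  qed auto
  show thesis
  proof (rule that[of u])
    show le: "u x \<le> norm x" for x using u(3) GI[of x "norm x" 0] by simp
    have "u (- x0) \<le> - norm x0" using u(3) GI[of 0 0 "- 1"] by simp
    moreover have "u (- x0) = - u x0" using u(2)[of "- 1" x0] by simp
    ultimately show "u x0 = norm x0" using le[of x0] by simp
  qed (use u in auto)
qed

text \<open>A norming real functional becomes scalar valued through
  \<open>real_functional_scalar\<close>; rotating the argument transfers its norm bound. Some sphere
  element is required even to represent the zero polynomial, since representations are infinite
  sequences in the sphere.\<close>

lemma dual_sphere_nonempty:
  assumes "\<exists>x::'a. x \<noteq> 0"
  obtains \<phi> where "\<phi> \<in> dual_sphere smul"
proof -
  obtain x0 :: 'a where "x0 \<noteq> 0" using assms by blast
  obtain u where u: "\<And>x y. u (x + y) = u x + u y" "\<And>r x. u (r *\<^sub>R x) = r * u x"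
    "\<And>x. u x \<le> norm x" "u x0 = norm x0"
    using exists_norming_real_functional[of x0] by blast
  have ex1: "\<exists>!d. \<forall>c. u (smul c x) = (c * d) \<bullet> 1" for x
  proof (rule real_functional_scalar)
    show "u (smul (a + b) x) = u (smul a x) + u (smul b x)" for a b by (simp add: scale_left_distrib u(1))
    show "u (smul (r *\<^sub>R a) x) = r * u (smul a x)" for r a
      unfolding scaleR_conv_of_real scale_scale[symmetric] smul_of_real by (rule u(2))
  qed
  define \<phi> where "\<phi> x = (THE d. \<forall>c. u (smul c x) = (c * d) \<bullet> 1)" for x
  have \<phi>: "u (smul c x) = (c * \<phi> x) \<bullet> 1" for c x
    using theI'[OF ex1[of x]] unfolding \<phi>_def by blast
  have \<phi>I: "\<phi> x = d" if "\<And>c. u (smul c x) = (c * d) \<bullet> 1" for x d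
    using ex1[of x] \<phi>[of _ x] that by blast
  have ball: "\<phi> \<in> dual_ball smul"
    unfolding dual_ball_iff
  proof (intro conjI allI)
    show "\<phi> (x + y) = \<phi> x + \<phi> y" for x y
      by (rule \<phi>I) (simp add: scale_right_distrib u(1) \<phi> distrib_left inner_add_left)
    show "\<phi> (smul a x) = a * \<phi> x" for a x
      by (rule \<phi>I) (simp add: \<phi> mult.assoc)
    show "norm (\<phi> x) \<le> norm x" for x
    proof -
      obtain v where v: "norm v = 1" "(v * \<phi> x) \<bullet> 1 = norm (\<phi> x)" by (rule rotate_to_real)
      then have "norm (\<phi> x) = u (smul v x)" by (simp add: \<phi>)
      also have "\<dots> \<le> norm (smul v x)" by (rule u(3))
      finally show ?thesis using v by (simp add: norm_smul)
    qed
  qed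
  have bl: "bounded_linear \<phi>" using ball by (simp add: dual_ball_def dual_space_def)
  have "norm x0 = \<phi> x0 \<bullet> 1" using \<phi>[of 1 x0] u(4) by simp
  also have "\<dots> \<le> norm (\<phi> x0)" using norm_cauchy_schwarz[of "\<phi> x0" 1] by simp
  also have "\<dots> \<le> onorm \<phi> * norm x0" by (rule onorm[OF bl])
  finally have "1 \<le> onorm \<phi>" using \<open>x0 \<noteq> 0\<close> by simp
  then have "\<phi> \<in> dual_sphere smul" using ball by (auto simp: dual_sphere_def dual_ball_def)
  then show thesis by (rule that)
qed

end

section \<open>The symmetric injective tensor product as a function space\<close>

lemma prod_list_update:
  fixes ys :: "'k::comm_monoid_mult list"
  assumes "i < length ys"
  shows "prod_list (ys[i := a]) = a * (prod_list (take i ys) * prod_list (drop (Suc i) ys))"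
  using assms by (simp add: upd_conv_take_nth_drop mult_ac)

lemma sum_lessThan_add:
  fixes f :: "nat \<Rightarrow> 'a::comm_monoid_add"
  shows "(\<Sum>j<m + n. f j) = (\<Sum>j<m. f j) + (\<Sum>j<n. f (m + j))"
  by (induction n) (auto simp: add_ac)

text \<open>On the zero space the dual sphere is empty and no nuclear representation exists;
  \<open>nonzero\<close> rules this out.\<close>

locale polynomial_space = banach_space_over smul
  for smul :: "'k::real_or_complex \<Rightarrow> 'a::banach \<Rightarrow> 'a" +
  fixes N :: nat
  assumes nonzero: "\<exists>x::'a. x \<noteq> 0"
begin

abbreviation K :: "('a \<Rightarrow> 'k) set" where "K \<equiv> dual_ball smul"
abbreviation Y :: "(('a \<Rightarrow> 'k) \<Rightarrow> 'k) set" where "Y \<equiv> sym_inj_tensor_product smul N"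

definition pow :: "'a \<Rightarrow> ('a \<Rightarrow> 'k) \<Rightarrow> 'k" where
  "pow x \<phi> = (if \<phi> \<in> K then \<phi> x ^ N else 0)"

definition power_sums :: "(('a \<Rightarrow> 'k) \<Rightarrow> 'k) set" where
  "power_sums = {z. \<exists>(m::nat) c x. z = (\<lambda>\<phi>. \<Sum>j<m. c j * pow (x j) \<phi>)}"

text \<open>Ensures that evaluating a tensor at a power form never meets the default value 0 in
  \<open>tensor_power\<close>.\<close>

lemma power_form_multilinear:
  assumes "\<phi> \<in> K"
  shows "(\<lambda>xs. prod_list (map \<phi> xs)) \<in> multilinear_forms smul n"
  unfolding multilinear_forms_def
proof (safe)
  fix xs :: "'a list" and i assume i: "i < length xs"
  have "vector_space smul" by unfold_locales
  moreover have "vector_space ((*) :: 'k \<Rightarrow> 'k \<Rightarrow> 'k)" by unfold_locales (auto simp: algebra_simps)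
  ultimately show "Vector_Spaces.linear smul (*) (\<lambda>v. prod_list (map \<phi> (xs[i := v])))"
    using assms i unfolding Vector_Spaces.linear_iff
    by (simp add: map_update prod_list_update dual_ball_iff algebra_simps)
qed

lemma ball_function_tensor_power: "ball_function smul (tensor_power smul N x) = pow x"
  using power_form_multilinear by (auto simp: ball_function_def tensor_power_def pow_def fun_eq_iff)

lemma ball_function_sum:
  "ball_function smul (\<lambda>A. \<Sum>j<m. c j * tensor_power smul N (x j) A) = (\<lambda>\<phi>. \<Sum>j<(m::nat). c j * pow (x j) \<phi>)"
  unfolding ball_function_tensor_power[symmetric] by (auto simp: ball_function_def fun_eq_iff)

lemma power_sums_eq: "power_sums = ball_function smul ` sym_tensors smul N"
proof (intro equalityI subsetI)
  fix z assume "z \<in> power_sums"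
  then obtain m c x where "z = (\<lambda>\<phi>. \<Sum>j<(m::nat). c j * pow (x j) \<phi>)" by (auto simp: power_sums_def)
  then show "z \<in> ball_function smul ` sym_tensors smul N"
    unfolding ball_function_sum[symmetric] by (auto simp: sym_tensors_def)
next
  fix z assume "z \<in> ball_function smul ` sym_tensors smul N"
  then obtain m c x where "z = ball_function smul (\<lambda>A. \<Sum>j<(m::nat). c j * tensor_power smul N (x j) A)"
    by (auto simp: sym_tensors_def)
  then show "z \<in> power_sums" unfolding ball_function_sum power_sums_def by blast
qed

lemma mem_Y_iff: "f \<in> Y \<longleftrightarrow> (\<forall>\<phi>. \<phi> \<notin> K \<longrightarrow> f \<phi> = 0) \<and> (\<forall>\<epsilon>>0. \<exists>z\<in>power_sums. \<forall>\<phi>\<in>K. norm (z \<phi> - f \<phi>) < \<epsilon>)"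
proof
  assume "f \<in> Y"
  then obtain z where z: "\<And>n. z n \<in> sym_tensors smul N" "uniform_limit K (\<lambda>n. ball_function smul (z n)) f sequentially"
    and off: "\<forall>\<phi>. \<phi> \<notin> K \<longrightarrow> f \<phi> = 0"
    unfolding sym_inj_tensor_product_def by blast
  have "\<exists>z\<in>power_sums. \<forall>\<phi>\<in>K. norm (z \<phi> - f \<phi>) < \<epsilon>" if "\<epsilon> > 0" for \<epsilon> :: real
  proof -
    have "\<forall>\<^sub>F n in sequentially. \<forall>\<phi>\<in>K. dist (ball_function smul (z n) \<phi>) (f \<phi>) < \<epsilon>"
      using uniform_limitD[OF z(2) that] .
    then obtain n where "\<forall>\<phi>\<in>K. dist (ball_function smul (z n) \<phi>) (f \<phi>) < \<epsilon>"
      using eventually_happens'[OF sequentially_bot] by blast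
    then show ?thesis using z(1)[of n] by (intro bexI[of _ "ball_function smul (z n)"]) (auto simp: dist_norm power_sums_eq)
  qed
  then show "(\<forall>\<phi>. \<phi> \<notin> K \<longrightarrow> f \<phi> = 0) \<and> (\<forall>\<epsilon>>0. \<exists>z\<in>power_sums. \<forall>\<phi>\<in>K. norm (z \<phi> - f \<phi>) < \<epsilon>)"
    using off by blast
next
  assume R: "(\<forall>\<phi>. \<phi> \<notin> K \<longrightarrow> f \<phi> = 0) \<and> (\<forall>\<epsilon>>0. \<exists>z\<in>power_sums. \<forall>\<phi>\<in>K. norm (z \<phi> - f \<phi>) < \<epsilon>)"
  have "\<exists>z\<in>sym_tensors smul N. \<forall>\<phi>\<in>K. norm (ball_function smul z \<phi> - f \<phi>) < inverse (real (Suc n))" for n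
  proof -
    have "inverse (real (Suc n)) > 0" by simp
    then have "\<exists>z\<in>power_sums. \<forall>\<phi>\<in>K. norm (z \<phi> - f \<phi>) < inverse (real (Suc n))" using R by blast
    then show ?thesis unfolding power_sums_eq by blast
  qed
  then obtain z where z: "\<And>n. z n \<in> sym_tensors smul N"
    "\<And>n \<phi>. \<phi> \<in> K \<Longrightarrow> norm (ball_function smul (z n) \<phi> - f \<phi>) < inverse (real (Suc n))" by metis
  have "uniform_limit K (\<lambda>n. ball_function smul (z n)) f sequentially"
    by (rule uniform_limit_inverse_Suc) (use z(2) in \<open>simp only: dist_norm\<close>)
  then show "f \<in> Y" using z(1) R unfolding sym_inj_tensor_product_def by blast
qed

lemma power_sums_lin:
  assumes "z \<in> power_sums" "w \<in> power_sums"
  shows "(\<lambda>\<phi>. c * z \<phi> + w \<phi>) \<in> power_sums"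
proof -
  obtain m a x where z: "z = (\<lambda>\<phi>. \<Sum>j<(m::nat). a j * pow (x j) \<phi>)" using assms(1) by (auto simp: power_sums_def)
  obtain n b y where w: "w = (\<lambda>\<phi>. \<Sum>j<(n::nat). b j * pow (y j) \<phi>)" using assms(2) by (auto simp: power_sums_def)
  define d where "d j = (if j < m then c * a j else b (j - m))" for j
  define u where "u j = (if j < m then x j else y (j - m))" for j
  have "(\<lambda>\<phi>. c * z \<phi> + w \<phi>) = (\<lambda>\<phi>. \<Sum>j<m + n. d j * pow (u j) \<phi>)"
    unfolding sum_lessThan_add z w by (simp add: d_def u_def sum_distrib_left mult.assoc)
  then show ?thesis unfolding power_sums_def by blast
qed

lemma pow_in_power_sums: "pow x \<in> power_sums"
  unfolding power_sums_def by (rule CollectI, intro exI[of _ 1] exI[of _ "\<lambda>_. 1"] exI[of _ "\<lambda>_. x"]) auto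

lemma pow_continuous: "continuous_on K (pow x)"
proof (rule continuous_on_cong[THEN iffD2, OF refl])
  show "continuous_on K (\<lambda>\<phi>. \<phi> x ^ N)"
    by (intro continuous_intros continuous_on_subset[OF continuous_on_product_coordinates]) auto
qed (simp add: pow_def)

lemma power_sums_continuous: "z \<in> power_sums \<Longrightarrow> continuous_on K z"
  unfolding power_sums_def by (auto intro!: continuous_intros pow_continuous)

lemma power_sums_subset: "power_sums \<subseteq> Y"
proof
  fix z assume z: "z \<in> power_sums"
  then have "z \<phi> = 0" if "\<phi> \<notin> K" for \<phi> using that by (auto simp: power_sums_def pow_def)
  then show "z \<in> Y" unfolding mem_Y_iff using z by (auto intro!: bexI[of _ z])
qed

sublocale function_space K Y
proof
  show "compact K" by (rule compact_dual_ball)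
  show "K \<noteq> {}" using zero_in_dual_ball by blast
  show "(\<lambda>_. 0) \<in> Y" using power_sums_subset unfolding power_sums_def by (force intro: exI[of _ 0])
  show "f \<phi> = 0" if "f \<in> Y" "\<phi> \<notin> K" for f \<phi> using that by (simp add: mem_Y_iff)
  show "continuous_on K f" if "f \<in> Y" for f
  proof -
    have "\<forall>n. \<exists>z\<in>power_sums. \<forall>\<phi>\<in>K. norm (z \<phi> - f \<phi>) < inverse (real (Suc n))"
      using that unfolding mem_Y_iff by simp
    then obtain z where z: "\<And>n. z n \<in> power_sums" "\<And>n \<phi>. \<phi> \<in> K \<Longrightarrow> norm (z n \<phi> - f \<phi>) < inverse (real (Suc n))" by metis
    show ?thesis
    proof (rule uniform_limit_theorem)
      show "\<forall>\<^sub>F n in sequentially. continuous_on K (z n)" using z(1) power_sums_continuous by simp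
      show "uniform_limit K z f sequentially"
        by (rule uniform_limit_inverse_Suc) (use z(2) in \<open>simp only: dist_norm\<close>)
    qed simp
  qed
  show "(\<lambda>t. c * f t + g t) \<in> Y" if f: "f \<in> Y" and g: "g \<in> Y" for f g c
    unfolding mem_Y_iff
  proof (intro conjI allI impI)
    fix \<epsilon> :: real assume \<epsilon>: "\<epsilon> > 0"
    define d where "d = \<epsilon> / (norm c + 1)"
    have c1: "norm c + 1 > 0" by (simp add: add_nonneg_pos)
    have d: "d > 0" "(norm c + 1) * d = \<epsilon>" using \<epsilon> c1 by (auto simp: d_def)
    obtain z where z: "z \<in> power_sums" "\<forall>\<phi>\<in>K. norm (z \<phi> - f \<phi>) < d" using f d unfolding mem_Y_iff by blast
    obtain w where w: "w \<in> power_sums" "\<forall>\<phi>\<in>K. norm (w \<phi> - g \<phi>) < d" using g d unfolding mem_Y_iff by blast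
    have "norm ((c * z \<phi> + w \<phi>) - (c * f \<phi> + g \<phi>)) < \<epsilon>" if "\<phi> \<in> K" for \<phi>
    proof -
      have "(c * z \<phi> + w \<phi>) - (c * f \<phi> + g \<phi>) = c * (z \<phi> - f \<phi>) + (w \<phi> - g \<phi>)" by (simp add: algebra_simps)
      also have "norm \<dots> \<le> norm c * norm (z \<phi> - f \<phi>) + norm (w \<phi> - g \<phi>)"
        by (rule order_trans[OF norm_triangle_ineq]) (simp add: norm_mult)
      also have "\<dots> \<le> norm c * d + norm (w \<phi> - g \<phi>)"
        using z(2) that by (intro add_right_mono mult_left_mono) (auto intro: less_imp_le)
      also have "\<dots> < norm c * d + d" using w(2) that by simp
      also have "\<dots> = \<epsilon>" using d by (simp add: algebra_simps)
      finally show ?thesis .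
    qed
    then show "\<exists>z\<in>power_sums. \<forall>\<phi>\<in>K. norm (z \<phi> - (c * f \<phi> + g \<phi>)) < \<epsilon>"
      using power_sums_lin[OF z(1) w(1), of c] by (intro bexI[of _ "\<lambda>\<phi>. c * z \<phi> + w \<phi>"]) auto
  qed (use f g in \<open>simp add: mem_Y_iff\<close>)
  show "f \<in> Y" if F: "\<And>n. F n \<in> Y" and lim: "uniform_limit K F f sequentially" and off: "\<And>\<phi>. \<phi> \<notin> K \<Longrightarrow> f \<phi> = 0" for F f
    unfolding mem_Y_iff
  proof (intro conjI allI impI off)
    fix \<epsilon> :: real assume \<epsilon>: "\<epsilon> > 0"
    obtain n where n: "\<forall>\<phi>\<in>K. dist (F n \<phi>) (f \<phi>) < \<epsilon> / 2"
      using eventually_happens'[OF sequentially_bot uniform_limitD[OF lim half_gt_zero[OF \<epsilon>]]] by blast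
    obtain z where z: "z \<in> power_sums" "\<forall>\<phi>\<in>K. norm (z \<phi> - F n \<phi>) < \<epsilon> / 2"
      using F[of n] half_gt_zero[OF \<epsilon>] unfolding mem_Y_iff by blast
    have "norm (z \<phi> - f \<phi>) < \<epsilon>" if "\<phi> \<in> K" for \<phi>
      using n z(2) that norm_triangle_lt[of "z \<phi> - F n \<phi>" "F n \<phi> - f \<phi>" \<epsilon>] by (force simp: dist_norm)
    then show "\<exists>z\<in>power_sums. \<forall>\<phi>\<in>K. norm (z \<phi> - f \<phi>) < \<epsilon>" using z(1) by blast
  qed
qed

lemma nrm_eq: "nrm = ball_norm smul"
  by (simp add: fun_eq_iff nrm_def ball_norm_def)

lemma functional_iff: "functional L \<longleftrightarrow> L \<in> sym_inj_functionals smul N"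
  by (simp add: functional_def sym_inj_functionals_def nrm_eq)

lemma pow_in_Y: "pow x \<in> Y"
  using pow_in_power_sums power_sums_subset by blast

text \<open>Agreement on powers extends to power sums, which are uniformly dense in
  \<open>Y\<close>. This makes \<open>pairing\<close> well defined.\<close>

lemma functional_ext:
  assumes L: "functional L" and M: "functional M" and eq: "\<And>x. L (pow x) = M (pow x)" and f: "f \<in> Y"
  shows "L f = M f"
proof -
  have D: "functional (\<lambda>g. L g - M g)" by (rule functional_minus[OF L M])
  obtain C where C: "C \<ge> 0" "\<And>g. g \<in> Y \<Longrightarrow> norm (L g - M g) \<le> C * nrm g" using functional_bound[OF D] by blast
  have "norm (L f - M f) \<le> 0 + \<epsilon>" if \<epsilon>: "\<epsilon> > 0" for \<epsilon>
  proof -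
    have "\<epsilon> / (C + 1) > 0" using \<epsilon> C by simp
    then obtain z where z: "z \<in> power_sums" "\<forall>\<phi>\<in>K. norm (z \<phi> - f \<phi>) < \<epsilon> / (C + 1)"
      using f unfolding mem_Y_iff by blast
    have zY: "z \<in> Y" using z power_sums_subset by blast
    obtain m c x where zz: "z = (\<lambda>\<phi>. \<Sum>j<(m::nat). c j * pow (x j) \<phi>)" using z(1) by (auto simp: power_sums_def)
    have val: "H z = (\<Sum>j<m. c j * H (pow (x j)))" if "functional H" for H
      unfolding zz using functional_sum[OF that, of "{..<m}" "\<lambda>j \<phi>. c j * pow (x j) \<phi>"]
        functional_scale[OF that pow_in_Y] scale[OF pow_in_Y] by simp
    have "L z - M z = 0" using val[OF L] val[OF M] eq by simp
    then have "L f - M f = (L f - M f) - (L z - M z)" by simp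
    also have "\<dots> = L (\<lambda>\<phi>. f \<phi> - z \<phi>) - M (\<lambda>\<phi>. f \<phi> - z \<phi>)" using functional_diff[OF D f zY] by simp
    finally have "norm (L f - M f) \<le> C * nrm (\<lambda>\<phi>. f \<phi> - z \<phi>)" using C(2)[OF diff[OF f zY]] by simp
    also have "\<dots> \<le> C * (\<epsilon> / (C + 1))"
      using z(2) C(1) by (intro mult_left_mono nrm_le) (auto simp: norm_minus_commute less_imp_le)
    also have "\<dots> \<le> \<epsilon>" using C \<epsilon> by (simp add: field_simps)
    finally show ?thesis by simp
  qed
  then have "norm (L f - M f) \<le> 0" by (rule field_le_epsilon)
  then show ?thesis by simp
qed

lemma pairing_eq:
  assumes L: "functional L" and P: "\<And>x. L (pow x) = P x" and f: "f \<in> Y"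
  shows "pairing smul N P f = L f"
  unfolding pairing_def ball_function_tensor_power
proof (rule the_equality)
  show "\<exists>M\<in>sym_inj_functionals smul N. (\<forall>x. M (pow x) = P x) \<and> M f = L f"
    using L P by (auto simp: functional_iff)
  fix v assume "\<exists>M\<in>sym_inj_functionals smul N. (\<forall>x. M (pow x) = P x) \<and> M f = v"
  then obtain M where "functional M" "\<And>x. M (pow x) = P x" "M f = v" by (auto simp: functional_iff)
  then show "v = L f" using functional_ext[OF _ L _ f, of M] P by simp
qed

end

section \<open>Radon measures on the dual ball\<close>

lemma norm_le_variation:
  assumes "A \<in> sets M" "E \<in> sets M" "A \<subseteq> E"
  shows "ennreal (norm (\<mu> A)) \<le> variation M \<mu> E"
proof -
  let ?P = "{A, E - A}"
  have "ennreal (norm (\<mu> A)) \<le> (\<Sum>B\<in>?P. ennreal (norm (\<mu> B)))"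
    by (rule member_le_sum) auto
  also have "\<dots> \<le> variation M \<mu> E"
    unfolding variation_def by (rule SUP_upper) (use assms in \<open>auto simp: disjoint_def\<close>)
  finally show ?thesis .
qed

lemma has_scalar_integral_cong:
  assumes "\<And>x. x \<in> space M \<Longrightarrow> f x = g x"
  shows "has_scalar_integral M \<mu> f a \<longleftrightarrow> has_scalar_integral M \<mu> g a"
proof -
  have "uniform_limit (space M) s f F \<longleftrightarrow> uniform_limit (space M) s g F" for s and F :: "nat filter"
    by (rule uniform_limit_cong') (use assms in auto)
  then show ?thesis by (simp add: has_scalar_integral_def)
qed

lemma closed_singleton_fun: "closed {\<phi> :: 'i \<Rightarrow> 'k::t2_space}"
proof -
  have "{\<phi>} = (\<Inter>x. {\<psi>. \<psi> x = \<phi> x})" by auto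
  moreover have "closed (\<Inter>x. {\<psi>. \<psi> x = \<phi> x})"
    by (intro closed_INT ballI closed_Collect_eq continuous_on_const continuous_on_product_coordinates)
  ultimately show ?thesis by simp
qed

lemma closed_finite_fun:
  assumes "finite (S :: ('i \<Rightarrow> 'k::t2_space) set)"
  shows "closed S"
proof -
  have "closed (\<Union>\<phi>\<in>S. {\<phi>})" by (rule closed_UN[OF assms]) (rule ballI, rule closed_singleton_fun)
  then show ?thesis by simp
qed

lemma ennreal_real_below:
  assumes "(0::ennreal) < \<epsilon>"
  obtains e where "e > 0" "ennreal e \<le> \<epsilon>"
proof (cases \<epsilon>)
  case (real r)
  then show ?thesis using assms that[of r] by simp
next
  case top
  then show ?thesis using that[of 1] by simp
qed

context polynomial_space
begin

abbreviation B :: "('a \<Rightarrow> 'k) measure" where "B \<equiv> dual_ball_borel smul"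

lemma space_B: "space B = K"
  by (simp add: dual_ball_borel_def space_restrict_space)

lemma open_in_sets_B: "open T \<Longrightarrow> K \<inter> T \<in> sets B"
  by (auto simp: dual_ball_borel_def sets_restrict_space)

lemma singleton_in_sets_B:
  assumes "\<phi> \<in> K"
  shows "{\<phi>} \<in> sets B"
proof -
  have "K - K \<inter> - {\<phi>} \<in> sets B"
    using sets.compl_sets[OF open_in_sets_B[OF open_Compl[OF closed_singleton_fun]]] unfolding space_B .
  moreover have "K - K \<inter> - {\<phi>} = {\<phi>}" using assms by auto
  ultimately show ?thesis by simp
qed

text \<open>Outer regularity at points gives every point an open neighbourhood on which the measure is bounded;
  compactness does the rest.\<close>

lemma radon_measure_bounded:
  assumes "radon_measure smul \<mu>"
  obtains b where "\<And>A. A \<in> sets B \<Longrightarrow> norm (\<mu> A) \<le> b"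
proof -
  have \<mu>: "scalar_measure B \<mu>" using assms by (simp add: radon_measure_def)
  have "\<exists>T. open T \<and> \<phi> \<in> T \<and> (\<forall>A\<in>sets B. A \<subseteq> T \<longrightarrow> norm (\<mu> A) \<le> 1 + norm (\<mu> {\<phi>}))" if \<phi>: "\<phi> \<in> K" for \<phi>
  proof -
    have reg: "\<forall>E\<in>sets B. \<forall>\<epsilon>>0. \<exists>K' U. compactin (top_of_set K) K' \<and> openin (top_of_set K) U \<and>
        K' \<subseteq> E \<and> E \<subseteq> U \<and> variation B \<mu> (U - K') < \<epsilon>"
      using assms by (simp add: radon_measure_def)
    obtain K' U where KU: "openin (top_of_set K) U" "K' \<subseteq> {\<phi>}" "{\<phi>} \<subseteq> U" "variation B \<mu> (U - K') < 1"
      using reg[rule_format, OF singleton_in_sets_B[OF \<phi>], of 1] by auto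
    obtain T where T: "open T" "U = K \<inter> T" using KU(1) unfolding openin_open by blast
    \<comment> \<open>Inside a singleton the inner compact set is trivial. So \<open>U\<close> with
      at most the point \<open>\<phi>\<close> removed has variation below 1, and the point itself
      adds at most its own mass.\<close>
    have K'_cases: "K' = {} \<or> K' = {\<phi>}" using KU(2) by blast
    have K': "K' \<in> sets B" using K'_cases singleton_in_sets_B[OF \<phi>] by auto
    have "norm (\<mu> A) \<le> 1 + norm (\<mu> {\<phi>})" if A: "A \<in> sets B" "A \<subseteq> T" for A
    proof -
      have AU: "A \<subseteq> U" using sets.sets_into_space[OF A(1)] A(2) T(2) by (auto simp: space_B)
      have "ennreal (norm (\<mu> (A - K'))) \<le> variation B \<mu> (U - K')"
        by (rule norm_le_variation) (use A K' T open_in_sets_B AU in auto)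
      then have "ennreal (norm (\<mu> (A - K'))) < 1" using KU(4) by (rule le_less_trans)
      then have "norm (\<mu> (A - K')) \<le> 1" by simp
      moreover have "norm (\<mu> (A \<inter> K')) \<le> norm (\<mu> {\<phi>})"
      proof -
        have "A \<inter> K' = {} \<or> A \<inter> K' = {\<phi>}" using KU(2) by blast
        then show ?thesis using scalar_measure_empty[OF \<mu>] by auto
      qed
      moreover have "\<mu> A = \<mu> (A - K') + \<mu> (A \<inter> K')"
      proof -
        have "(A - K') \<union> (A \<inter> K') = A" by auto
        then show ?thesis using scalar_measure_Un[OF \<mu>, of "A - K'" "A \<inter> K'"] A K' by auto
      qed
      ultimately show ?thesis using norm_triangle_ineq[of "\<mu> (A - K')" "\<mu> (A \<inter> K')"] by simp
    qed
    then show ?thesis using T KU(3) by blast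
  qed
  then obtain T where T: "\<And>\<phi>. \<phi> \<in> K \<Longrightarrow> open (T \<phi>) \<and> \<phi> \<in> T \<phi> \<and>
      (\<forall>A\<in>sets B. A \<subseteq> T \<phi> \<longrightarrow> norm (\<mu> A) \<le> 1 + norm (\<mu> {\<phi>}))" by metis
  obtain C where C: "C \<subseteq> K" "finite C" "K \<subseteq> (\<Union>\<phi>\<in>C. T \<phi>)"
    by (rule compactE_image[OF compact, of K T]) (use T in auto)
  have bound: "norm (\<mu> A) \<le> (\<Sum>\<phi>\<in>C. 1 + norm (\<mu> {\<phi>}))" if "A \<in> sets B" "A \<subseteq> (\<Union>\<phi>\<in>C. T \<phi>)" for A
    using C(2,1) that
  proof (induction C arbitrary: A rule: finite_induct)
    case empty
    then show ?case using scalar_measure_empty[OF \<mu>] by simp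
  next
    case (insert \<phi> C)
    have \<phi>: "\<phi> \<in> K" using insert.prems by simp
    have sub: "A \<subseteq> K" using sets.sets_into_space[OF insert.prems(2)] by (simp add: space_B)
    have "A \<inter> (K \<inter> T \<phi>) \<in> sets B"
      using T[OF \<phi>] by (intro sets.Int[OF insert.prems(2)] open_in_sets_B) blast
    moreover have eq: "A \<inter> (K \<inter> T \<phi>) = A \<inter> T \<phi>" using sub by auto
    ultimately have m1: "A \<inter> T \<phi> \<in> sets B" by simp
    then have m2: "A - A \<inter> T \<phi> \<in> sets B" using insert.prems(2) by (intro sets.Diff)
    have "norm (\<mu> (A \<inter> T \<phi>)) \<le> 1 + norm (\<mu> {\<phi>})" using T[OF \<phi>] m1 by blast
    moreover have "norm (\<mu> (A - A \<inter> T \<phi>)) \<le> (\<Sum>\<phi>\<in>C. 1 + norm (\<mu> {\<phi>}))"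
      by (rule insert.IH) (use insert.prems m2 in auto)
    moreover have "\<mu> A = \<mu> (A \<inter> T \<phi>) + \<mu> (A - A \<inter> T \<phi>)"
    proof -
      have "(A \<inter> T \<phi>) \<union> (A - A \<inter> T \<phi>) = A" by auto
      then show ?thesis using scalar_measure_Un[OF \<mu> m1 m2] by auto
    qed
    ultimately show ?case
      using norm_triangle_ineq[of "\<mu> (A \<inter> T \<phi>)" "\<mu> (A - A \<inter> T \<phi>)"] insert.hyps by simp
  qed
  have "norm (\<mu> A) \<le> (\<Sum>\<phi>\<in>C. 1 + norm (\<mu> {\<phi>}))" if "A \<in> sets B" for A
    by (rule bound[OF that]) (use sets.sets_into_space[OF that] C(3) in \<open>auto simp: space_B\<close>)
  then show thesis by (rule that)
qed

text \<open>The functional is integration against a representing measure, which is bounded by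
  \<open>radon_measure_bounded\<close>. The resulting constant is not sharp; any finite bound
  suffices here.\<close>

lemma integral_polynomial_functional:
  assumes "P \<in> integral_polynomials smul N"
  obtains L where "functional L" "\<And>x. L (pow x) = P x"
proof -
  obtain \<mu> where \<mu>: "radon_measure smul \<mu>" "\<And>x. has_scalar_integral B \<mu> (\<lambda>\<phi>. \<phi> x ^ N) (P x)"
    using assms by (auto simp: integral_polynomials_def representing_measures_def)
  have sm: "scalar_measure B \<mu>" using \<mu>(1) by (simp add: radon_measure_def)
  obtain b where b: "\<And>A. A \<in> sets B \<Longrightarrow> norm (\<mu> A) \<le> b" using radon_measure_bounded[OF \<mu>(1)] by blast
  define L where "L f = (THE a. has_scalar_integral B \<mu> f a)" for f
  have L_eq: "L f = a" if "has_scalar_integral B \<mu> f a" for f a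
    unfolding L_def using that by (rule the_equality) (rule has_scalar_integral_unique[OF sm b _ that])
  have L: "has_scalar_integral B \<mu> f (L f)" if f: "f \<in> Y" for f
  proof -
    have "f \<in> borel_measurable B"
      unfolding dual_ball_borel_def by (rule borel_measurable_continuous_on_restrict[OF continuous[OF f]])
    moreover have "norm (f x) \<le> nrm f" if "x \<in> space B" for x using norm_le_nrm[OF f] that by (simp add: space_B)
    ultimately obtain a where "has_scalar_integral B \<mu> f a"
      using has_scalar_integral_exists[OF sm b] by blast
    then show ?thesis using L_eq by simp
  qed
  have "functional L"
    unfolding functional_def
  proof (intro conjI ballI allI)
    show "L (\<lambda>t. c * f t + g t) = c * L f + L g" if "f \<in> Y" "g \<in> Y" for f g c
      by (rule L_eq[OF has_scalar_integral_lin[OF sm L L]]) (rule that)+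
    have "norm (L f) \<le> 2 * DIM('k) * b * nrm f" if f: "f \<in> Y" for f
      by (rule has_scalar_integral_bound[OF sm b L[OF f]])
        (use norm_le_nrm[OF f] nrm_nonneg[OF f] in \<open>auto simp: space_B\<close>)
    then show "\<exists>C. \<forall>f\<in>Y. norm (L f) \<le> C * nrm f" by blast
  qed
  moreover have "L (pow x) = P x" for x
  proof (rule L_eq)
    show "has_scalar_integral B \<mu> (pow x) (P x)"
      using \<mu>(2)[of x] by (rule has_scalar_integral_cong[THEN iffD1, rotated]) (simp add: pow_def space_B)
  qed
  ultimately show thesis by (rule that)
qed

text \<open>Finitely many indices \<open>F\<close> carry all but less than \<open>e\<close> of the
  mass. \<open>K'\<close> collects their points inside \<open>E\<close> and \<open>U\<close> avoids
  those outside, so only atoms with index outside \<open>F\<close> can lie in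
  \<open>U - K'\<close>.\<close>

lemma radon_point_measure_sum:
  fixes \<phi> :: "'i \<Rightarrow> 'a \<Rightarrow> 'k"
  assumes c: "(\<lambda>i. norm (c i)) summable_on I" and \<phi>: "\<And>i. i \<in> I \<Longrightarrow> \<phi> i \<in> K"
  shows "radon_measure smul (point_measure_sum I c \<phi>)"
  unfolding radon_measure_def
proof (intro conjI ballI allI impI)
  show "scalar_measure B (point_measure_sum I c \<phi>)" by (rule scalar_measure_point_measure_sum[OF c])
  fix E and \<epsilon> :: ennreal assume E: "E \<in> sets B" and "\<epsilon> > 0"
  then obtain e where e: "e > 0" "ennreal e \<le> \<epsilon>" using ennreal_real_below by blast
  obtain F where F: "finite F" "F \<subseteq> I" "dist (\<Sum>i\<in>F. norm (c i)) (\<Sum>\<^sub>\<infinity>i\<in>I. norm (c i)) \<le> e / 2"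
    using infsum_finite_approximation[OF c half_gt_zero[OF e(1)]] by blast
  have cF: "(\<lambda>i. norm (c i)) summable_on (I - F)" using c by (rule summable_on_subset_banach) auto
  have "F \<union> (I - F) = I" using F(2) by auto
  then have "(\<Sum>\<^sub>\<infinity>i\<in>I. norm (c i)) = (\<Sum>i\<in>F. norm (c i)) + (\<Sum>\<^sub>\<infinity>i\<in>I - F. norm (c i))"
    using infsum_Un_disjoint[OF _ cF, of F] F(1) by auto
  then have tail: "(\<Sum>\<^sub>\<infinity>i\<in>I - F. norm (c i)) < e" using F(3) e(1) by (simp add: dist_real_def)
  define K' where "K' = \<phi> ` F \<inter> E"
  define U where "U = K \<inter> - (\<phi> ` F - E)"
  have "open (- (\<phi> ` F - E))" using F(1) by (intro open_Compl closed_finite_fun) simp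
  then have "openin (top_of_set K) U" unfolding U_def by (rule openin_open_Int)
  moreover have "compactin (top_of_set K) K'"
    using F \<phi> by (intro finite_imp_compactin) (auto simp: K'_def)
  moreover have "E \<subseteq> U" using sets.sets_into_space[OF E] by (auto simp: U_def space_B)
  moreover have "variation B (point_measure_sum I c \<phi>) (U - K') < \<epsilon>"
  proof -
    have "variation B (point_measure_sum I c \<phi>) (U - K') \<le> ennreal (\<Sum>\<^sub>\<infinity>i\<in>{i \<in> I. \<phi> i \<in> U - K'}. norm (c i))"
      by (rule variation_point_measure_sum[OF c])
    also have "\<dots> \<le> ennreal (\<Sum>\<^sub>\<infinity>i\<in>I - F. norm (c i))"
    proof (intro ennreal_leI infsum_mono2 cF)
      show "(\<lambda>i. norm (c i)) summable_on {i \<in> I. \<phi> i \<in> U - K'}" by (rule abs_summable_sub[OF c])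
    qed (auto simp: U_def K'_def)
    also have "\<dots> < ennreal e" using tail e(1) by (simp add: ennreal_less_iff infsum_nonneg)
    finally show ?thesis using e(2) by (rule less_le_trans)
  qed
  ultimately show "\<exists>K' U. compactin (top_of_set K) K' \<and> openin (top_of_set K) U \<and> K' \<subseteq> E \<and> E \<subseteq> U \<and>
      variation B (point_measure_sum I c \<phi>) (U - K') < \<epsilon>"
    by (intro exI[of _ K'] exI[of _ U]) (auto simp: K'_def)
qed

lemma point_measure_sum_representing:
  fixes \<phi> :: "'i \<Rightarrow> 'a \<Rightarrow> 'k"
  assumes c: "(\<lambda>i. norm (c i)) summable_on I" and \<phi>: "\<And>i. i \<in> I \<Longrightarrow> \<phi> i \<in> K"
    and P: "\<And>x. ((\<lambda>i. c i * \<phi> i x ^ N) has_sum P x) I"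
  shows "point_measure_sum I c \<phi> \<in> representing_measures smul N P"
  unfolding representing_measures_def
proof (intro CollectI conjI allI)
  show "radon_measure smul (point_measure_sum I c \<phi>)" by (rule radon_point_measure_sum[OF c \<phi>])
  fix x
  let ?g = "\<lambda>\<phi>::'a \<Rightarrow> 'k. \<phi> x ^ N"
  have bd: "norm (?g \<psi>) \<le> norm x ^ N" if "\<psi> \<in> space B" for \<psi>
    using that by (auto simp: space_B dual_ball_iff norm_power intro!: power_mono)
  have g: "?g \<in> borel_measurable B"
    unfolding dual_ball_borel_def
    by (intro borel_measurable_continuous_on_restrict continuous_intros
        continuous_on_subset[OF continuous_on_product_coordinates]) auto
  obtain s where s: "\<And>n::nat. simple_function B (s n)" "uniform_limit (space B) s ?g sequentially"
    using simple_function_uniform_approx[of ?g B "norm x ^ N"] g bd by blast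
  have "has_scalar_integral B (point_measure_sum I c \<phi>) ?g (\<Sum>\<^sub>\<infinity>i\<in>I. c i * ?g (\<phi> i))"
    by (rule integral_point_measure_sum[where B="norm x ^ N", OF c g _ s]) (use \<phi> bd in \<open>auto simp: space_B\<close>)
  then show "has_scalar_integral B (point_measure_sum I c \<phi>) ?g (P x)" using infsumI[OF P[of x]] by simp
qed

lemma integral_norm_le_sum:
  fixes \<phi> :: "'i \<Rightarrow> 'a \<Rightarrow> 'k"
  assumes c: "(\<lambda>i. norm (c i)) summable_on I" and \<phi>: "\<And>i. i \<in> I \<Longrightarrow> \<phi> i \<in> K"
    and P: "\<And>x. ((\<lambda>i. c i * \<phi> i x ^ N) has_sum P x) I"
  shows "integral_norm smul N P \<le> ennreal (\<Sum>\<^sub>\<infinity>i\<in>I. norm (c i))"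
proof -
  have "integral_norm smul N P \<le> variation B (point_measure_sum I c \<phi>) K"
    unfolding integral_norm_def by (rule INF_lower[OF point_measure_sum_representing[OF assms]])
  also have "\<dots> \<le> ennreal (\<Sum>\<^sub>\<infinity>i\<in>{i \<in> I. \<phi> i \<in> K}. norm (c i))" by (rule variation_point_measure_sum[OF c])
  also have "{i \<in> I. \<phi> i \<in> K} = I" using \<phi> by auto
  finally show ?thesis .
qed

text \<open>The factor 2 is the sum of the geometric series in \<open>functional_series\<close>; a
  constant factor is harmless for density.\<close>

lemma small_functional_integral_norm:
  assumes no_ell1: "\<not> contains_ell1 Y nrm"
    and L: "functional L" and C: "C > 0" "\<And>g. g \<in> Y \<Longrightarrow> norm (L g) \<le> C * nrm g"
  shows "integral_norm smul N (\<lambda>x. L (pow x)) \<le> ennreal (2 * C)"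
proof -
  obtain S c where S: "\<And>n::nat. finite (S n)" "\<And>n. S n \<subseteq> K" "\<And>n. (\<Sum>t\<in>S n. norm (c n t)) \<le> C / 2 ^ n"
    and sums: "\<And>g. g \<in> Y \<Longrightarrow> (\<lambda>n. \<Sum>t\<in>S n. c n t * g t) sums L g"
    using functional_series[OF no_ell1 L C] by blast
  \<comment> \<open>Indices are pairs of a round and a point, so repetitions across rounds need no
    merging.\<close>
  define I where "I = Sigma UNIV S"
  define d where "d = (\<lambda>(n, t). c n t)"
  have geo: "(\<lambda>n. C / 2 ^ n) sums (2 * C)"
    using sums_mult[OF geometric_sums[of "1 / 2 :: real"], of C] by (simp add: power_divide mult.commute)
  have sn: "summable (\<lambda>n. \<Sum>t\<in>S n. norm (c n t))"
    by (rule summable_comparison_test'[OF sums_summable[OF geo], of 0]) (use S(3) in \<open>auto simp: sum_nonneg\<close>)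
  have hs: "((\<lambda>n. \<Sum>t\<in>S n. norm (c n t)) has_sum (\<Sum>n. \<Sum>t\<in>S n. norm (c n t))) UNIV"
    by (rule sums_nonneg_imp_has_sum[OF summable_sums[OF sn]]) (simp add: sum_nonneg)
  have dsum: "(\<lambda>i. norm (d i)) summable_on I"
    unfolding I_def
  proof (rule summable_on_SigmaI)
    show "((\<lambda>t. norm (d (n, t))) has_sum (\<Sum>t\<in>S n. norm (c n t))) (S n)" for n
      by (simp add: has_sum_finite_iff S d_def)
    show "(\<lambda>n. \<Sum>t\<in>S n. norm (c n t)) summable_on UNIV" using hs by (rule has_sum_imp_summable)
  qed auto
  have total: "(\<Sum>\<^sub>\<infinity>i\<in>I. norm (d i)) \<le> 2 * C"
  proof -
    have "((\<lambda>i. norm (d i)) has_sum (\<Sum>n. \<Sum>t\<in>S n. norm (c n t))) I"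
      unfolding I_def
      by (rule has_sum_SigmaI[OF _ hs]) (use dsum S in \<open>auto simp: has_sum_finite_iff d_def I_def\<close>)
    then have "(\<Sum>\<^sub>\<infinity>i\<in>I. norm (d i)) = (\<Sum>n. \<Sum>t\<in>S n. norm (c n t))" by (rule infsumI)
    also have "\<dots> \<le> (\<Sum>n. C / 2 ^ n)" by (rule suminf_le[OF S(3) sn sums_summable[OF geo]])
    finally show ?thesis using sums_unique[OF geo] by simp
  qed
  have inK: "snd i \<in> K" if "i \<in> I" for i using that S(2)[of "fst i"] by (auto simp: I_def)
  have P: "((\<lambda>i. d i * snd i x ^ N) has_sum L (pow x)) I" for x
  proof -
    have "(\<lambda>i. norm (d i * snd i x ^ N)) summable_on I"
    proof (rule Infinite_Sum.abs_summable_on_comparison_test)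
      show "(\<lambda>i. norm (d i * of_real (norm x ^ N) :: 'k)) summable_on I"
        using summable_on_cmult_left[OF dsum, of "norm x ^ N"] by (simp add: norm_mult norm_power)
      show "norm (d i * snd i x ^ N) \<le> norm (d i * of_real (norm x ^ N) :: 'k)" if "i \<in> I" for i
        using inK[OF that] by (auto simp: dual_ball_iff norm_mult norm_power intro!: mult_left_mono power_mono)
    qed
    then have "(\<lambda>i. d i * snd i x ^ N) summable_on I" by (rule abs_summable_summable)
    then obtain v where v: "((\<lambda>i. d i * snd i x ^ N) has_sum v) I" by (auto simp: summable_on_def)
    \<comment> \<open>Grouping the unconditional sum \<open>v\<close> by rounds yields the series
      for \<open>L (pow x)\<close>, which identifies \<open>v\<close>.\<close>
    have "((\<lambda>n. \<Sum>t\<in>S n. c n t * pow x t) has_sum v) UNIV"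
    proof (rule has_sum_Sigma[OF isUCont_plus v[unfolded I_def]])
      fix n :: nat
      have "(\<Sum>t\<in>S n. c n t * pow x t) = (\<Sum>t\<in>S n. d (n, t) * snd (n, t) x ^ N)"
        using S(2)[of n] by (intro sum.cong) (auto simp: pow_def d_def)
      then show "((\<lambda>t. d (n, t) * snd (n, t) x ^ N) has_sum (\<Sum>t\<in>S n. c n t * pow x t)) (S n)"
        using S(1) by (simp only: has_sum_finite_iff)
    qed
    then have "(\<lambda>n. \<Sum>t\<in>S n. c n t * pow x t) sums v" by (rule has_sum_imp_sums)
    then have "v = L (pow x)" using sums[OF pow_in_Y] by (rule sums_unique2)
    then show ?thesis using v by simp
  qed
  have "integral_norm smul N (\<lambda>x. L (pow x)) \<le> ennreal (\<Sum>\<^sub>\<infinity>i\<in>I. norm (d i))"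
    by (rule integral_norm_le_sum[OF dsum inK P])
  also have "\<dots> \<le> ennreal (2 * C)" using total by (rule ennreal_leI)
  finally show ?thesis .
qed

section \<open>Polynomials attaining their nuclear norm\<close>

lemma norm_prod_list_map_le:
  assumes "\<phi> \<in> K"
  shows "norm (prod_list (map \<phi> xs)) \<le> prod_list (map norm xs)"
proof (induction xs)
  case (Cons x xs)
  have "norm (\<phi> x) \<le> norm x" using assms by (simp add: dual_ball_iff)
  then show ?case using Cons by (simp add: norm_mult mult_mono)
qed simp

lemma homogeneous_polynomial_finite_sum:
  assumes S: "S \<subseteq> K"
  shows "homogeneous_polynomial smul N (\<lambda>x. \<Sum>\<phi>\<in>S. c \<phi> * \<phi> x ^ N)"
  unfolding homogeneous_polynomial_def
proof (rule bexI[of _ "\<lambda>xs. \<Sum>\<phi>\<in>S. c \<phi> * prod_list (map \<phi> xs)"], intro conjI allI)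
  have "norm (\<Sum>\<phi>\<in>S. c \<phi> * prod_list (map \<phi> xs)) \<le> (\<Sum>\<phi>\<in>S. norm (c \<phi>)) * prod_list (map norm xs)" for xs
    unfolding sum_distrib_right
    by (rule order_trans[OF norm_sum sum_mono])
      (use S norm_prod_list_map_le in \<open>auto simp: norm_mult intro!: mult_left_mono\<close>)
  then show "\<exists>C. \<forall>xs. length xs = N \<longrightarrow> norm (\<Sum>\<phi>\<in>S. c \<phi> * prod_list (map \<phi> xs)) \<le> C * prod_list (map norm xs)"
    by blast
  show "(\<lambda>xs. \<Sum>\<phi>\<in>S. c \<phi> * prod_list (map \<phi> xs)) \<in> multilinear_forms smul N"
    unfolding multilinear_forms_def
  proof (intro CollectI allI impI)
    fix xs :: "'a list" and i assume i: "length xs = N" "i < N"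
    have form: "Vector_Spaces.linear smul (*) (\<lambda>v. prod_list (map \<phi> (xs[i := v])))" if "\<phi> \<in> S" for \<phi>
      using power_form_multilinear[of \<phi> N] S that i unfolding multilinear_forms_def by blast
    have "vector_space smul" by unfold_locales
    moreover have "vector_space ((*) :: 'k \<Rightarrow> 'k \<Rightarrow> 'k)" by unfold_locales (auto simp: algebra_simps)
    ultimately show "Vector_Spaces.linear smul (*) (\<lambda>v. \<Sum>\<phi>\<in>S. c \<phi> * prod_list (map \<phi> (xs[i := v])))"
      using form unfolding Vector_Spaces.linear_iff
      by (simp add: sum_distrib_left sum.distrib[symmetric] distrib_left mult.left_commute)
  qed
qed simp

text \<open>Exact for power sums, and an error \<open>d\<close> in the approximation grows at most
  by the factor \<open>1 + norm (a ^ N)\<close>.\<close>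

lemma Y_homogeneous:
  assumes f: "f \<in> Y" and \<psi>: "\<psi> \<in> K" "(\<lambda>x. a * \<psi> x) \<in> K"
  shows "f (\<lambda>x. a * \<psi> x) = a ^ N * f \<psi>"
proof -
  have "norm (f (\<lambda>x. a * \<psi> x) - a ^ N * f \<psi>) \<le> 0 + \<epsilon>" if \<epsilon>: "\<epsilon> > 0" for \<epsilon>
  proof -
    define d where "d = \<epsilon> / (1 + norm (a ^ N))"
    have a1: "1 + norm (a ^ N) > 0" by (simp add: add_pos_nonneg)
    have d: "d > 0" "d * (1 + norm (a ^ N)) = \<epsilon>" using \<epsilon> a1 by (auto simp: d_def)
    obtain z where z: "z \<in> power_sums" "\<forall>\<phi>\<in>K. norm (z \<phi> - f \<phi>) < d" using f d(1) unfolding mem_Y_iff by blast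
    have "z (\<lambda>x. a * \<psi> x) = a ^ N * z \<psi>"
      using z(1) \<psi> by (auto simp: power_sums_def pow_def power_mult_distrib sum_distrib_left mult_ac)
    then have "f (\<lambda>x. a * \<psi> x) - a ^ N * f \<psi> = a ^ N * (z \<psi> - f \<psi>) - (z (\<lambda>x. a * \<psi> x) - f (\<lambda>x. a * \<psi> x))"
      by (simp add: algebra_simps)
    also have "norm \<dots> \<le> norm (a ^ N) * norm (z \<psi> - f \<psi>) + norm (z (\<lambda>x. a * \<psi> x) - f (\<lambda>x. a * \<psi> x))"
      using norm_triangle_ineq4[of "a ^ N * (z \<psi> - f \<psi>)"] by (simp only: norm_mult)
    also have "\<dots> \<le> norm (a ^ N) * d + d"
      using z(2) \<psi> by (intro add_mono mult_left_mono) (auto intro: less_imp_le)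
    finally show ?thesis using d by (simp add: algebra_simps)
  qed
  then have "norm (f (\<lambda>x. a * \<psi> x) - a ^ N * f \<psi>) \<le> 0" by (rule field_le_epsilon)
  then show ?thesis by simp
qed

text \<open>For \<open>N > 0\<close> homogeneity forces a point of the ball where \<open>f\<close> attains its norm to lie on the sphere;
  for \<open>N = 0\<close> any point of the sphere will do.\<close>

lemma peak_on_sphere:
  assumes f: "f \<in> Y" "nrm f \<le> 1" and \<phi>: "\<phi> \<in> K" "norm (f \<phi>) = 1"
  obtains \<psi> where "\<psi> \<in> dual_sphere smul" "\<And>x. \<psi> x ^ N = \<phi> x ^ N"
proof (cases "N = 0")
  case True
  then show thesis using dual_sphere_nonempty[OF nonzero] that by (metis power_0)
next
  case False
  have bl: "bounded_linear \<phi>" and le: "onorm \<phi> \<le> 1" and ds: "\<phi> \<in> dual_space smul"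
    using \<phi>(1) by (auto simp: dual_ball_def dual_space_def)
  have "onorm \<phi> = 1"
  proof (rule ccontr)
    assume "onorm \<phi> \<noteq> 1"
    \<comment> \<open>The lower bound 1/2 permits division also for \<open>\<phi> = 0\<close>. Since
      \<open>\<phi>\<close> divided by \<open>s\<close> is still in the ball, homogeneity gives
      \<open>norm (f \<phi>) \<le> s ^ N < 1\<close>.\<close>
    define s where "s = max (onorm \<phi>) (1 / 2)"
    have s: "0 < s" "s < 1" "onorm \<phi> \<le> s" using le \<open>onorm \<phi> \<noteq> 1\<close> by (auto simp: s_def)
    define \<psi> where "\<psi> x = \<phi> x / of_real s" for x
    have "norm (\<psi> x) \<le> norm x" for x
    proof -
      have "norm (\<phi> x) \<le> onorm \<phi> * norm x" by (rule onorm[OF bl])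
      also have "\<dots> \<le> s * norm x" using s(3) by (rule mult_right_mono) simp
      finally show ?thesis using s(1) by (simp add: \<psi>_def norm_divide field_simps)
    qed
    then have \<psi>: "\<psi> \<in> K" using \<phi>(1) by (auto simp: dual_ball_iff \<psi>_def add_divide_distrib)
    have eq: "(\<lambda>x. of_real s * \<psi> x) = \<phi>" using s(1) by (simp add: \<psi>_def fun_eq_iff)
    have "f \<phi> = of_real s ^ N * f \<psi>" using Y_homogeneous[OF f(1) \<psi>, of "of_real s"] \<phi>(1) by (simp add: eq)
    then have "1 = s ^ N * norm (f \<psi>)" using \<phi>(2) s(1) by (simp add: norm_mult norm_power)
    also have "\<dots> \<le> s ^ N * 1" using norm_le_nrm[OF f(1) \<psi>] f(2) s by (intro mult_left_mono) auto
    also have "\<dots> < 1" using s False by (simp add: power_less_one_iff)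
    finally show False by simp
  qed
  then show thesis using that[of \<phi>] ds by (simp add: dual_sphere_def)
qed

text \<open>Extends a representation from powers to all of \<open>Y\<close>, so that it can be
  evaluated at a certificate \<open>f\<close>, which is in general not a power.\<close>

lemma nuclear_representation_functional:
  assumes "nuclear_representation smul N Q \<psi> d"
  shows "functional (\<lambda>g. \<Sum>i. d i * g (\<psi> i))" "(\<Sum>i. d i * pow x (\<psi> i)) = Q x"
    "g \<in> Y \<Longrightarrow> norm (\<Sum>i. d i * g (\<psi> i)) \<le> (\<Sum>i. norm (d i)) * nrm g"
proof -
  have \<psi>: "\<psi> i \<in> K" for i using assms dual_sphere_subset by (auto simp: nuclear_representation_def)
  have sd: "summable (\<lambda>i. norm (d i))" using assms by (simp add: nuclear_representation_def)
  have le: "norm (d i * g (\<psi> i)) \<le> norm (d i) * nrm g" if "g \<in> Y" for g i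
    using norm_le_nrm[OF that \<psi>] by (simp add: norm_mult mult_left_mono)
  have sm: "summable (\<lambda>i. norm (d i * g (\<psi> i)))" if "g \<in> Y" for g
    by (rule summable_comparison_test'[OF summable_mult2[OF sd, of "nrm g"], of 0]) (use le[OF that] in auto)
  have sm': "summable (\<lambda>i. d i * g (\<psi> i))" if "g \<in> Y" for g using summable_norm_cancel[OF sm[OF that]] .
  have bound: "norm (\<Sum>i. d i * g (\<psi> i)) \<le> (\<Sum>i. norm (d i)) * nrm g" if "g \<in> Y" for g
  proof -
    have "norm (\<Sum>i. d i * g (\<psi> i)) \<le> (\<Sum>i. norm (d i) * nrm g)"
      by (rule norm_suminf_le[OF le[OF that] summable_mult2[OF sd]])
    then show ?thesis by (simp add: suminf_mult2[OF sd])
  qed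
  then show "g \<in> Y \<Longrightarrow> norm (\<Sum>i. d i * g (\<psi> i)) \<le> (\<Sum>i. norm (d i)) * nrm g" .
  show "functional (\<lambda>g. \<Sum>i. d i * g (\<psi> i))"
    unfolding functional_def
  proof (intro conjI ballI allI)
    fix f g c assume fg: "f \<in> Y" "g \<in> Y"
    have "(\<Sum>i. d i * (c * f (\<psi> i) + g (\<psi> i))) = (\<Sum>i. c * (d i * f (\<psi> i)) + d i * g (\<psi> i))"
      by (simp add: algebra_simps)
    also have "\<dots> = c * (\<Sum>i. d i * f (\<psi> i)) + (\<Sum>i. d i * g (\<psi> i))"
      using sm'[OF fg(1)] sm'[OF fg(2)] by (simp add: suminf_add[symmetric] suminf_mult summable_mult)
    finally show "(\<Sum>i. d i * (c * f (\<psi> i) + g (\<psi> i))) = c * (\<Sum>i. d i * f (\<psi> i)) + (\<Sum>i. d i * g (\<psi> i))" .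
  qed (use bound in blast)
  have "(\<lambda>i. d i * \<psi> i x ^ N) sums Q x" using assms by (simp add: nuclear_representation_def)
  then show "(\<Sum>i. d i * pow x (\<psi> i)) = Q x" using \<psi> by (simp add: pow_def sums_unique[symmetric])
qed

lemma peak_sum_polynomial:
  assumes "peak_sum f S c"
  shows "(\<lambda>x. \<Sum>\<phi>\<in>S. c \<phi> * \<phi> x ^ N) \<in> NA_nu smul N" (is "?Q \<in> _")
    and "(\<lambda>x. \<Sum>\<phi>\<in>S. c \<phi> * \<phi> x ^ N) \<in> integral_polynomials smul N"
    and "functional (\<lambda>g. \<Sum>\<phi>\<in>S. c \<phi> * g \<phi>)"
    and "(\<Sum>\<phi>\<in>S. c \<phi> * pow x \<phi>) = (\<Sum>\<phi>\<in>S. c \<phi> * \<phi> x ^ N)"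
proof -
  have f: "f \<in> Y" "nrm f \<le> 1" and S: "finite S" "S \<subseteq> K"
    and peak: "\<And>\<phi>. \<phi> \<in> S \<Longrightarrow> norm (f \<phi>) = 1" "\<And>\<phi>. \<phi> \<in> S \<Longrightarrow> c \<phi> * f \<phi> = of_real (norm (c \<phi>))"
    using assms by (auto simp: peak_sum_def)
  show fS: "functional (\<lambda>g. \<Sum>\<phi>\<in>S. c \<phi> * g \<phi>)" by (rule functional_point_sum[OF S(2)])
  show val: "(\<Sum>\<phi>\<in>S. c \<phi> * pow x \<phi>) = (\<Sum>\<phi>\<in>S. c \<phi> * \<phi> x ^ N)" for x
    using S(2) by (intro sum.cong) (auto simp: pow_def)
  have hom: "homogeneous_polynomial smul N ?Q" by (rule homogeneous_polynomial_finite_sum[OF S(2)])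
  have "point_measure_sum S c (\<lambda>\<phi>. \<phi>) \<in> representing_measures smul N ?Q"
    by (rule point_measure_sum_representing) (use S in \<open>auto simp: has_sum_finite_iff\<close>)
  then show "?Q \<in> integral_polynomials smul N" using hom by (auto simp: integral_polynomials_def)
  obtain \<psi>0 where \<psi>0: "\<psi>0 \<in> dual_sphere smul" by (rule dual_sphere_nonempty[OF nonzero])
  have "\<forall>\<phi>\<in>S. \<exists>\<psi>\<in>dual_sphere smul. \<forall>x. \<psi> x ^ N = \<phi> x ^ N"
    using peak_on_sphere[OF f] S(2) peak(1) by (metis subsetD)
  then obtain \<tau> where \<tau>: "\<And>\<phi>. \<phi> \<in> S \<Longrightarrow> \<tau> \<phi> \<in> dual_sphere smul" "\<And>\<phi> x. \<phi> \<in> S \<Longrightarrow> \<tau> \<phi> x ^ N = \<phi> x ^ N" by metis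
  obtain h where h: "bij_betw h {0..<card S} S" using ex_bij_betw_nat_finite[OF S(1)] by blast
  have hS: "h i \<in> S" if "i < card S" for i using bij_betwE[OF h] that by auto
  \<comment> \<open>The atoms, moved onto the sphere by \<open>\<tau>\<close>, are enumerated and
    padded with a sphere element of coefficient 0 to form an infinite sequence.\<close>
  define \<psi> where "\<psi> i = (if i < card S then \<tau> (h i) else \<psi>0)" for i
  define d where "d i = (if i < card S then c (h i) else 0)" for i
  have sums_h: "(\<lambda>i. F (d i) i) sums (\<Sum>i<card S. F (c (h i)) i)" if "\<And>i. F 0 i = 0" for F :: "'k \<Rightarrow> nat \<Rightarrow> 'z::real_normed_vector"
  proof -
    have "(\<lambda>i. F (d i) i) sums (\<Sum>i<card S. F (d i) i)" by (rule sums_finite) (auto simp: d_def that)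
    then show ?thesis by (simp add: d_def)
  qed
  have reindex: "(\<Sum>i<card S. G (h i)) = (\<Sum>\<phi>\<in>S. G \<phi>)" for G :: "_ \<Rightarrow> 'z::real_normed_vector"
    using sum.reindex_bij_betw[OF h, of G] by (simp add: atLeast0LessThan)
  have norm_sums: "(\<lambda>i. norm (d i)) sums (\<Sum>\<phi>\<in>S. norm (c \<phi>))"
    using sums_h[of "\<lambda>a i. norm a"] reindex[of "\<lambda>\<phi>. norm (c \<phi>)"] by simp
  have rep: "nuclear_representation smul N ?Q \<psi> d"
    unfolding nuclear_representation_def
  proof (intro conjI allI)
    show "\<psi> i \<in> dual_sphere smul" for i using \<tau>(1) hS \<psi>0 by (simp add: \<psi>_def)
    show "summable (\<lambda>i. norm (d i))" using norm_sums by (rule sums_summable)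
    fix x
    have "(\<Sum>i<card S. c (h i) * \<psi> i x ^ N) = (\<Sum>i<card S. c (h i) * h i x ^ N)"
      by (intro sum.cong) (auto simp: \<psi>_def \<tau>(2) hS)
    then show "(\<lambda>i. d i * \<psi> i x ^ N) sums ?Q x"
      using sums_h[of "\<lambda>a i. a * \<psi> i x ^ N"] reindex[of "\<lambda>\<phi>. c \<phi> * \<phi> x ^ N"] by simp
  qed
  have lower: "(\<Sum>\<phi>\<in>S. norm (c \<phi>)) \<le> (\<Sum>i. norm (d' i))" if r: "nuclear_representation smul N ?Q \<psi>' d'" for \<psi>' d'
  proof -
    \<comment> \<open>The value at \<open>f\<close> depends only on the polynomial, so every
      representation gives the sum of the moduli there; \<open>nrm f \<le> 1\<close> turns this into
      a lower bound for its cost.\<close>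
    have "(\<Sum>i. d' i * f (\<psi>' i)) = (\<Sum>\<phi>\<in>S. c \<phi> * f \<phi>)"
      by (rule functional_ext[OF nuclear_representation_functional(1)[OF r] fS _ f(1)])
        (simp add: nuclear_representation_functional(2)[OF r] val)
    also have "\<dots> = of_real (\<Sum>\<phi>\<in>S. norm (c \<phi>))" using peak(2) by simp
    finally have eq: "(\<Sum>i. d' i * f (\<psi>' i)) = of_real (\<Sum>\<phi>\<in>S. norm (c \<phi>))" .
    have "(\<Sum>\<phi>\<in>S. norm (c \<phi>)) = norm (\<Sum>i. d' i * f (\<psi>' i))"
      unfolding eq norm_of_real by (simp add: sum_nonneg)
    also have "\<dots> \<le> (\<Sum>i. norm (d' i)) * nrm f" by (rule nuclear_representation_functional(3)[OF r f(1)])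
    also have "\<dots> \<le> (\<Sum>i. norm (d' i)) * 1"
      using f(2) r by (intro mult_left_mono suminf_nonneg) (auto simp: nuclear_representation_def)
    finally show ?thesis by simp
  qed
  have sum_d: "(\<Sum>i. norm (d i)) = (\<Sum>\<phi>\<in>S. norm (c \<phi>))" using sums_unique[OF norm_sums] by simp
  have "nuclear_norm smul N ?Q = (\<Sum>i. norm (d i))"
    unfolding nuclear_norm_def
  proof (rule cInf_eq_minimum)
    show "(\<Sum>i. norm (d i)) \<in> {\<Sum>i. norm (c i) |\<phi> c. nuclear_representation smul N ?Q \<phi> c}"
      using rep by blast
  qed (use lower sum_d in auto)
  then show "?Q \<in> NA_nu smul N"
    unfolding NA_nu_def nuclear_polynomials_def using hom rep by auto
qed

section \<open>The two density statements\<close>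

lemma weak_star_density:
  "weak_star_topology smul N closure_of NA_nu smul N = integral_polynomials smul N"
proof (intro equalityI subsetI)
  have top: "topspace (weak_star_topology smul N) = integral_polynomials smul N"
    by (auto simp: weak_star_topology_def topspace_pullback_topology)
  show "P \<in> integral_polynomials smul N" if "P \<in> weak_star_topology smul N closure_of NA_nu smul N" for P
    using that top by (simp add: in_closure_of)
  fix P assume P: "P \<in> integral_polynomials smul N"
  obtain L where L: "functional L" "\<And>x. L (pow x) = P x" using integral_polynomial_functional[OF P] by blast
  obtain C where C: "C \<ge> 0" "\<And>g. g \<in> Y \<Longrightarrow> norm (L g) \<le> C * nrm g" using functional_bound[OF L(1)] by blast
  show "P \<in> weak_star_topology smul N closure_of NA_nu smul N"
    unfolding in_closure_of top
  proof (intro conjI allI impI P)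
    fix T assume T: "P \<in> T \<and> openin (weak_star_topology smul N) T"
    then obtain U where U: "openin (product_topology (\<lambda>_. euclidean) Y) U"
      "T = (\<lambda>P. restrict (pairing smul N P) Y) -` U \<inter> integral_polynomials smul N"
      unfolding weak_star_topology_def openin_pullback_topology by blast
    then have "restrict (pairing smul N P) Y \<in> U" using T by auto
    from product_topology_open_contains_basis[OF U(1) this]
    obtain X where "restrict (pairing smul N P) Y \<in> PiE Y X \<and> (\<forall>g. openin euclidean (X g)) \<and>
        finite {g. X g \<noteq> topspace euclidean} \<and> PiE Y X \<subseteq> U" ..
    then have X: "restrict (pairing smul N P) Y \<in> PiE Y X" "\<And>g. open (X g)"
      "finite {g. X g \<noteq> UNIV}" "PiE Y X \<subseteq> U" by auto
    define G where "G = {g. X g \<noteq> UNIV} \<inter> Y"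
    have G: "finite G" "G \<subseteq> Y" using X(3) by (auto simp: G_def)
    have "\<exists>\<delta>>0. ball (L g) \<delta> \<subseteq> X g" if "g \<in> G" for g
    proof -
      have "pairing smul N P g \<in> X g" using X(1) that G(2) by (auto simp: PiE_iff)
      then have "L g \<in> X g" using pairing_eq[OF L] that G(2) by auto
      then show ?thesis using X(2)[of g] by (auto simp: open_contains_ball)
    qed
    then obtain \<delta> where \<delta>: "\<And>g. g \<in> G \<Longrightarrow> \<delta> g > 0 \<and> ball (L g) (\<delta> g) \<subseteq> X g" by metis
    \<comment> \<open>Inserting 1 keeps the minimum defined when \<open>G\<close> is empty.\<close>
    define d where "d = Min (insert 1 (\<delta> ` G))"
    have d: "d > 0" "\<And>g. g \<in> G \<Longrightarrow> d \<le> \<delta> g" using G(1) \<delta> by (auto simp: d_def)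
    obtain f S c where fSc: "peak_sum f S c" "\<And>g. g \<in> G \<Longrightarrow> norm (L g - (\<Sum>t\<in>S. c t * g t)) < d"
      using functional_weak_approx[OF L(1) C G d(1)] by blast
    let ?Q = "\<lambda>x. \<Sum>\<phi>\<in>S. c \<phi> * \<phi> x ^ N"
    have Q: "pairing smul N ?Q g = (\<Sum>t\<in>S. c t * g t)" if "g \<in> Y" for g
      by (rule pairing_eq[OF peak_sum_polynomial(3)[OF fSc(1)] peak_sum_polynomial(4)[OF fSc(1)] that])
    have "pairing smul N ?Q g \<in> X g" if g: "g \<in> Y" for g
    proof (cases "g \<in> G")
      case True
      then have "dist (L g) (pairing smul N ?Q g) < \<delta> g" using fSc(2)[OF True] d(2)[OF True] Q[OF g] by (simp add: dist_norm)
      then show ?thesis using \<delta>[OF True] by auto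
    next
      case False
      then show ?thesis using g by (simp add: G_def)
    qed
    then have "restrict (pairing smul N ?Q) Y \<in> U" using X(4) by (auto simp: PiE_iff)
    then have "?Q \<in> T" using U(2) peak_sum_polynomial(2)[OF fSc(1)] by simp
    then show "\<exists>Q. Q \<in> NA_nu smul N \<and> Q \<in> T" using peak_sum_polynomial(1)[OF fSc(1)] by blast
  qed
qed

lemma norm_density:
  assumes no_ell1: "\<not> contains_ell1 Y (ball_norm smul)"
    and P: "P \<in> integral_polynomials smul N" and \<epsilon>: "\<epsilon> > 0"
  obtains Q where "Q \<in> NA_nu smul N" "integral_norm smul N (\<lambda>x. P x - Q x) < \<epsilon>"
proof -
  have no_ell1': "\<not> contains_ell1 Y nrm" using no_ell1 by (simp add: nrm_eq)
  obtain e where e: "e > 0" "ennreal e \<le> \<epsilon>" using ennreal_real_below[OF \<epsilon>] .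
  obtain L where L: "functional L" "\<And>x. L (pow x) = P x" using integral_polynomial_functional[OF P] by blast
  obtain C where C: "C \<ge> 0" "\<And>g. g \<in> Y \<Longrightarrow> norm (L g) \<le> C * nrm g" using functional_bound[OF L(1)] by blast
  \<comment> \<open>The passage to the integral norm doubles the error and the final inequality is
    strict, hence a quarter.\<close>
  have "e / 4 > 0" using e by simp
  obtain f S c where fSc: "peak_sum f S c" "\<And>g. g \<in> Y \<Longrightarrow> norm (L g - (\<Sum>t\<in>S. c t * g t)) \<le> e / 4 * nrm g"
    by (rule functional_norm_approx[OF no_ell1' L(1) C \<open>e / 4 > 0\<close>]) (assumption | rule that)+
  let ?Q = "\<lambda>x. \<Sum>\<phi>\<in>S. c \<phi> * \<phi> x ^ N"
  have "integral_norm smul N (\<lambda>x. L (pow x) - (\<Sum>t\<in>S. c t * pow x t)) \<le> ennreal (2 * (e / 4))"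
    by (rule small_functional_integral_norm[OF no_ell1' functional_minus[OF L(1) peak_sum_polynomial(3)[OF fSc(1)]] \<open>e / 4 > 0\<close> fSc(2)])
  also have "(\<lambda>x. L (pow x) - (\<Sum>t\<in>S. c t * pow x t)) = (\<lambda>x. P x - ?Q x)"
    by (simp add: L(2) peak_sum_polynomial(4)[OF fSc(1)])
  finally have "integral_norm smul N (\<lambda>x. P x - ?Q x) \<le> ennreal (2 * (e / 4))" .
  also have "\<dots> < ennreal e" using e(1) by (simp add: ennreal_less_iff)
  also have "\<dots> \<le> \<epsilon>" by (rule e(2))
  finally show thesis by (rule that[OF peak_sum_polynomial(1)[OF fSc(1)]])
qed

end

theorem theorem2p4:
  fixes smul :: "'k::real_or_complex \<Rightarrow> 'a::banach \<Rightarrow> 'a" and N :: nat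
  assumes "banach_space_over smul"
    and "\<exists>x :: 'a. x \<noteq> 0"
  shows "weak_star_topology smul N closure_of NA_nu smul N = integral_polynomials smul N \<and>
    (\<not> contains_ell1 (sym_inj_tensor_product smul N) (ball_norm smul) \<longrightarrow>
      (\<forall>P \<in> integral_polynomials smul N. \<forall>\<epsilon>>0. \<exists>Q \<in> NA_nu smul N.
         integral_norm smul N (\<lambda>x. P x - Q x) < \<epsilon>))"
proof -
  interpret banach_space_over smul by (rule assms(1))
  interpret polynomial_space smul N by unfold_locales (rule assms(2))
  show ?thesis using weak_star_density norm_density by blast
qed

end
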